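(* Let $\varphi\colon R\to T$ be a homomorphism of commutative rings. (1) If $T$ is flat as an $R$-module, then for every $T$-module $L$ (regarded as an $R$-module via $\varphi$), $\mathrm{FT}\text{-}\mathrm{fd}_R L\le \mathrm{FT}\text{-}\mathrm{fd}_T L$. (2) For every $T$-module $L$ (regarded as an $R$-module via $\varphi$), $\mathrm{FT}\text{-}\mathrm{fd}_R L\le \mathrm{FT}\text{-}\mathrm{fd}_T L+\mathrm{FT}\text{-}\mathrm{fd}_R T$.
   Context: All rings are commutative with identity. For a ring $R$, $\mathcal{FPR}(R)$ is the class of $R$-modules $M$ admitting an exact sequence $0\to P_n\to\cdots\to P_1\to P_0\to M\to 0$ (some $n\ge 0$) with every $P_i$ a finitely generated projective $R$-module. An $R$-module $M$ is called FT-flat if $\mathrm{Tor}_1^R(N,M)=0$ for every $N\in\mathcal{FPR}(R)$. One writes $\mathrm{FT}\text{-}\mathrm{fd}_R M\le n$ (for an integer $n\ge 0$) if there is an exact sequence $0\to P_n\to\cdots\to P_1\to P_0\to M\to 0$ with every $P_i$ an FT-flat $R$-module; $\mathrm{FT}\text{-}\mathrm{fd}_R M$ is the least such $n$, and is $\infty$ if no such $n$ exists. *)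

theory Defs
  imports
    "HOL-Algebra.AbelCoset"
    "HOL-Algebra.Module"
    "HOL-Algebra.Generated_Groups"
    "HOL-Algebra.Elementary_Groups"
    "HOL-Algebra.Free_Abelian_Groups"
    "HOL-Library.Extended_Nat"
begin

text \<open>Modules are those of HOL-Algebra: explicit carriers over a (possibly zero) \<open>cring\<close>.
  The fields \<open>mult\<close> and \<open>one\<close> that a module record inherits from rings carry no meaning.\<close>


section \<open>The types over which auxiliary modules range\<close>

text \<open>
  The notions "projective", "flat", "FPR", "FT-flat" and "FT-fd" quantify over all modules, whereas
  a HOL formula can only quantify over the modules whose elements belong to one fixed type.
  Below, whenever a notion concerns an \<open>R\<close>-module with elements of type \<open>'m\<close>, where \<open>R\<close> has elements
  of type \<open>'r\<close>, the modules quantified over have elements of type \<open>('r, 'm) formal\<close>.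
  This type consists of formal elements obtained from those of \<open>'m\<close> by iterating the
  formation of finite linear combinations. Its cardinality is the maximum of those of
  \<open>'r\<close>, \<open>'m\<close> and the natural numbers. Hence it contains a copy of the module itself, of all finitely
  generated \<open>R\<close>-modules, of the free \<open>R\<close>-module on any subset of \<open>('r, 'm) formal\<close>
  (see \<open>finite_support_embeds_in_formal\<close>), and of all subquotients of these. In particular all
  syzygies in a free resolution of the module fit.

  No notion changes by admitting larger modules:
  projectivity can be tested on a surjection from a free module onto the given module;
  flatness can be tested on the inclusions of ideals of \<open>R\<close>;
  all modules in a finite resolution by finitely generated projectives are finitely generated;
  and if a module has an FT-flat resolution of length \<open>n\<close>, then its \<open>n\<close>-th syzygy in any free
  resolution is FT-flat.
\<close>

datatype ('r, 'm) formal = Gen 'm | Comb "('r \<times> ('r, 'm) formal) list"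

lemma finite_support_embeds_in_formal:
  "\<exists>e :: (('r, 'm) formal \<Rightarrow> 'r) \<Rightarrow> ('r, 'm) formal. inj_on e {f. finite {x. f x \<noteq> z}}"
proof -
  define supp where "supp f = (SOME xs. set xs = {x. f x \<noteq> z})" for f :: "('r, 'm) formal \<Rightarrow> 'r"
  have supp: "set (supp f) = {x. f x \<noteq> z}" if "finite {x. f x \<noteq> z}" for f
    unfolding supp_def using finite_list[OF that] by (rule someI_ex)
  define e where "e f = Comb (map (\<lambda>x. (f x, x)) (supp f))" for f
  have "inj_on e {f. finite {x. f x \<noteq> z}}"
  proof (rule inj_onI)
    fix f g assume fin: "f \<in> {f. finite {x. f x \<noteq> z}}" "g \<in> {f. finite {x. f x \<noteq> z}}"
      and "e f = e g"
    then have eq: "map (\<lambda>x. (f x, x)) (supp f) = map (\<lambda>x. (g x, x)) (supp g)"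
      by (simp add: e_def)
    from arg_cong[OF this, of "map snd"] have supps: "supp f = supp g"
      by (simp add: comp_def)
    show "f = g"
    proof
      fix x show "f x = g x"
      proof (cases "x \<in> set (supp f)")
        case True
        with eq supps show ?thesis by auto
      next
        case False
        then have "x \<notin> {x. f x \<noteq> z}" "x \<notin> {x. g x \<noteq> z}"
          using supp[of f] supp[of g] fin supps by auto
        then show ?thesis by simp
      qed
    qed
  qed
  then show ?thesis by blast
qed


section \<open>Basic module theory\<close>

definition module_hom ::
  "('r, 'x) ring_scheme \<Rightarrow> ('r, 'a, 'y) module_scheme \<Rightarrow> ('r, 'b, 'z) module_scheme \<Rightarrow> ('a \<Rightarrow> 'b) set"
  where "module_hom R A B =
    {f \<in> carrier A \<rightarrow> carrier B.
      (\<forall>x\<in>carrier A. \<forall>y\<in>carrier A. f (x \<oplus>\<^bsub>A\<^esub> y) = f x \<oplus>\<^bsub>B\<^esub> f y) \<and>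
      (\<forall>r\<in>carrier R. \<forall>x\<in>carrier A. f (r \<odot>\<^bsub>A\<^esub> x) = r \<odot>\<^bsub>B\<^esub> f x)}"

definition ring_as_module :: "('r, 'x) ring_scheme \<Rightarrow> ('r, 'r) module"
  where "ring_as_module R =
    \<lparr>carrier = carrier R, mult = (\<otimes>\<^bsub>R\<^esub>), one = \<one>\<^bsub>R\<^esub>, ring.zero = \<zero>\<^bsub>R\<^esub>, ring.add = (\<oplus>\<^bsub>R\<^esub>),
     smult = (\<otimes>\<^bsub>R\<^esub>)\<rparr>"

definition restrict_scalars :: "('r \<Rightarrow> 't) \<Rightarrow> ('t, 'm, 'x) module_scheme \<Rightarrow> ('r, 'm) module"
  where "restrict_scalars \<phi> M =
    \<lparr>carrier = carrier M, mult = (\<otimes>\<^bsub>M\<^esub>), one = \<one>\<^bsub>M\<^esub>, ring.zero = \<zero>\<^bsub>M\<^esub>, ring.add = (\<oplus>\<^bsub>M\<^esub>),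
     smult = (\<lambda>r x. \<phi> r \<odot>\<^bsub>M\<^esub> x)\<rparr>"

definition finitely_generated :: "('r, 'x) ring_scheme \<Rightarrow> ('r, 'm, 'y) module_scheme \<Rightarrow> bool"
  where "finitely_generated R M \<longleftrightarrow>
    (\<exists>S. finite S \<and> S \<subseteq> carrier M \<and>
      (\<forall>x\<in>carrier M. \<exists>c\<in>S \<rightarrow> carrier R. x = (\<Oplus>\<^bsub>M\<^esub>s\<in>S. c s \<odot>\<^bsub>M\<^esub> s)))"

definition projective_module :: "('r, 'x) ring_scheme \<Rightarrow> ('r, 'm, 'y) module_scheme \<Rightarrow> bool"
  where "projective_module R P \<longleftrightarrow> Module.module R P \<and>
    (\<forall>(A :: ('r, ('r, 'm) formal) module) (B :: ('r, ('r, 'm) formal) module).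
      Module.module R A \<longrightarrow> Module.module R B \<longrightarrow>
      (\<forall>g\<in>module_hom R A B. g ` carrier A = carrier B \<longrightarrow>
        (\<forall>f\<in>module_hom R P B. \<exists>h\<in>module_hom R P A. \<forall>x\<in>carrier P. g (h x) = f x)))"

definition fg_projective :: "('r, 'x) ring_scheme \<Rightarrow> ('r, 'm, 'y) module_scheme \<Rightarrow> bool"
  where "fg_projective R P \<longleftrightarrow> finitely_generated R P \<and> projective_module R P"

text \<open>\<open>resolution \<C> R M n P d \<epsilon>\<close>: the sequence
  \<open>0 \<rightarrow> P n \<rightarrow> \<dots> \<rightarrow> P 1 \<rightarrow> P 0 \<rightarrow> M \<rightarrow> 0\<close> with maps \<open>d i : P i \<rightarrow> P (i - 1)\<close> for \<open>1 \<le> i \<le> n\<close> and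
  \<open>\<epsilon> : P 0 \<rightarrow> M\<close> is an exact sequence of \<open>R\<close>-modules, and all \<open>P i\<close> satisfy \<open>\<C>\<close>.
  Values of \<open>P\<close> and \<open>d\<close> at indices outside this range are ignored.\<close>

definition resolution ::
  "(('r, 'p) module \<Rightarrow> bool) \<Rightarrow> ('r, 'x) ring_scheme \<Rightarrow> ('r, 'm, 'y) module_scheme \<Rightarrow> nat \<Rightarrow>
   (nat \<Rightarrow> ('r, 'p) module) \<Rightarrow> (nat \<Rightarrow> 'p \<Rightarrow> 'p) \<Rightarrow> ('p \<Rightarrow> 'm) \<Rightarrow> bool"
  where "resolution \<C> R M n P d \<epsilon> \<longleftrightarrow>
    Module.module R M \<and>
    (\<forall>i\<le>n. Module.module R (P i) \<and> \<C> (P i)) \<and>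
    \<epsilon> \<in> module_hom R (P 0) M \<and>
    (\<forall>i\<in>{1..n}. d i \<in> module_hom R (P i) (P (i - 1))) \<and>
    \<epsilon> ` carrier (P 0) = carrier M \<and>
    (let image_into = (\<lambda>i. if i = n then {\<zero>\<^bsub>P i\<^esub>} else d (Suc i) ` carrier (P (Suc i)))
     in a_kernel (P 0) M \<epsilon> = image_into 0 \<and>
        (\<forall>i\<in>{1..n}. a_kernel (P i) (P (i - 1)) (d i) = image_into i))"

definition FPR :: "('r, 'x) ring_scheme \<Rightarrow> ('r, 'm, 'y) module_scheme \<Rightarrow> bool"
  where "FPR R M \<longleftrightarrow>
    (\<exists>n (P :: nat \<Rightarrow> ('r, ('r, 'm) formal) module) d \<epsilon>. resolution (fg_projective R) R M n P d \<epsilon>)"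


section \<open>Tensor products and flatness\<close>

definition tensor_relations ::
  "('r, 'x) ring_scheme \<Rightarrow> ('r, 'a, 'y) module_scheme \<Rightarrow> ('r, 'b, 'z) module_scheme \<Rightarrow>
   ('a \<times> 'b \<Rightarrow>\<^sub>0 int) set"
  where "tensor_relations R A B =
    {frag_of (a \<oplus>\<^bsub>A\<^esub> a', b) - frag_of (a, b) - frag_of (a', b) | a a' b.
       a \<in> carrier A \<and> a' \<in> carrier A \<and> b \<in> carrier B} \<union>
    {frag_of (a, b \<oplus>\<^bsub>B\<^esub> b') - frag_of (a, b) - frag_of (a, b') | a b b'.
       a \<in> carrier A \<and> b \<in> carrier B \<and> b' \<in> carrier B} \<union>
    {frag_of (r \<odot>\<^bsub>A\<^esub> a, b) - frag_of (a, r \<odot>\<^bsub>B\<^esub> b) | r a b.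
       r \<in> carrier R \<and> a \<in> carrier A \<and> b \<in> carrier B}"

definition tensor_kernel ::
  "('r, 'x) ring_scheme \<Rightarrow> ('r, 'a, 'y) module_scheme \<Rightarrow> ('r, 'b, 'z) module_scheme \<Rightarrow>
   ('a \<times> 'b \<Rightarrow>\<^sub>0 int) set"
  where "tensor_kernel R A B =
    generate (free_Abelian_group (carrier A \<times> carrier B)) (tensor_relations R A B)"

text \<open>Only the abelian group underlying the tensor product over \<open>R\<close> is needed. It is written
  multiplicatively, as all groups of HOL-Algebra.\<close>

definition tensor ::
  "('r, 'x) ring_scheme \<Rightarrow> ('r, 'a, 'y) module_scheme \<Rightarrow> ('r, 'b, 'z) module_scheme \<Rightarrow>
   ('a \<times> 'b \<Rightarrow>\<^sub>0 int) set monoid"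
  where "tensor R A B = free_Abelian_group (carrier A \<times> carrier B) Mod tensor_kernel R A B"

text \<open>The map \<open>f \<otimes> id : A \<otimes> M \<rightarrow> B \<otimes> M\<close> induced by \<open>f : A \<rightarrow> B\<close>. Its argument \<open>X\<close> is a coset; all
  elements of \<open>X\<close> yield the same coset in \<open>B \<otimes> M\<close>.\<close>

definition tensor_map ::
  "('r, 'x) ring_scheme \<Rightarrow> ('r, 'b, 'y) module_scheme \<Rightarrow> ('r, 'm, 'z) module_scheme \<Rightarrow> ('a \<Rightarrow> 'b) \<Rightarrow>
   ('a \<times> 'm \<Rightarrow>\<^sub>0 int) set \<Rightarrow> ('b \<times> 'm \<Rightarrow>\<^sub>0 int) set"
  where "tensor_map R B M f X =
    the_elem ((\<lambda>c. tensor_kernel R B M #>\<^bsub>free_Abelian_group (carrier B \<times> carrier M)\<^esub>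
                    frag_extend (\<lambda>(a, m). frag_of (f a, m)) c) ` X)"

definition flat_module :: "('r, 'x) ring_scheme \<Rightarrow> ('r, 'm, 'y) module_scheme \<Rightarrow> bool"
  where "flat_module R M \<longleftrightarrow> Module.module R M \<and>
    (\<forall>(A :: ('r, ('r, 'm) formal) module) (B :: ('r, ('r, 'm) formal) module).
      Module.module R A \<longrightarrow> Module.module R B \<longrightarrow>
      (\<forall>f\<in>module_hom R A B. inj_on f (carrier A) \<longrightarrow>
        inj_on (tensor_map R B M f) (carrier (tensor R A M))))"


section \<open>Tor and FT-flat dimension\<close>

text \<open>The free \<open>R\<close>-module on \<open>X\<close>, as the module of finitely supported functions.\<close>

definition free_module :: "('r, 'x) ring_scheme \<Rightarrow> 'a set \<Rightarrow> ('r, 'a \<Rightarrow> 'r) module"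
  where "free_module R X =
    \<lparr>carrier = {f. (\<forall>x\<in>X. f x \<in> carrier R) \<and> (\<forall>x. x \<notin> X \<longrightarrow> f x = \<zero>\<^bsub>R\<^esub>) \<and> finite {x. f x \<noteq> \<zero>\<^bsub>R\<^esub>}},
     mult = undefined, one = undefined,
     ring.zero = (\<lambda>x. \<zero>\<^bsub>R\<^esub>), ring.add = (\<lambda>f g x. f x \<oplus>\<^bsub>R\<^esub> g x), smult = (\<lambda>r f x. r \<otimes>\<^bsub>R\<^esub> f x)\<rparr>"

text \<open>\<open>cover R M\<close> is the free module on the elements of \<open>M\<close>, \<open>cover_map R M\<close> its canonical surjection
  onto \<open>M\<close>, and \<open>syzygy R M\<close> the kernel of the latter. Iteration gives the canonical free resolution
  of \<open>M\<close>: with \<open>K\<^sub>0 = syzygy R M\<close>, \<open>K\<^sub>1 = syzygy R K\<^sub>0\<close> and so on, it reads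
  \<open>\<dots> \<rightarrow> cover R K\<^sub>1 \<rightarrow> cover R K\<^sub>0 \<rightarrow> cover R M \<rightarrow> M \<rightarrow> 0\<close>, where \<open>cover R K\<^sub>i\<close> maps onto
  \<open>K\<^sub>i\<close>, which is contained in the preceding free module.\<close>

definition cover :: "('r, 'x) ring_scheme \<Rightarrow> ('r, 'm, 'y) module_scheme \<Rightarrow> ('r, 'm \<Rightarrow> 'r) module"
  where "cover R M = free_module R (carrier M)"

definition cover_map :: "('r, 'x) ring_scheme \<Rightarrow> ('r, 'm, 'y) module_scheme \<Rightarrow> ('m \<Rightarrow> 'r) \<Rightarrow> 'm"
  where "cover_map R M f = (\<Oplus>\<^bsub>M\<^esub>x\<in>{x \<in> carrier M. f x \<noteq> \<zero>\<^bsub>R\<^esub>}. f x \<odot>\<^bsub>M\<^esub> x)"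

definition syzygy :: "('r, 'x) ring_scheme \<Rightarrow> ('r, 'm, 'y) module_scheme \<Rightarrow> ('r, 'm \<Rightarrow> 'r) module"
  where "syzygy R M = (cover R M)\<lparr>carrier := a_kernel (cover R M) M (cover_map R M)\<rparr>"

text \<open>The first homology group of the canonical free resolution of \<open>N\<close> tensored with \<open>M\<close>.\<close>

definition Tor1 ::
  "('r, 'x) ring_scheme \<Rightarrow> ('r, 'n, 'y) module_scheme \<Rightarrow> ('r, 'm, 'z) module_scheme \<Rightarrow>
   (((('n \<Rightarrow> 'r) \<Rightarrow> 'r) \<times> 'm) \<Rightarrow>\<^sub>0 int) set set monoid"
  where "Tor1 R N M =
    (let K0 = syzygy R N; K1 = syzygy R K0;
         F0 = cover R N; F1 = cover R K0; F2 = cover R K1;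
         d1 = tensor_map R F0 M (cover_map R K0);
         d2 = tensor_map R F1 M (cover_map R K1)
     in (tensor R F1 M)\<lparr>carrier := kernel (tensor R F1 M) (tensor R F0 M) d1\<rparr>
          Mod (d2 ` carrier (tensor R F2 M)))"

definition FT_flat :: "('r, 'x) ring_scheme \<Rightarrow> ('r, 'm, 'y) module_scheme \<Rightarrow> bool"
  where "FT_flat R M \<longleftrightarrow> Module.module R M \<and>
    (\<forall>N :: ('r, ('r, 'm) formal) module. FPR R N \<longrightarrow> trivial_group (Tor1 R N M))"

definition FT_fd_le :: "('r, 'x) ring_scheme \<Rightarrow> ('r, 'm, 'y) module_scheme \<Rightarrow> nat \<Rightarrow> bool"
  where "FT_fd_le R M n \<longleftrightarrow>
    (\<exists>(P :: nat \<Rightarrow> ('r, ('r, 'm) formal) module) d \<epsilon>. resolution (FT_flat R) R M n P d \<epsilon>)"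

text \<open>In \<open>enat\<close> the infimum of the empty set is \<open>\<infinity>\<close>.\<close>

definition FT_fd :: "('r, 'x) ring_scheme \<Rightarrow> ('r, 'm, 'y) module_scheme \<Rightarrow> enat"
  where "FT_fd R M = Inf (enat ` {n. FT_fd_le R M n})"

end

theory Submission
  imports Defs
begin

text \<open>
  A module in \<open>FPR\<close> is presented by finite data: idempotent matrices for the projectives and matrices for the
  differentials. With coefficients in a module \<open>M\<close> these data give a complex of tuples in \<open>M\<close> whose homology is
  Tor, and by dimension shifting \<open>FT_fd R M \<le> m\<close> holds iff, for all such data over \<open>R\<close>, this homology vanishes
  in the degrees above \<open>m\<close>.

  Let \<open>FT_fd R T \<le> m\<close> and \<open>FT_fd T L \<le> n\<close>. The image under \<open>\<phi>\<close> of a matrix resolution over \<open>R\<close> has no homology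
  over \<open>T\<close> above degree \<open>m\<close>. Hence its part from degree \<open>m\<close> on is a matrix resolution over \<open>T\<close>, and so has no
  homology with coefficients in \<open>L\<close> above degree \<open>n\<close>. But \<open>R\<close> acts on \<open>L\<close> through \<open>\<phi>\<close>, so this is the homology
  of the original data with coefficients in \<open>L\<close>, shifted by \<open>m\<close>. If \<open>T\<close> is flat over \<open>R\<close>, then one can take \<open>m = 0\<close>.
\<close>

section \<open>Modules and homomorphisms\<close>

text \<open>The defining notions quantify over auxiliary modules whose type depends on that of the
  module under study, so an assumption about the \<open>T\<close>-module \<open>L\<close> cannot be
  applied directly to modules built from \<open>R\<close>. Matrices remove this obstacle: their
  entries lie in the ring alone, and \<open>mexact\<close> speaks only of sums and of the scalar
  action in \<open>M\<close>. Hence the right-hand side of \<open>FT_fd_le_iff\<close> is free of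
  auxiliary types, base-changed \<open>T\<close>-modules are never formed, and base change just
  means applying \<open>\<phi>\<close> to the entries. Idempotents are carried along because the
  terms of a resolution are projective rather than free. Exactness in degree 0 is left out of
  \<open>fp_resolution\<close> so that dropping the first \<open>m\<close> terms again gives a
  resolution, namely of a cokernel; consequently vanishing in degree one for all data already gives
  vanishing in all positive degrees. The price is paid in transfers between types: test modules for
  \<open>FT_flat\<close> have to be realised inside \<open>formal\<close>, and so have the syzygies
  that make up a resolution.\<close>

lemma module_homI:
  assumes "\<And>x. x \<in> carrier A \<Longrightarrow> f x \<in> carrier B"
    and "\<And>x y. x \<in> carrier A \<Longrightarrow> y \<in> carrier A \<Longrightarrow> f (x \<oplus>\<^bsub>A\<^esub> y) = f x \<oplus>\<^bsub>B\<^esub> f y"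
    and "\<And>r x. r \<in> carrier R \<Longrightarrow> x \<in> carrier A \<Longrightarrow> f (r \<odot>\<^bsub>A\<^esub> x) = r \<odot>\<^bsub>B\<^esub> f x"
  shows "f \<in> module_hom R A B"
  using assms by (auto simp: module_hom_def)

lemma module_hom_closed: "f \<in> module_hom R A B \<Longrightarrow> x \<in> carrier A \<Longrightarrow> f x \<in> carrier B"
  by (auto simp: module_hom_def)

lemma module_hom_add:
  "f \<in> module_hom R A B \<Longrightarrow> x \<in> carrier A \<Longrightarrow> y \<in> carrier A \<Longrightarrow> f (x \<oplus>\<^bsub>A\<^esub> y) = f x \<oplus>\<^bsub>B\<^esub> f y"
  by (auto simp: module_hom_def)

lemma module_hom_smult:
  "f \<in> module_hom R A B \<Longrightarrow> r \<in> carrier R \<Longrightarrow> x \<in> carrier A \<Longrightarrow> f (r \<odot>\<^bsub>A\<^esub> x) = r \<odot>\<^bsub>B\<^esub> f x"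
  by (auto simp: module_hom_def)

lemma module_hom_comp:
  "f \<in> module_hom R A B \<Longrightarrow> g \<in> module_hom R B C \<Longrightarrow> (\<lambda>x. g (f x)) \<in> module_hom R A C"
  by (auto simp: module_hom_def Pi_iff)

lemma module_hom_id: "(\<lambda>x. x) \<in> module_hom R A A"
  by (auto simp: module_hom_def)

lemma module_hom_zero:
  assumes "Module.module R A" "Module.module R B" "f \<in> module_hom R A B"
  shows "f \<zero>\<^bsub>A\<^esub> = \<zero>\<^bsub>B\<^esub>"
proof -
  interpret A: Module.module R A by fact
  interpret B: Module.module R B by fact
  have "f (\<zero>\<^bsub>R\<^esub> \<odot>\<^bsub>A\<^esub> \<zero>\<^bsub>A\<^esub>) = \<zero>\<^bsub>R\<^esub> \<odot>\<^bsub>B\<^esub> f \<zero>\<^bsub>A\<^esub>"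
    by (rule module_hom_smult[OF assms(3)]) auto
  then show ?thesis
    using module_hom_closed[OF assms(3) A.M.zero_closed] by simp
qed

lemma module_hom_minus:
  assumes "Module.module R A" "Module.module R B" "f \<in> module_hom R A B" "x \<in> carrier A"
  shows "f (\<ominus>\<^bsub>A\<^esub> x) = \<ominus>\<^bsub>B\<^esub> f x"
proof -
  interpret A: Module.module R A by fact
  interpret B: Module.module R B by fact
  have "f (\<ominus>\<^bsub>A\<^esub> x) \<oplus>\<^bsub>B\<^esub> f x = \<zero>\<^bsub>B\<^esub>"
    using assms(4) module_hom_zero[OF assms(1-3)]
    by (simp add: A.M.l_neg flip: module_hom_add[OF assms(3)])
  then show ?thesis
    using module_hom_closed[OF assms(3)] assms(4)
    by (metis A.M.a_inv_closed B.M.minus_equality)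
qed

lemma module_hom_diff:
  assumes "Module.module R A" "Module.module R B" "f \<in> module_hom R A B"
    "x \<in> carrier A" "y \<in> carrier A"
  shows "f (x \<ominus>\<^bsub>A\<^esub> y) = f x \<ominus>\<^bsub>B\<^esub> f y"
proof -
  interpret A: Module.module R A by fact
  show ?thesis
    using assms module_hom_minus[OF assms(1-3,5)]
    by (simp add: a_minus_def module_hom_add[OF assms(3)])
qed

lemma (in Module.module) module_hom_zero_map:
  "Module.module R A \<Longrightarrow> (\<lambda>x. \<zero>\<^bsub>M\<^esub>) \<in> module_hom R A M"
  by (auto simp: module_hom_def)

lemma (in Module.module) module_hom_add_map:
  assumes "f \<in> module_hom R A M" "g \<in> module_hom R A M"
  shows "(\<lambda>x. f x \<oplus>\<^bsub>M\<^esub> g x) \<in> module_hom R A M"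
  using assms by (auto simp: module_hom_def Pi_iff smult_r_distr M.a_ac)

lemma (in Module.module) smult_r_minus:
  "a \<in> carrier R \<Longrightarrow> x \<in> carrier M \<Longrightarrow> a \<odot>\<^bsub>M\<^esub> (\<ominus>\<^bsub>M\<^esub> x) = \<ominus>\<^bsub>M\<^esub> (a \<odot>\<^bsub>M\<^esub> x)"
  by (metis M.a_inv_closed M.l_neg M.minus_equality smult_closed smult_r_distr smult_r_null)

lemma (in Module.module) module_hom_diff_map:
  assumes f: "f \<in> module_hom R A M" and g: "g \<in> module_hom R A M"
  shows "(\<lambda>x. f x \<ominus>\<^bsub>M\<^esub> g x) \<in> module_hom R A M"
proof (rule module_homI)
  fix x y assume "x \<in> carrier A" "y \<in> carrier A"
  then show "f (x \<oplus>\<^bsub>A\<^esub> y) \<ominus>\<^bsub>M\<^esub> g (x \<oplus>\<^bsub>A\<^esub> y) = f x \<ominus>\<^bsub>M\<^esub> g x \<oplus>\<^bsub>M\<^esub> (f y \<ominus>\<^bsub>M\<^esub> g y)"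
    using module_hom_closed[OF f] module_hom_closed[OF g]
    by (simp add: module_hom_add[OF f] module_hom_add[OF g] a_minus_def M.minus_add M.a_ac)
qed (use module_hom_closed[OF f] module_hom_closed[OF g] in
  \<open>auto simp: module_hom_smult[OF f] module_hom_smult[OF g] a_minus_def smult_r_distr smult_r_minus\<close>)

lemma (in Module.module) diff_eq_zero_iff:
  "x \<in> carrier M \<Longrightarrow> y \<in> carrier M \<Longrightarrow> x \<ominus>\<^bsub>M\<^esub> y = \<zero>\<^bsub>M\<^esub> \<longleftrightarrow> x = y"
  by (metis M.a_inv_closed M.minus_equality M.minus_minus M.r_neg a_minus_def)

lemma (in Module.module) diff_zero: "x \<in> carrier M \<Longrightarrow> x \<ominus>\<^bsub>M\<^esub> \<zero>\<^bsub>M\<^esub> = x"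
  using diff_eq_zero_iff[of "\<zero>\<^bsub>M\<^esub>" "\<zero>\<^bsub>M\<^esub>"] by (simp add: a_minus_def)

lemma module_hom_kernel_module:
  assumes A: "Module.module R A" and B: "Module.module R B" and f: "f \<in> module_hom R A B"
  shows "Module.module R (A\<lparr>carrier := a_kernel A B f\<rparr>)"
proof -
  interpret A: Module.module R A by fact
  interpret B: Module.module R B by fact
  have "submodule (a_kernel A B f) R A"
    by (rule A.submoduleI)
      (use f module_hom_zero[OF A B f] module_hom_minus[OF A B f] in
        \<open>auto simp: a_kernel_def' module_hom_add module_hom_smult\<close>)
  then show ?thesis
    by (rule submodule.submodule_is_module[OF _ A])
qed

lemma module_hom_incl:
  "H \<subseteq> carrier A \<Longrightarrow> (\<lambda>x. x) \<in> module_hom R (A\<lparr>carrier := H\<rparr>) A"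
  by (auto simp: module_hom_def)

lemma module_hom_restrict:
  "f \<in> module_hom R A B \<Longrightarrow> H \<subseteq> carrier B \<Longrightarrow> f ` carrier A \<subseteq> H \<Longrightarrow> f \<in> module_hom R A (B\<lparr>carrier := H\<rparr>)"
  by (auto simp: module_hom_def)

lemma module_hom_restrict_source:
  "f \<in> module_hom R A B \<Longrightarrow> H \<subseteq> carrier A \<Longrightarrow> f \<in> module_hom R (A\<lparr>carrier := H\<rparr>) B"
  unfolding module_hom_def by (auto simp: subset_iff)

text \<open>The module structure transported along \<open>q\<close>: a copy of \<open>A\<close> if \<open>q\<close> is injective, and a quotient if
  \<open>q\<close> picks representatives. It moves modules into the types \<open>formal\<close> over which the definitions quantify.\<close>

definition image_module :: "('r, 'a, 'x) module_scheme \<Rightarrow> ('a \<Rightarrow> 'b) \<Rightarrow> ('r, 'b) module"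
  where "image_module A q =
    \<lparr>carrier = q ` carrier A, mult = undefined, one = undefined, ring.zero = q \<zero>\<^bsub>A\<^esub>,
     ring.add = (\<lambda>u v. q (inv_into (carrier A) q u \<oplus>\<^bsub>A\<^esub> inv_into (carrier A) q v)),
     smult = (\<lambda>r u. q (r \<odot>\<^bsub>A\<^esub> inv_into (carrier A) q u))\<rparr>"

lemma carrier_image_module [simp]: "carrier (image_module A q) = q ` carrier A"
  by (simp add: image_module_def)

text \<open>The congruence conditions say that the operations of \<open>A\<close> descend to the
  fibres of \<open>q\<close>. The representatives that \<open>inv_into\<close> picks may then be
  exchanged for any others, and the module axioms are inherited from \<open>A\<close>.\<close>

lemma image_module_quotient:
  assumes "Module.module R A"
    and congr_add: "\<And>x x' y y'. \<lbrakk>x \<in> carrier A; x' \<in> carrier A; y \<in> carrier A; y' \<in> carrier A;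
        q x = q x'; q y = q y'\<rbrakk> \<Longrightarrow> q (x \<oplus>\<^bsub>A\<^esub> y) = q (x' \<oplus>\<^bsub>A\<^esub> y')"
    and congr_smult: "\<And>r x x'. \<lbrakk>r \<in> carrier R; x \<in> carrier A; x' \<in> carrier A; q x = q x'\<rbrakk> \<Longrightarrow>
        q (r \<odot>\<^bsub>A\<^esub> x) = q (r \<odot>\<^bsub>A\<^esub> x')"
  shows "Module.module R (image_module A q)" "q \<in> module_hom R A (image_module A q)"
proof -
  interpret A: Module.module R A by fact
  let ?B = "image_module A q"
  have inv: "inv_into (carrier A) q (q x) \<in> carrier A" "q (inv_into (carrier A) q (q x)) = q x"
    if "x \<in> carrier A" for x
    using that by (simp_all add: inv_into_into f_inv_into_f)
  have add: "q x \<oplus>\<^bsub>?B\<^esub> q y = q (x \<oplus>\<^bsub>A\<^esub> y)" if "x \<in> carrier A" "y \<in> carrier A" for x y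
    using that inv by (auto simp: image_module_def intro!: congr_add)
  have smult: "r \<odot>\<^bsub>?B\<^esub> q x = q (r \<odot>\<^bsub>A\<^esub> x)" if "r \<in> carrier R" "x \<in> carrier A" for r x
    using that inv by (auto simp: image_module_def intro!: congr_smult)
  have zero: "\<zero>\<^bsub>?B\<^esub> = q \<zero>\<^bsub>A\<^esub>"
    by (simp add: image_module_def)
  have "abelian_group ?B"
  proof (rule abelian_groupI)
    fix x assume "x \<in> carrier ?B"
    then obtain a where a: "a \<in> carrier A" "x = q a" by auto
    then show "\<exists>y\<in>carrier ?B. y \<oplus>\<^bsub>?B\<^esub> x = \<zero>\<^bsub>?B\<^esub>"
      by (intro bexI[of _ "q (\<ominus>\<^bsub>A\<^esub> a)"]) (auto simp: add zero A.M.l_neg)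
  qed (auto simp: add zero A.M.a_ac)
  then show "Module.module R ?B"
    by (intro moduleI)
      (auto simp: add smult A.R.is_cring A.smult_l_distr A.smult_r_distr A.smult_assoc1)
  show "q \<in> module_hom R A ?B"
    by (rule module_homI) (auto simp: add smult)
qed

lemma image_module_inj:
  assumes "Module.module R A" and "inj_on q (carrier A)"
  shows "Module.module R (image_module A q)" "q \<in> module_hom R A (image_module A q)"
    "inv_into (carrier A) q \<in> module_hom R (image_module A q) A"
proof -
  interpret A: Module.module R A by fact
  have q: "q x = q y \<longleftrightarrow> x = y" if "x \<in> carrier A" "y \<in> carrier A" for x y
    using assms(2) that by (auto simp: inj_on_def)
  show "Module.module R (image_module A q)" "q \<in> module_hom R A (image_module A q)"
    by (rule image_module_quotient; use assms q in auto)+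
  show "inv_into (carrier A) q \<in> module_hom R (image_module A q) A"
    by (rule module_homI) (use assms(2) in \<open>auto simp: image_module_def\<close>)
qed

text \<open>Zero and negatives come from multiplication by \<open>\<zero>\<close> and by
  \<open>\<ominus> \<one>\<close>, so closure under sums and scalars makes the nonempty set
  \<open>H\<close> a submodule.\<close>

lemma module_submoduleI:
  assumes "Module.module R A" "H \<subseteq> carrier A" "H \<noteq> {}"
    "\<And>x y. x \<in> H \<Longrightarrow> y \<in> H \<Longrightarrow> x \<oplus>\<^bsub>A\<^esub> y \<in> H" "\<And>r x. r \<in> carrier R \<Longrightarrow> x \<in> H \<Longrightarrow> r \<odot>\<^bsub>A\<^esub> x \<in> H"
  shows "Module.module R (A\<lparr>carrier := H\<rparr>)"
proof -
  interpret A: Module.module R A by fact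
  obtain h where h: "h \<in> H" using assms(3) by auto
  have "\<ominus>\<^bsub>A\<^esub> x = (\<ominus>\<^bsub>R\<^esub> \<one>\<^bsub>R\<^esub>) \<odot>\<^bsub>A\<^esub> x" if "x \<in> H" for x
    using that assms(2) by (simp add: A.smult_l_minus subset_iff)
  moreover have "\<zero>\<^bsub>A\<^esub> = \<zero>\<^bsub>R\<^esub> \<odot>\<^bsub>A\<^esub> h"
    using h assms(2) by (simp add: subset_iff)
  ultimately have "submodule H R A"
    by (intro A.submoduleI) (use assms h in auto)
  then show ?thesis
    by (rule submodule.submodule_is_module[OF _ assms(1)])
qed

lemma image_submodule:
  assumes "Module.module R A" "Module.module R B" "f \<in> module_hom R A B"
  shows "Module.module R (B\<lparr>carrier := f ` carrier A\<rparr>)"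
proof -
  interpret A: Module.module R A by fact
  show ?thesis
    by (rule module_submoduleI[OF assms(2)])
      (use assms(3) in \<open>auto simp: module_hom_closed simp flip: module_hom_add module_hom_smult\<close>)
qed

section \<open>Sums and products over initial segments of the natural numbers\<close>

text \<open>One recursion serves the tensor products, which are written multiplicatively, and
  through \<open>add_monoid\<close> also the sums \<open>msum\<close> in modules. Since the index
  set always consists of the first \<open>n\<close> numbers, proofs are inductions on
  \<open>n\<close>.\<close>

primrec iprod :: "('a, 'x) monoid_scheme \<Rightarrow> (nat \<Rightarrow> 'a) \<Rightarrow> nat \<Rightarrow> 'a" where
  "iprod G f 0 = \<one>\<^bsub>G\<^esub>"
| "iprod G f (Suc n) = iprod G f n \<otimes>\<^bsub>G\<^esub> f n"

lemma iprod_cong: "(\<And>i. i < n \<Longrightarrow> f i = g i) \<Longrightarrow> iprod G f n = iprod G g n"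
  by (induction n) auto

context comm_group
begin

lemma iprod_closed: "(\<And>i. i < n \<Longrightarrow> f i \<in> carrier G) \<Longrightarrow> iprod G f n \<in> carrier G"
  by (induction n) auto

lemma iprod_one: "(\<And>i. i < n \<Longrightarrow> f i = \<one>) \<Longrightarrow> iprod G f n = \<one>"
  by (induction n) auto

lemma iprod_mult:
  assumes "\<And>i. i < n \<Longrightarrow> f i \<in> carrier G" "\<And>i. i < n \<Longrightarrow> g i \<in> carrier G"
  shows "iprod G (\<lambda>i. f i \<otimes> g i) n = iprod G f n \<otimes> iprod G g n"
  using assms by (induction n) (auto simp: iprod_closed m_ac)

lemma iprod_swap:
  assumes "\<And>i j. i < m \<Longrightarrow> j < n \<Longrightarrow> f i j \<in> carrier G"
  shows "iprod G (\<lambda>i. iprod G (f i) n) m = iprod G (\<lambda>j. iprod G (\<lambda>i. f i j) m) n"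
  using assms
proof (induction m)
  case 0
  then show ?case by (simp add: iprod_one)
next
  case (Suc m)
  then have "iprod G (\<lambda>i. iprod G (f i) n) (Suc m)
      = iprod G (\<lambda>j. iprod G (\<lambda>i. f i j) m) n \<otimes> iprod G (f m) n"
    by simp
  also have "\<dots> = iprod G (\<lambda>j. iprod G (\<lambda>i. f i j) m \<otimes> f m j) n"
    using Suc.prems by (intro iprod_mult[symmetric] iprod_closed) auto
  finally show ?case by simp
qed

lemma iprod_single:
  assumes "i < n" "x \<in> carrier G"
  shows "iprod G (\<lambda>j. if j = i then x else \<one>) n = x"
  using assms
proof (induction n)
  case (Suc n)
  show ?case
  proof (cases "i = n")
    case True
    then have "iprod G (\<lambda>j. if j = i then x else \<one>) n = \<one>"
      by (intro iprod_one) auto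
    with True Suc show ?thesis by simp
  qed (use Suc in auto)
qed simp

end

lemma hom_iprod:
  assumes "group G" "group H" "h \<in> hom G H" "\<And>i. i < n \<Longrightarrow> f i \<in> carrier G"
  shows "h (iprod G f n) = iprod H (\<lambda>i. h (f i)) n" and "iprod G f n \<in> carrier G"
proof -
  interpret group_hom G H h
    using assms by (simp add: group_hom_def group_hom_axioms_def)
  have "iprod G f n \<in> carrier G \<and> h (iprod G f n) = iprod H (\<lambda>i. h (f i)) n"
    using assms(4) by (induction n) auto
  then show "h (iprod G f n) = iprod H (\<lambda>i. h (f i)) n" "iprod G f n \<in> carrier G" by auto
qed

definition msum :: "('a, 'x) ring_scheme \<Rightarrow> (nat \<Rightarrow> 'a) \<Rightarrow> nat \<Rightarrow> 'a"
  where "msum M = iprod (add_monoid M)"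

lemma msum_0 [simp]: "msum M f 0 = \<zero>\<^bsub>M\<^esub>"
  and msum_Suc [simp]: "msum M f (Suc n) = msum M f n \<oplus>\<^bsub>M\<^esub> f n"
  by (simp_all add: msum_def)

lemma msum_cong: "(\<And>i. i < n \<Longrightarrow> f i = g i) \<Longrightarrow> msum M f n = msum M g n"
  unfolding msum_def by (rule iprod_cong)

context abelian_group
begin

lemma msum_closed: "(\<And>i. i < n \<Longrightarrow> f i \<in> carrier G) \<Longrightarrow> msum G f n \<in> carrier G"
  using comm_group.iprod_closed[OF a_comm_group] by (simp add: msum_def)

lemma msum_zero: "(\<And>i. i < n \<Longrightarrow> f i = \<zero>) \<Longrightarrow> msum G f n = \<zero>"
  using comm_group.iprod_one[OF a_comm_group] by (simp add: msum_def)

lemma msum_add: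
  assumes "\<And>i. i < n \<Longrightarrow> f i \<in> carrier G" "\<And>i. i < n \<Longrightarrow> g i \<in> carrier G"
  shows "msum G (\<lambda>i. f i \<oplus> g i) n = msum G f n \<oplus> msum G g n"
  using comm_group.iprod_mult[OF a_comm_group] assms by (simp add: msum_def)

lemma msum_swap:
  assumes "\<And>i j. i < m \<Longrightarrow> j < n \<Longrightarrow> f i j \<in> carrier G"
  shows "msum G (\<lambda>i. msum G (f i) n) m = msum G (\<lambda>j. msum G (\<lambda>i. f i j) m) n"
  unfolding msum_def by (rule comm_group.iprod_swap[OF a_comm_group]) (use assms in simp)

lemma msum_single:
  "i < n \<Longrightarrow> x \<in> carrier G \<Longrightarrow> msum G (\<lambda>j. if j = i then x else \<zero>) n = x"
  using comm_group.iprod_single[OF a_comm_group, of i n x] by (simp add: msum_def cong: if_cong)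

end

lemma msum_module_hom:
  assumes "Module.module R A" "Module.module R B" "f \<in> module_hom R A B" "\<And>i. i < n \<Longrightarrow> x i \<in> carrier A"
  shows "f (msum A x n) = msum B (\<lambda>i. f (x i)) n"
proof -
  interpret A: Module.module R A by fact
  show ?thesis
    using assms(4)
    by (induction n) (simp_all add: module_hom_zero[OF assms(1-3)] module_hom_add[OF assms(3)] A.M.msum_closed)
qed

context Module.module
begin

lemma smult_msum:
  "r \<in> carrier R \<Longrightarrow> (\<And>i. i < n \<Longrightarrow> x i \<in> carrier M) \<Longrightarrow>
    r \<odot>\<^bsub>M\<^esub> msum M x n = msum M (\<lambda>i. r \<odot>\<^bsub>M\<^esub> x i) n"
  by (induction n) (auto simp: smult_r_distr M.msum_closed)

lemma msum_smult:
  "m \<in> carrier M \<Longrightarrow> (\<And>i. i < n \<Longrightarrow> r i \<in> carrier R) \<Longrightarrow>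
    msum R r n \<odot>\<^bsub>M\<^esub> m = msum M (\<lambda>i. r i \<odot>\<^bsub>M\<^esub> m) n"
  by (induction n) (auto simp: smult_l_distr R.msum_closed)

end

section \<open>Free modules and their retracts\<close>

lemma free_module_simps [simp]:
  "f \<oplus>\<^bsub>free_module R X\<^esub> g = (\<lambda>x. f x \<oplus>\<^bsub>R\<^esub> g x)"
  "\<zero>\<^bsub>free_module R X\<^esub> = (\<lambda>x. \<zero>\<^bsub>R\<^esub>)"
  "r \<odot>\<^bsub>free_module R X\<^esub> f = (\<lambda>x. r \<otimes>\<^bsub>R\<^esub> f x)"
  by (simp_all add: free_module_def)

lemma carrier_free_module:
  "f \<in> carrier (free_module R X) \<longleftrightarrow>
    (\<forall>x\<in>X. f x \<in> carrier R) \<and> (\<forall>x. x \<notin> X \<longrightarrow> f x = \<zero>\<^bsub>R\<^esub>) \<and> finite {x. f x \<noteq> \<zero>\<^bsub>R\<^esub>}"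
  by (simp add: free_module_def)

lemma (in cring) free_module_closed:
  "f \<in> carrier (free_module R X) \<Longrightarrow> f x \<in> carrier R"
  by (cases "x \<in> X") (auto simp: carrier_free_module)

lemma (in cring) module_free_module: "Module.module R (free_module R X)"
proof -
  let ?F = "free_module R X"
  have add: "f \<oplus>\<^bsub>?F\<^esub> g \<in> carrier ?F" if "f \<in> carrier ?F" "g \<in> carrier ?F" for f g
  proof -
    have "finite ({x. f x \<noteq> \<zero>} \<union> {x. g x \<noteq> \<zero>})"
      using that by (auto simp: carrier_free_module)
    then have "finite {x. f x \<oplus> g x \<noteq> \<zero>}"
      by (rule rev_finite_subset) auto
    with that show ?thesis by (auto simp: carrier_free_module)
  qed
  have smult: "r \<odot>\<^bsub>?F\<^esub> f \<in> carrier ?F" if "r \<in> carrier R" "f \<in> carrier ?F" for r f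
  proof -
    have "finite {x. f x \<noteq> \<zero>}"
      using that by (auto simp: carrier_free_module)
    then have "finite {x. r \<otimes> f x \<noteq> \<zero>}"
      by (rule rev_finite_subset) (use that in auto)
    with that show ?thesis by (auto simp: carrier_free_module)
  qed
  have "abelian_group ?F"
  proof (rule abelian_groupI)
    fix f assume f: "f \<in> carrier ?F"
    have "(\<ominus> \<one>) \<odot>\<^bsub>?F\<^esub> f \<oplus>\<^bsub>?F\<^esub> f = \<zero>\<^bsub>?F\<^esub>"
      using free_module_closed[OF f] by (simp add: l_minus l_neg)
    then show "\<exists>g\<in>carrier ?F. g \<oplus>\<^bsub>?F\<^esub> f = \<zero>\<^bsub>?F\<^esub>"
      using smult[OF _ f, of "\<ominus> \<one>"] by blast
  qed (use add in \<open>auto simp: free_module_closed a_ac carrier_free_module\<close>)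
  then show ?thesis
    by (intro moduleI)
      (use smult in \<open>auto simp: is_cring free_module_closed l_distr r_distr m_assoc\<close>)
qed

definition delta :: "('r, 'x) ring_scheme \<Rightarrow> 'a \<Rightarrow> 'a \<Rightarrow> 'r"
  where "delta R x = (\<lambda>y. if y = x then \<one>\<^bsub>R\<^esub> else \<zero>\<^bsub>R\<^esub>)"

lemma (in cring) delta_closed: "x \<in> X \<Longrightarrow> delta R x \<in> carrier (free_module R X)"
proof -
  have "finite {y. delta R x y \<noteq> \<zero>}"
    by (rule finite_subset[of _ "{x}"]) (auto simp: delta_def)
  then show "x \<in> X \<Longrightarrow> ?thesis"
    by (auto simp: carrier_free_module delta_def)
qed

text \<open>Induction on a finite set containing the support: one step splits off a coordinate,
  \<open>f = f(x := 0) + f x * delta x\<close>. The set may contain points outside \<open>X\<close>,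
  where \<open>f\<close> is zero anyway and nothing is split off.\<close>

lemma (in cring) free_module_hom_eqI:
  assumes A: "Module.module R A"
    and u: "u \<in> module_hom R (free_module R X) A" and v: "v \<in> module_hom R (free_module R X) A"
    and eq: "\<And>x. x \<in> X \<Longrightarrow> u (delta R x) = v (delta R x)"
    and f: "f \<in> carrier (free_module R X)"
  shows "u f = v f"
proof -
  let ?F = "free_module R X"
  note F = module_free_module[of X]
  have "u f = v f" if "finite S" "{x. f x \<noteq> \<zero>} \<subseteq> S" "f \<in> carrier ?F" for S f
    using that
  proof (induction S arbitrary: f rule: finite_induct)
    case empty
    then have "f = \<zero>\<^bsub>?F\<^esub>" by auto
    then show ?case
      using module_hom_zero[OF F A u] module_hom_zero[OF F A v] by (simp del: free_module_simps)
  next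
    case (insert x S)
    let ?g = "f(x := \<zero>)"
    have "finite {y. ?g y \<noteq> \<zero>}"
      by (rule finite_subset[OF _ insert.hyps(1)]) (use insert.prems in auto)
    then have g: "?g \<in> carrier ?F"
      using insert.prems(2) by (auto simp: carrier_free_module)
    have ug: "u ?g = v ?g"
      by (rule insert.IH[OF _ g]) (use insert.prems in auto)
    show ?case
    proof (cases "x \<in> X")
      case True
      note d = delta_closed[OF True]
      have fx: "f x \<in> carrier R" using insert.prems(2) by (rule free_module_closed)
      have "f = ?g \<oplus>\<^bsub>?F\<^esub> (f x \<odot>\<^bsub>?F\<^esub> delta R x)"
        using free_module_closed[OF insert.prems(2)] by (auto simp: delta_def fun_eq_iff)
      moreover have "u (?g \<oplus>\<^bsub>?F\<^esub> (f x \<odot>\<^bsub>?F\<^esub> delta R x)) = v (?g \<oplus>\<^bsub>?F\<^esub> (f x \<odot>\<^bsub>?F\<^esub> delta R x))"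
        using module.smult_closed[OF F fx d] fx d g ug eq[OF True]
        by (simp add: module_hom_add[OF u] module_hom_add[OF v]
            module_hom_smult[OF u] module_hom_smult[OF v] del: free_module_simps)
      ultimately show ?thesis by metis
    next
      case False
      then have "?g = f" using insert.prems(2) by (auto simp: carrier_free_module)
      with ug show ?thesis by simp
    qed
  qed
  with f show ?thesis by (auto simp: carrier_free_module)
qed

text \<open>The linear extension to the free module of a map \<open>a\<close> prescribed on the
  basis. Terms with zero coefficient are left out, so the sum is finite for finitely supported
  \<open>f\<close>.\<close>

definition lincomb ::
  "('r, 'x) ring_scheme \<Rightarrow> ('r, 'm, 'y) module_scheme \<Rightarrow> ('a \<Rightarrow> 'm) \<Rightarrow> ('a \<Rightarrow> 'r) \<Rightarrow> 'm"
  where "lincomb R M a f = (\<Oplus>\<^bsub>M\<^esub>x\<in>{x. f x \<noteq> \<zero>\<^bsub>R\<^esub>}. f x \<odot>\<^bsub>M\<^esub> a x)"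

context Module.module
begin

lemma lincomb_finsum:
  assumes "finite S" "{x. f x \<noteq> \<zero>} \<subseteq> S" "\<And>x. x \<in> S \<Longrightarrow> a x \<in> carrier M" "\<And>x. f x \<in> carrier R"
  shows "lincomb R M a f = (\<Oplus>\<^bsub>M\<^esub>x\<in>S. f x \<odot>\<^bsub>M\<^esub> a x)"
  unfolding lincomb_def
  by (rule M.add.finprod_mono_neutral_cong_left) (use assms in auto)

lemma lincomb_hom:
  assumes a: "a \<in> X \<rightarrow> carrier M"
  shows "lincomb R M a \<in> module_hom R (free_module R X) M"
proof (rule module_homI)
  let ?F = "free_module R X"
  note closed = R.free_module_closed
  have fs: "finite {x. f x \<noteq> \<zero>}" "{x. f x \<noteq> \<zero>} \<subseteq> X" if "f \<in> carrier ?F" for f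
    using that by (auto simp: carrier_free_module)
  fix f assume f: "f \<in> carrier ?F"
  show "lincomb R M a f \<in> carrier M"
    unfolding lincomb_def by (rule M.finsum_closed) (use fs[OF f] a closed[OF f] in auto)
  {
    fix g assume g: "g \<in> carrier ?F"
    \<comment> \<open>The supports of \<open>f\<close>, of \<open>g\<close> and of their sum differ;
      all three combinations are rewritten as sums over the union.\<close>
    let ?S = "{x. f x \<noteq> \<zero>} \<union> {x. g x \<noteq> \<zero>}"
    have S: "finite ?S" "\<And>x. x \<in> ?S \<Longrightarrow> a x \<in> carrier M"
      using fs[OF f] fs[OF g] a by auto
    have aS: "f x \<odot>\<^bsub>M\<^esub> a x \<in> carrier M" "g x \<odot>\<^bsub>M\<^esub> a x \<in> carrier M" if "x \<in> ?S" for x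
      using S(2)[OF that] closed[OF f] closed[OF g] by auto
    have "lincomb R M a (f \<oplus>\<^bsub>?F\<^esub> g) = (\<Oplus>\<^bsub>M\<^esub>x\<in>?S. (f x \<oplus> g x) \<odot>\<^bsub>M\<^esub> a x)"
      unfolding free_module_simps
      by (rule lincomb_finsum) (use S closed[OF f] closed[OF g] in auto)
    also have "\<dots> = (\<Oplus>\<^bsub>M\<^esub>x\<in>?S. f x \<odot>\<^bsub>M\<^esub> a x \<oplus>\<^bsub>M\<^esub> g x \<odot>\<^bsub>M\<^esub> a x)"
      by (rule M.finsum_cong') (use aS S(2) closed[OF f] closed[OF g] in \<open>auto simp: smult_l_distr\<close>)
    also have "\<dots> = (\<Oplus>\<^bsub>M\<^esub>x\<in>?S. f x \<odot>\<^bsub>M\<^esub> a x) \<oplus>\<^bsub>M\<^esub> (\<Oplus>\<^bsub>M\<^esub>x\<in>?S. g x \<odot>\<^bsub>M\<^esub> a x)"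
      by (rule M.finsum_addf) (use aS in blast)+
    also have "\<dots> = lincomb R M a f \<oplus>\<^bsub>M\<^esub> lincomb R M a g"
      using lincomb_finsum[of ?S f a] lincomb_finsum[of ?S g a] S closed[OF f] closed[OF g] by auto
    finally show "lincomb R M a (f \<oplus>\<^bsub>?F\<^esub> g) = lincomb R M a f \<oplus>\<^bsub>M\<^esub> lincomb R M a g" .
  }
  {
    fix r assume r: "r \<in> carrier R"
    let ?S = "{x. f x \<noteq> \<zero>}"
    have S: "finite ?S" "\<And>x. x \<in> ?S \<Longrightarrow> a x \<in> carrier M"
      using fs[OF f] a by auto
    have "lincomb R M a (r \<odot>\<^bsub>?F\<^esub> f) = (\<Oplus>\<^bsub>M\<^esub>x\<in>?S. (r \<otimes> f x) \<odot>\<^bsub>M\<^esub> a x)"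
      unfolding free_module_simps
      by (rule lincomb_finsum) (use S closed[OF f] r in auto)
    also have "\<dots> = (\<Oplus>\<^bsub>M\<^esub>x\<in>?S. r \<odot>\<^bsub>M\<^esub> (f x \<odot>\<^bsub>M\<^esub> a x))"
      by (rule M.finsum_cong') (use S(2) closed[OF f] r in \<open>auto simp: smult_assoc1\<close>)
    also have "\<dots> = r \<odot>\<^bsub>M\<^esub> lincomb R M a f"
      unfolding lincomb_def
      by (rule finsum_smult_ldistr[symmetric]) (use S r closed[OF f] in auto)
    finally show "lincomb R M a (r \<odot>\<^bsub>?F\<^esub> f) = r \<odot>\<^bsub>M\<^esub> lincomb R M a f" .
  }
qed

lemma lincomb_delta:
  assumes "a x \<in> carrier M"
  shows "lincomb R M a (delta R x) = a x"
proof -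
  have "lincomb R M a (delta R x) = (\<Oplus>\<^bsub>M\<^esub>y\<in>{x}. delta R x y \<odot>\<^bsub>M\<^esub> a y)"
    by (rule lincomb_finsum) (use assms in \<open>auto simp: delta_def\<close>)
  then show ?thesis using assms by (simp add: delta_def)
qed

end

text \<open>Direct summands of free modules with the splitting kept as data: the composite
  \<open>i \<circ> p\<close> is the idempotent that later becomes a matrix. In contrast to
  \<open>projective_module\<close> no type of test modules enters.\<close>

definition retract_free ::
  "('r, 'x) ring_scheme \<Rightarrow> ('r, 'p, 'y) module_scheme \<Rightarrow> 'a set \<Rightarrow> ('p \<Rightarrow> 'a \<Rightarrow> 'r) \<Rightarrow> (('a \<Rightarrow> 'r) \<Rightarrow> 'p) \<Rightarrow> bool"
  where "retract_free R P X i p \<longleftrightarrow> Module.module R P \<and>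
    i \<in> module_hom R P (free_module R X) \<and> p \<in> module_hom R (free_module R X) P \<and>
    (\<forall>x\<in>carrier P. p (i x) = x)"

lemma (in cring) retract_free_free_module: "retract_free R (free_module R X) X (\<lambda>x. x) (\<lambda>x. x)"
  by (simp add: retract_free_def module_free_module module_hom_id)

text \<open>The lift is chosen on the basis of the free module, extended linearly and preceded by
  \<open>i\<close>. The condition that \<open>f\<close> lands in the range of \<open>g\<close> suits
  differentials, whose range is a kernel: chain maps and homotopies are lifted without forming that
  kernel as a module. The types of \<open>A\<close> and \<open>B\<close> are arbitrary.\<close>

lemma retract_free_lift:
  assumes P: "retract_free R P X i p" and A: "Module.module R A" and B: "Module.module R B"
    and g: "g \<in> module_hom R A B" and f: "f \<in> module_hom R P B"
    and sub: "\<And>x. x \<in> carrier P \<Longrightarrow> f x \<in> g ` carrier A"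
  obtains h where "h \<in> module_hom R P A" "\<And>x. x \<in> carrier P \<Longrightarrow> g (h x) = f x"
proof -
  interpret A: Module.module R A by fact
  note i = P[unfolded retract_free_def, THEN conjunct2, THEN conjunct1]
  note p = P[unfolded retract_free_def, THEN conjunct2, THEN conjunct2, THEN conjunct1]
  define a where "a x = inv_into (carrier A) g (f (p (delta R x)))" for x
  have a: "a x \<in> carrier A" "g (a x) = f (p (delta R x))" if "x \<in> X" for x
    using sub[OF module_hom_closed[OF p A.R.delta_closed[OF that]]]
    by (auto simp: a_def inv_into_into f_inv_into_f)
  have lin: "lincomb R A a \<in> module_hom R (free_module R X) A"
    by (rule A.lincomb_hom) (use a in auto)
  have "g (lincomb R A a y) = f (p y)" if "y \<in> carrier (free_module R X)" for y
    using A.R.free_module_hom_eqI[OF B module_hom_comp[OF lin g] module_hom_comp[OF p f] _ that] a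
    by (simp add: A.lincomb_delta)
  then have "g (lincomb R A a (i x)) = f x" if "x \<in> carrier P" for x
    using P that module_hom_closed[OF i that] by (simp add: retract_free_def)
  with module_hom_comp[OF i lin] show thesis by (rule that)
qed

section \<open>Tensor products\<close>

abbreviation pair_group :: "('r, 'a, 'y) module_scheme \<Rightarrow> ('r, 'b, 'z) module_scheme \<Rightarrow> ('a \<times> 'b \<Rightarrow>\<^sub>0 int) monoid"
  where "pair_group A M \<equiv> free_Abelian_group (carrier A \<times> carrier M)"

text \<open>The elementary tensor of \<open>a\<close> and \<open>m\<close>.\<close>

definition tens ::
  "('r, 'x) ring_scheme \<Rightarrow> ('r, 'a, 'y) module_scheme \<Rightarrow> ('r, 'b, 'z) module_scheme \<Rightarrow>
   'a \<Rightarrow> 'b \<Rightarrow> ('a \<times> 'b \<Rightarrow>\<^sub>0 int) set"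
  where "tens R A M a m = tensor_kernel R A M #>\<^bsub>pair_group A M\<^esub> frag_of (a, m)"

lemma tensor_relations_add_left:
  "\<lbrakk>a \<in> carrier A; a' \<in> carrier A; m \<in> carrier M\<rbrakk> \<Longrightarrow>
    frag_of (a \<oplus>\<^bsub>A\<^esub> a', m) - frag_of (a, m) - frag_of (a', m) \<in> tensor_relations R A M"
  unfolding tensor_relations_def by (rule UnI1, rule UnI1) blast

lemma tensor_relations_add_right:
  "\<lbrakk>a \<in> carrier A; m \<in> carrier M; m' \<in> carrier M\<rbrakk> \<Longrightarrow>
    frag_of (a, m \<oplus>\<^bsub>M\<^esub> m') - frag_of (a, m) - frag_of (a, m') \<in> tensor_relations R A M"
  unfolding tensor_relations_def by (rule UnI1, rule UnI2) blast

lemma tensor_relations_smult: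
  "\<lbrakk>r \<in> carrier R; a \<in> carrier A; m \<in> carrier M\<rbrakk> \<Longrightarrow>
    frag_of (r \<odot>\<^bsub>A\<^esub> a, m) - frag_of (a, r \<odot>\<^bsub>M\<^esub> m) \<in> tensor_relations R A M"
  unfolding tensor_relations_def by (rule UnI2) blast

lemma tensor_relations_subset:
  assumes "Module.module R A" "Module.module R M"
  shows "tensor_relations R A M \<subseteq> carrier (pair_group A M)"
proof -
  interpret A: Module.module R A by fact
  interpret M: Module.module R M by fact
  have diff: "x - y \<in> carrier (pair_group A M)"
    if "x \<in> carrier (pair_group A M)" "y \<in> carrier (pair_group A M)" for x y
    using that keys_diff[of x y] by auto
  show ?thesis
    unfolding tensor_relations_def
    by (auto intro!: diff simp del: carrier_free_Abelian_group_iff)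
qed

lemma tensor_kernel_subgroup:
  assumes "Module.module R A" "Module.module R M"
  shows "subgroup (tensor_kernel R A M) (pair_group A M)"
  unfolding tensor_kernel_def
  by (rule group.generate_is_subgroup[OF group_free_Abelian_group tensor_relations_subset[OF assms]])

lemma tensor_kernel_normal:
  assumes "Module.module R A" "Module.module R M"
  shows "tensor_kernel R A M \<lhd> pair_group A M"
  by (rule comm_group.subgroup_imp_normal[OF abelian_free_Abelian_group tensor_kernel_subgroup[OF assms]])

lemma comm_group_tensor:
  assumes "Module.module R A" "Module.module R M"
  shows "comm_group (tensor R A M)"
  unfolding tensor_def
  by (rule comm_group.abelian_FactGroup[OF abelian_free_Abelian_group tensor_kernel_subgroup[OF assms]])

lemma group_tensor:
  "Module.module R A \<Longrightarrow> Module.module R M \<Longrightarrow> group (tensor R A M)"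
  using comm_group_tensor comm_group.axioms(2) by blast

lemma carrier_tensor:
  "carrier (tensor R A M) = (\<lambda>c. tensor_kernel R A M #>\<^bsub>pair_group A M\<^esub> c) ` carrier (pair_group A M)"
  by (simp add: tensor_def carrier_FactGroup)

lemma tens_closed:
  "a \<in> carrier A \<Longrightarrow> m \<in> carrier M \<Longrightarrow> tens R A M a m \<in> carrier (tensor R A M)"
  by (auto simp: carrier_tensor tens_def)

lemma tensor_mult_coset:
  assumes "Module.module R A" "Module.module R M"
    "x \<in> carrier (pair_group A M)" "y \<in> carrier (pair_group A M)"
  shows "(tensor_kernel R A M #>\<^bsub>pair_group A M\<^esub> x) \<otimes>\<^bsub>tensor R A M\<^esub> (tensor_kernel R A M #>\<^bsub>pair_group A M\<^esub> y)
    = tensor_kernel R A M #>\<^bsub>pair_group A M\<^esub> (x + y)"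
  using normal.rcos_sum[OF tensor_kernel_normal[OF assms(1,2)] assms(3,4)]
  by (simp add: tensor_def)

lemma tensor_coset_eqI:
  assumes "Module.module R A" "Module.module R M"
    "x \<in> carrier (pair_group A M)" "y - x \<in> tensor_kernel R A M"
  shows "tensor_kernel R A M #>\<^bsub>pair_group A M\<^esub> x = tensor_kernel R A M #>\<^bsub>pair_group A M\<^esub> y"
proof (rule group.repr_independence[OF group_free_Abelian_group _ assms(3) tensor_kernel_subgroup[OF assms(1,2)]])
  show "y \<in> tensor_kernel R A M #>\<^bsub>pair_group A M\<^esub> x"
    unfolding r_coset_def using assms(4) by (auto intro!: bexI[of _ "y - x"])
qed

lemma tensor_relation_kernel: "x \<in> tensor_relations R A M \<Longrightarrow> x \<in> tensor_kernel R A M"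
  unfolding tensor_kernel_def by (rule generate.incl)

lemma tens_add_left:
  assumes "Module.module R A" "Module.module R M" "a \<in> carrier A" "a' \<in> carrier A" "m \<in> carrier M"
  shows "tens R A M (a \<oplus>\<^bsub>A\<^esub> a') m = tens R A M a m \<otimes>\<^bsub>tensor R A M\<^esub> tens R A M a' m"
proof -
  have "frag_of (a \<oplus>\<^bsub>A\<^esub> a', m) - (frag_of (a, m) + frag_of (a', m)) \<in> tensor_kernel R A M"
    by (rule tensor_relation_kernel) (use assms in \<open>simp add: tensor_relations_add_left tensor_relations_add_right flip: diff_diff_eq\<close>)
  moreover have "frag_of (a, m) + frag_of (a', m) \<in> carrier (pair_group A M)"
    using assms keys_add[of "frag_of (a, m)" "frag_of (a', m)"] by auto
  ultimately show ?thesis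
    using assms by (simp add: tens_def tensor_mult_coset tensor_coset_eqI del: carrier_free_Abelian_group_iff)
qed

lemma tens_add_right:
  assumes "Module.module R A" "Module.module R M" "a \<in> carrier A" "m \<in> carrier M" "m' \<in> carrier M"
  shows "tens R A M a (m \<oplus>\<^bsub>M\<^esub> m') = tens R A M a m \<otimes>\<^bsub>tensor R A M\<^esub> tens R A M a m'"
proof -
  have "frag_of (a, m \<oplus>\<^bsub>M\<^esub> m') - (frag_of (a, m) + frag_of (a, m')) \<in> tensor_kernel R A M"
    by (rule tensor_relation_kernel) (use assms in \<open>simp add: tensor_relations_add_left tensor_relations_add_right flip: diff_diff_eq\<close>)
  moreover have "frag_of (a, m) + frag_of (a, m') \<in> carrier (pair_group A M)"
    using assms keys_add[of "frag_of (a, m)" "frag_of (a, m')"] by auto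
  ultimately show ?thesis
    using assms by (simp add: tens_def tensor_mult_coset tensor_coset_eqI del: carrier_free_Abelian_group_iff)
qed

lemma tens_smult:
  assumes "Module.module R A" "Module.module R M" "r \<in> carrier R" "a \<in> carrier A" "m \<in> carrier M"
  shows "tens R A M (r \<odot>\<^bsub>A\<^esub> a) m = tens R A M a (r \<odot>\<^bsub>M\<^esub> m)"
proof -
  interpret M: Module.module R M by fact
  have "frag_of (r \<odot>\<^bsub>A\<^esub> a, m) - frag_of (a, r \<odot>\<^bsub>M\<^esub> m) \<in> tensor_kernel R A M"
    by (rule tensor_relation_kernel) (use assms in \<open>simp add: tensor_relations_smult\<close>)
  from tensor_coset_eqI[OF assms(1,2) _ this] show ?thesis
    unfolding tens_def using assms by simp
qed

text \<open>Elementary tensors generate the tensor product. The step is a quotient because free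
  abelian groups are generated under differences; it covers products and inverses at once.\<close>

lemma tensor_induct [consumes 3, case_names one tens diff]:
  assumes A: "Module.module R A" and M: "Module.module R M" and X: "X \<in> carrier (tensor R A M)"
    and one: "P \<one>\<^bsub>tensor R A M\<^esub>"
    and tens: "\<And>a m. a \<in> carrier A \<Longrightarrow> m \<in> carrier M \<Longrightarrow> P (tens R A M a m)"
    and diff: "\<And>X Y. X \<in> carrier (tensor R A M) \<Longrightarrow> Y \<in> carrier (tensor R A M) \<Longrightarrow> P X \<Longrightarrow> P Y \<Longrightarrow>
      P (X \<otimes>\<^bsub>tensor R A M\<^esub> inv\<^bsub>tensor R A M\<^esub> Y)"
  shows "P X"
proof -
  let ?K = "tensor_kernel R A M" and ?F = "pair_group A M"
  interpret T: comm_group "tensor R A M" by (rule comm_group_tensor[OF A M])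
  obtain c where c: "Poly_Mapping.keys c \<subseteq> carrier A \<times> carrier M" "X = ?K #>\<^bsub>?F\<^esub> c"
    using X by (auto simp: carrier_tensor)
  have "P (?K #>\<^bsub>?F\<^esub> c)"
    using c(1)
  proof (induction c rule: free_Abelian_group_induct[consumes 1, case_names 1 2 3])
    case 1
    have "?K #>\<^bsub>?F\<^esub> \<one>\<^bsub>?F\<^esub> = ?K"
      by (rule group.coset_mult_one)
        (use subgroup.subset[OF tensor_kernel_subgroup[OF A M]] in auto)
    then show ?case using one by (simp add: tensor_def)
  next
    case (2 x y)
    have xy: "Poly_Mapping.keys (x - y) \<subseteq> carrier A \<times> carrier M"
      using 2(1,2) keys_diff[of x y] by auto
    then have in_T: "?K #>\<^bsub>?F\<^esub> (x - y) \<in> carrier (tensor R A M)"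
        "?K #>\<^bsub>?F\<^esub> x \<in> carrier (tensor R A M)" "?K #>\<^bsub>?F\<^esub> y \<in> carrier (tensor R A M)"
      using 2 by (auto simp: carrier_tensor)
    have "(?K #>\<^bsub>?F\<^esub> (x - y)) \<otimes>\<^bsub>tensor R A M\<^esub> (?K #>\<^bsub>?F\<^esub> y) = ?K #>\<^bsub>?F\<^esub> x"
      using 2 xy by (simp add: tensor_mult_coset[OF A M])
    then have "?K #>\<^bsub>?F\<^esub> (x - y) = (?K #>\<^bsub>?F\<^esub> x) \<otimes>\<^bsub>tensor R A M\<^esub> inv\<^bsub>tensor R A M\<^esub> (?K #>\<^bsub>?F\<^esub> y)"
      using in_T by (simp add: T.inv_solve_right)
    then show ?case
      using diff in_T 2 by simp
  next
    case (3 a)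
    then show ?case
      using tens by (auto simp: tens_def)
  qed
  with c show ?thesis by simp
qed

lemma tensor_hom_eqI:
  assumes A: "Module.module R A" and M: "Module.module R M" and H: "group H"
    and u: "u \<in> hom (tensor R A M) H" and v: "v \<in> hom (tensor R A M) H"
    and eq: "\<And>a m. a \<in> carrier A \<Longrightarrow> m \<in> carrier M \<Longrightarrow> u (tens R A M a m) = v (tens R A M a m)"
    and X: "X \<in> carrier (tensor R A M)"
  shows "u X = v X"
proof -
  interpret u: group_hom "tensor R A M" H u
    using group_tensor[OF A M] H u by (simp add: group_hom_def group_hom_axioms_def)
  interpret v: group_hom "tensor R A M" H v
    using group_tensor[OF A M] H v by (simp add: group_hom_def group_hom_axioms_def)
  show ?thesis
    using A M X by (induction rule: tensor_induct) (auto simp: eq)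
qed

text \<open>The additive extension of \<open>\<beta>\<close> to the free abelian group on the pairs
  kills the relations and hence factors through the quotient. The target \<open>H\<close> is a mere
  abelian group, so compatibility with scalars can only be expressed by moving them from one
  argument to the other.\<close>

lemma tensor_universal:
  assumes A: "Module.module R A" and M: "Module.module R M" and H: "comm_group H"
    and closed: "\<And>a m. a \<in> carrier A \<Longrightarrow> m \<in> carrier M \<Longrightarrow> \<beta> a m \<in> carrier H"
    and add_left: "\<And>a a' m. a \<in> carrier A \<Longrightarrow> a' \<in> carrier A \<Longrightarrow> m \<in> carrier M \<Longrightarrow>
      \<beta> (a \<oplus>\<^bsub>A\<^esub> a') m = \<beta> a m \<otimes>\<^bsub>H\<^esub> \<beta> a' m"
    and add_right: "\<And>a m m'. a \<in> carrier A \<Longrightarrow> m \<in> carrier M \<Longrightarrow> m' \<in> carrier M \<Longrightarrow>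
      \<beta> a (m \<oplus>\<^bsub>M\<^esub> m') = \<beta> a m \<otimes>\<^bsub>H\<^esub> \<beta> a m'"
    and smult: "\<And>r a m. r \<in> carrier R \<Longrightarrow> a \<in> carrier A \<Longrightarrow> m \<in> carrier M \<Longrightarrow>
      \<beta> (r \<odot>\<^bsub>A\<^esub> a) m = \<beta> a (r \<odot>\<^bsub>M\<^esub> m)"
  obtains h where "h \<in> hom (tensor R A M) H"
    "\<And>a m. a \<in> carrier A \<Longrightarrow> m \<in> carrier M \<Longrightarrow> h (tens R A M a m) = \<beta> a m"
proof -
  let ?K = "tensor_kernel R A M" and ?F = "pair_group A M"
  interpret A: Module.module R A by fact
  interpret M: Module.module R M by fact
  interpret H: comm_group H by fact
  have "(\<lambda>(a, m). \<beta> a m) ` (carrier A \<times> carrier M) \<subseteq> carrier H"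
    using closed by auto
  then obtain h where h: "h \<in> hom ?F H"
    "\<And>x. x \<in> carrier A \<times> carrier M \<Longrightarrow> h (frag_of x) = (\<lambda>(a, m). \<beta> a m) x"
    by (rule H.free_Abelian_group_universal) (rule that)
  interpret h: group_hom ?F H h
    using h(1) by (simp add: group_hom_def group_hom_axioms_def H.is_group)
  have hF: "h (frag_of (a, m)) = \<beta> a m" if "a \<in> carrier A" "m \<in> carrier M" for a m
    using h(2)[of "(a, m)"] that by simp
  have hdiff: "Poly_Mapping.keys (x - y) \<subseteq> carrier A \<times> carrier M \<and> h (x - y) = h x \<otimes>\<^bsub>H\<^esub> inv\<^bsub>H\<^esub> h y"
    if "Poly_Mapping.keys x \<subseteq> carrier A \<times> carrier M" "Poly_Mapping.keys y \<subseteq> carrier A \<times> carrier M" for x y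
    using that keys_diff[of x y] h.hom_mult[of x "- y"] h.hom_inv[of y] by auto
  \<comment> \<open>By bilinearity an additivity relation is sent to an expression of this shape in
    the multiplicatively written group \<open>H\<close>.\<close>
  have commutator: "x \<otimes>\<^bsub>H\<^esub> y \<otimes>\<^bsub>H\<^esub> inv\<^bsub>H\<^esub> x \<otimes>\<^bsub>H\<^esub> inv\<^bsub>H\<^esub> y = \<one>\<^bsub>H\<^esub>"
    if "x \<in> carrier H" "y \<in> carrier H" for x y
    using that by (metis H.inv_closed H.m_closed H.m_comm H.inv_solve_right' H.r_inv)
  have rel: "h x = \<one>\<^bsub>H\<^esub>" if "x \<in> tensor_relations R A M" for x
    using that unfolding tensor_relations_def
    by (auto simp: hdiff hF add_left add_right smult closed commutator)
  have "?K \<subseteq> kernel ?F H h"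
    unfolding tensor_kernel_def
    by (rule h.generate_subgroup_incl[OF _ h.subgroup_kernel])
      (use rel tensor_relations_subset[OF A M] in \<open>auto simp: kernel_def simp del: carrier_free_Abelian_group_iff\<close>)
  then obtain g where "g \<in> hom (?F Mod ?K) H" "\<And>x. x \<in> carrier ?F \<Longrightarrow> g (?K #>\<^bsub>?F\<^esub> x) = h x"
    using h.FactGroup_universal_kernel[OF tensor_kernel_normal[OF A M]] by blast
  then show thesis
    by (intro that[of g]) (auto simp: tensor_def tens_def hF)
qed

text \<open>\<open>tensor_map\<close> is \<open>the_elem\<close> of the image of a coset, so
  everything rests on that image being a single coset. The additive map \<open>\<theta>\<close>,
  which applies \<open>f\<close> to first components, carries relations to relations, hence one
  kernel into the other. From here on \<open>tensor_map\<close> is handled only as a homomorphism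
  with known values on elementary tensors.\<close>

lemma tensor_map_facts:
  fixes M :: "('r, 'm, 'z) module_scheme"
  assumes A: "Module.module R A" and B: "Module.module R B" and M: "Module.module R M"
    and f: "f \<in> module_hom R A B"
  shows tensor_map_hom: "tensor_map R B M f \<in> hom (tensor R A M) (tensor R B M)"
    and tensor_map_tens: "\<And>a m. a \<in> carrier A \<Longrightarrow> m \<in> carrier M \<Longrightarrow>
      tensor_map R B M f (tens R A M a m) = tens R B M (f a) m"
proof -
  let ?K = "tensor_kernel R A M" and ?F = "pair_group A M"
  let ?L = "tensor_kernel R B M" and ?G = "pair_group B M"
  define \<theta> where "\<theta> = frag_extend (\<lambda>(a, m :: 'm). frag_of (f a, m))"
  interpret A: Module.module R A by fact
  interpret B: Module.module R B by fact
  interpret M: Module.module R M by fact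
  interpret L: subgroup ?L ?G by (rule tensor_kernel_subgroup[OF B M])
  note fc = module_hom_closed[OF f]
  have \<theta>_add: "\<theta> (x + y) = \<theta> x + \<theta> y" and \<theta>_diff: "\<theta> (x - y) = \<theta> x - \<theta> y"
    and \<theta>_minus: "\<theta> (- x) = - \<theta> x" and \<theta>_zero: "\<theta> 0 = 0" for x y
    by (simp_all add: \<theta>_def frag_extend_add frag_extend_diff frag_extend_minus)
  have \<theta>_of: "\<theta> (frag_of (a, m)) = frag_of (f a, m)" for a m
    by (simp add: \<theta>_def)
  have \<theta>_closed: "\<theta> x \<in> carrier ?G" if "x \<in> carrier ?F" for x
  proof -
    have "Poly_Mapping.keys x \<subseteq> carrier A \<times> carrier M" using that by simp
    then have "Poly_Mapping.keys (\<theta> x) \<subseteq> carrier B \<times> carrier M"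
    proof (induction x rule: free_Abelian_group_induct[consumes 1, case_names 1 2 3])
      case (2 x y)
      then show ?case using keys_diff[of "\<theta> x" "\<theta> y"] by (auto simp: \<theta>_diff)
    qed (auto simp: \<theta>_zero \<theta>_of fc)
    then show ?thesis by simp
  qed
  have \<theta>_rel: "\<theta> x \<in> ?L" if x: "x \<in> tensor_relations R A M" for x
  proof (rule tensor_relation_kernel)
    consider
      (left) a a' b where "a \<in> carrier A" "a' \<in> carrier A" "b \<in> carrier M"
        "x = frag_of (a \<oplus>\<^bsub>A\<^esub> a', b) - frag_of (a, b) - frag_of (a', b)"
    | (right) a b b' where "a \<in> carrier A" "b \<in> carrier M" "b' \<in> carrier M"
        "x = frag_of (a, b \<oplus>\<^bsub>M\<^esub> b') - frag_of (a, b) - frag_of (a, b')"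
    | (smult) r a b where "r \<in> carrier R" "a \<in> carrier A" "b \<in> carrier M"
        "x = frag_of (r \<odot>\<^bsub>A\<^esub> a, b) - frag_of (a, r \<odot>\<^bsub>M\<^esub> b)"
      using x unfolding tensor_relations_def
      by (elim UnE CollectE exE conjE) (rule left right smult; assumption)+
    then show "\<theta> x \<in> tensor_relations R B M"
    proof cases
      case left
      then have "\<theta> x = frag_of (f a \<oplus>\<^bsub>B\<^esub> f a', b) - frag_of (f a, b) - frag_of (f a', b)"
        by (simp add: \<theta>_diff \<theta>_of module_hom_add[OF f])
      then show ?thesis
        using fc[OF left(1)] fc[OF left(2)] left(3) by (simp add: tensor_relations_add_left)
    next
      case right
      then have "\<theta> x = frag_of (f a, b \<oplus>\<^bsub>M\<^esub> b') - frag_of (f a, b) - frag_of (f a, b')"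
        by (simp add: \<theta>_diff \<theta>_of)
      then show ?thesis
        using fc[OF right(1)] right(2,3) by (simp add: tensor_relations_add_right)
    next
      case smult
      then have "\<theta> x = frag_of (r \<odot>\<^bsub>B\<^esub> f a, b) - frag_of (f a, r \<odot>\<^bsub>M\<^esub> b)"
        by (simp add: \<theta>_diff \<theta>_of module_hom_smult[OF f])
      then show ?thesis
        using smult(1) fc[OF smult(2)] smult(3) by (simp add: tensor_relations_smult)
    qed
  qed
  have L_minus: "- x \<in> ?L" if "x \<in> ?L" for x
    using L.m_inv_closed[OF that] L.mem_carrier[OF that] by simp
  have L_add: "x + y \<in> ?L" if "x \<in> ?L" "y \<in> ?L" for x y
    using L.m_closed[OF that] by simp
  have \<theta>_K: "\<theta> x \<in> ?L" if "x \<in> ?K" for x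
    using that unfolding tensor_kernel_def
  proof (induction rule: generate.induct)
    case (inv h)
    then show ?case
      using \<theta>_rel[OF inv] tensor_relations_subset[OF A M] L_minus
      by (auto simp: \<theta>_minus tensor_kernel_def)
  qed (use \<theta>_rel L_add L.one_closed in \<open>auto simp: \<theta>_zero \<theta>_add tensor_kernel_def\<close>)
  have val: "tensor_map R B M f (?K #>\<^bsub>?F\<^esub> c) = ?L #>\<^bsub>?G\<^esub> \<theta> c" if c: "c \<in> carrier ?F" for c
  proof -
    have "?L #>\<^bsub>?G\<^esub> \<theta> c' = ?L #>\<^bsub>?G\<^esub> \<theta> c" if c': "c' \<in> ?K #>\<^bsub>?F\<^esub> c" for c'
    proof -
      obtain k where k: "k \<in> ?K" "c' = k + c"
        using c' by (auto simp: r_coset_def)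
      show ?thesis
        by (rule tensor_coset_eqI[OF B M, symmetric])
          (use k \<theta>_closed[OF c] \<theta>_K in \<open>auto simp: \<theta>_add\<close>)
    qed
    moreover have "c \<in> ?K #>\<^bsub>?F\<^esub> c"
      by (rule group.rcos_self[OF group_free_Abelian_group c tensor_kernel_subgroup[OF A M]])
    ultimately have "(\<lambda>c. ?L #>\<^bsub>?G\<^esub> \<theta> c) ` (?K #>\<^bsub>?F\<^esub> c) = {?L #>\<^bsub>?G\<^esub> \<theta> c}"
      by blast
    then show ?thesis
      by (simp add: tensor_map_def \<theta>_def)
  qed
  show "tensor_map R B M f \<in> hom (tensor R A M) (tensor R B M)"
  proof (rule homI)
    fix X assume "X \<in> carrier (tensor R A M)"
    then obtain x where x: "x \<in> carrier ?F" "X = ?K #>\<^bsub>?F\<^esub> x"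
      by (auto simp: carrier_tensor)
    then show "tensor_map R B M f X \<in> carrier (tensor R B M)"
      using val \<theta>_closed by (auto simp: carrier_tensor)
    fix Y assume "Y \<in> carrier (tensor R A M)"
    then obtain y where y: "y \<in> carrier ?F" "Y = ?K #>\<^bsub>?F\<^esub> y"
      by (auto simp: carrier_tensor)
    have xy: "x + y \<in> carrier ?F"
      using x y keys_add[of x y] by auto
    show "tensor_map R B M f (X \<otimes>\<^bsub>tensor R A M\<^esub> Y)
        = tensor_map R B M f X \<otimes>\<^bsub>tensor R B M\<^esub> tensor_map R B M f Y"
      using tensor_mult_coset[OF A M x(1) y(1)] tensor_mult_coset[OF B M \<theta>_closed[OF x(1)] \<theta>_closed[OF y(1)]]
        val[OF x(1)] val[OF y(1)] val[OF xy] x(2) y(2)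
      by (simp add: \<theta>_add)
  qed
  show "tensor_map R B M f (tens R A M a m) = tens R B M (f a) m"
    if "a \<in> carrier A" "m \<in> carrier M" for a m
    using val[of "frag_of (a, m)"] that by (simp add: tens_def \<theta>_of)
qed

lemma tensor_map_closed:
  assumes "Module.module R A" "Module.module R B" "Module.module R M" "f \<in> module_hom R A B"
    "X \<in> carrier (tensor R A M)"
  shows "tensor_map R B M f X \<in> carrier (tensor R B M)"
  using hom_in_carrier[OF tensor_map_hom[OF assms(1-4)] assms(5)] .

lemma tensor_map_one:
  assumes "Module.module R A" "Module.module R B" "Module.module R M" "f \<in> module_hom R A B"
  shows "tensor_map R B M f \<one>\<^bsub>tensor R A M\<^esub> = \<one>\<^bsub>tensor R B M\<^esub>"
  by (rule hom_one[OF tensor_map_hom[OF assms] group_tensor[OF assms(1,3)] group_tensor[OF assms(2,3)]])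

lemma tensor_map_comp:
  assumes A: "Module.module R A" and B: "Module.module R B" and C: "Module.module R C" and M: "Module.module R M"
    and f: "f \<in> module_hom R A B" and g: "g \<in> module_hom R B C"
    and X: "X \<in> carrier (tensor R A M)"
  shows "tensor_map R C M g (tensor_map R B M f X) = tensor_map R C M (\<lambda>x. g (f x)) X"
proof (rule tensor_hom_eqI[OF A M group_tensor[OF C M] _ tensor_map_hom[OF A C M module_hom_comp[OF f g]] _ X])
  show "(\<lambda>X. tensor_map R C M g (tensor_map R B M f X)) \<in> hom (tensor R A M) (tensor R C M)"
    using hom_compose[OF tensor_map_hom[OF A B M f] tensor_map_hom[OF B C M g]] by (simp add: o_def)
qed (simp add: tensor_map_tens[OF A B M f] tensor_map_tens[OF B C M g]
      tensor_map_tens[OF A C M module_hom_comp[OF f g]] module_hom_closed[OF f])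

lemma tensor_map_cong:
  assumes A: "Module.module R A" and B: "Module.module R B" and M: "Module.module R M"
    and f: "f \<in> module_hom R A B" and g: "g \<in> module_hom R A B"
    and eq: "\<And>a. a \<in> carrier A \<Longrightarrow> f a = g a"
    and X: "X \<in> carrier (tensor R A M)"
  shows "tensor_map R B M f X = tensor_map R B M g X"
  by (rule tensor_hom_eqI[OF A M group_tensor[OF B M] tensor_map_hom[OF A B M f] tensor_map_hom[OF A B M g] _ X])
    (simp add: tensor_map_tens[OF A B M f] tensor_map_tens[OF A B M g] eq)

lemma tensor_map_id:
  assumes A: "Module.module R A" and M: "Module.module R M" and X: "X \<in> carrier (tensor R A M)"
  shows "tensor_map R A M (\<lambda>x. x) X = X"
  by (rule tensor_hom_eqI[OF A M group_tensor[OF A M] tensor_map_hom[OF A A M module_hom_id] _ _ X])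
    (auto simp: tensor_map_tens[OF A A M module_hom_id] hom_def)

lemma tensor_map_zero:
  assumes A: "Module.module R A" and B: "Module.module R B" and M: "Module.module R M"
    and X: "X \<in> carrier (tensor R A M)"
  shows "tensor_map R B M (\<lambda>x. \<zero>\<^bsub>B\<^esub>) X = \<one>\<^bsub>tensor R B M\<^esub>"
proof (rule tensor_hom_eqI[OF A M group_tensor[OF B M] _ _ _ X])
  interpret B: Module.module R B by fact
  interpret T: comm_group "tensor R B M" by (rule comm_group_tensor[OF B M])
  show "tensor_map R B M (\<lambda>x. \<zero>\<^bsub>B\<^esub>) \<in> hom (tensor R A M) (tensor R B M)"
    by (rule tensor_map_hom[OF A B M B.module_hom_zero_map[OF A]])
  show "(\<lambda>X. \<one>\<^bsub>tensor R B M\<^esub>) \<in> hom (tensor R A M) (tensor R B M)"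
    by (auto simp: hom_def)
  show "tensor_map R B M (\<lambda>x. \<zero>\<^bsub>B\<^esub>) (tens R A M a m) = \<one>\<^bsub>tensor R B M\<^esub>"
    if "a \<in> carrier A" "m \<in> carrier M" for a m
  proof -
    \<comment> \<open>From \<open>0 + 0 = 0\<close> the tensor of zero with \<open>m\<close> is
      idempotent, and an idempotent of a group is trivial.\<close>
    have "tens R B M \<zero>\<^bsub>B\<^esub> m \<otimes>\<^bsub>tensor R B M\<^esub> tens R B M \<zero>\<^bsub>B\<^esub> m = tens R B M \<zero>\<^bsub>B\<^esub> m"
      using tens_add_left[OF B M B.M.zero_closed B.M.zero_closed that(2)] by simp
    then have "tens R B M \<zero>\<^bsub>B\<^esub> m = \<one>\<^bsub>tensor R B M\<^esub>"
      using tens_closed[OF B.M.zero_closed that(2)] by (metis T.l_cancel_one')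
    then show ?thesis
      using that by (simp add: tensor_map_tens[OF A B M B.module_hom_zero_map[OF A]])
  qed
qed

lemma tensor_map_add:
  assumes A: "Module.module R A" and B: "Module.module R B" and M: "Module.module R M"
    and f: "f \<in> module_hom R A B" and g: "g \<in> module_hom R A B"
    and X: "X \<in> carrier (tensor R A M)"
  shows "tensor_map R B M (\<lambda>x. f x \<oplus>\<^bsub>B\<^esub> g x) X
    = tensor_map R B M f X \<otimes>\<^bsub>tensor R B M\<^esub> tensor_map R B M g X"
proof -
  interpret B: Module.module R B by fact
  interpret T: comm_group "tensor R B M" by (rule comm_group_tensor[OF B M])
  note homs = tensor_map_hom[OF A B M f] tensor_map_hom[OF A B M g]
  note h = B.module_hom_add_map[OF f g]
  show ?thesis
  proof (rule tensor_hom_eqI[OF A M group_tensor[OF B M] tensor_map_hom[OF A B M h] _ _ X])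
    show "(\<lambda>X. tensor_map R B M f X \<otimes>\<^bsub>tensor R B M\<^esub> tensor_map R B M g X)
        \<in> hom (tensor R A M) (tensor R B M)"
      by (rule homI) (auto simp: hom_in_carrier[OF homs(1)] hom_in_carrier[OF homs(2)]
          hom_mult[OF homs(1)] hom_mult[OF homs(2)] T.m_ac)
  qed (auto simp: tensor_map_tens[OF A B M f] tensor_map_tens[OF A B M g] tensor_map_tens[OF A B M h]
        module_hom_closed[OF f] module_hom_closed[OF g] tens_add_left[OF B M])
qed

section \<open>Independence of Tor from the resolution\<close>

text \<open>The piece \<open>A2 \<rightarrow> A1 \<rightarrow> A0 \<rightarrow> N \<rightarrow>
  0\<close> of an augmented resolution, exact at \<open>A1\<close>, \<open>A0\<close> and
  \<open>N\<close>: as much of a resolution as the first Tor group sees.\<close>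

definition aug_exact where
  "aug_exact R A2 d1 A1 d0 A0 \<epsilon> N \<longleftrightarrow>
    Module.module R A2 \<and> Module.module R A1 \<and> Module.module R A0 \<and> Module.module R N \<and>
    d1 \<in> module_hom R A2 A1 \<and> d0 \<in> module_hom R A1 A0 \<and> \<epsilon> \<in> module_hom R A0 N \<and>
    \<epsilon> ` carrier A0 = carrier N \<and> a_kernel A0 N \<epsilon> = d0 ` carrier A1 \<and> a_kernel A1 A0 d0 = d1 ` carrier A2"

text \<open>Only the inclusion of the kernel in the image; the opposite inclusion holds as soon as
  \<open>d0 \<circ> d1\<close> is zero.\<close>

definition tensor_exact where
  "tensor_exact R M A2 d1 A1 d0 A0 \<longleftrightarrow>
    (\<forall>X\<in>carrier (tensor R A1 M). tensor_map R A0 M d0 X = \<one>\<^bsub>tensor R A0 M\<^esub> \<longrightarrow>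
      X \<in> tensor_map R A1 M d1 ` carrier (tensor R A2 M))"

text \<open>Lifts \<open>f\<close> and \<open>g\<close> of the identity of \<open>N\<close> and a homotopy \<open>g f - 1 = d s\<^sub>1 + s\<^sub>0 d\<close> survive tensoring with \<open>M\<close>.\<close>

lemma tensor_exact_compare:
  assumes A: "aug_exact R A2 dA1 A1 dA0 A0 \<epsilon>A N" and B: "aug_exact R B2 dB1 B1 dB0 B0 \<epsilon>B N"
    and free: "retract_free R A1 XA1 iA1 pA1" "retract_free R A0 XA0 iA0 pA0"
      "retract_free R B2 XB2 iB2 pB2" "retract_free R B1 XB1 iB1 pB1" "retract_free R B0 XB0 iB0 pB0"
    and M: "Module.module R M"
    and exact: "tensor_exact R M B2 dB1 B1 dB0 B0"
  shows "tensor_exact R M A2 dA1 A1 dA0 A0"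
proof -
  have modules: "Module.module R A2" "Module.module R A1" "Module.module R A0" "Module.module R N"
      "Module.module R B2" "Module.module R B1" "Module.module R B0"
    and hA1: "dA1 \<in> module_hom R A2 A1" and hA0: "dA0 \<in> module_hom R A1 A0" and eA: "\<epsilon>A \<in> module_hom R A0 N"
    and hB1: "dB1 \<in> module_hom R B2 B1" and hB0: "dB0 \<in> module_hom R B1 B0" and eB: "\<epsilon>B \<in> module_hom R B0 N"
    using A B by (auto simp: aug_exact_def)
  interpret A2: Module.module R A2 by fact
  interpret A1: Module.module R A1 by fact
  interpret A0: Module.module R A0 by fact
  have surj: "\<epsilon>A ` carrier A0 = carrier N" "\<epsilon>B ` carrier B0 = carrier N"
    using A B by (auto simp: aug_exact_def)
  have kernels: "a_kernel A0 N \<epsilon>A = dA0 ` carrier A1" "a_kernel A1 A0 dA0 = dA1 ` carrier A2"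
      "a_kernel B0 N \<epsilon>B = dB0 ` carrier B1" "a_kernel B1 B0 dB0 = dB1 ` carrier B2"
    using A B by (auto simp: aug_exact_def)
  have kA0: "x \<in> carrier A0 \<Longrightarrow> \<epsilon>A x = \<zero>\<^bsub>N\<^esub> \<Longrightarrow> x \<in> dA0 ` carrier A1"
    and zA0: "y \<in> carrier A1 \<Longrightarrow> \<epsilon>A (dA0 y) = \<zero>\<^bsub>N\<^esub>" for x y
    using kernels(1) by (auto simp: a_kernel_def')
  have kA1: "x \<in> carrier A1 \<Longrightarrow> dA0 x = \<zero>\<^bsub>A0\<^esub> \<Longrightarrow> x \<in> dA1 ` carrier A2" for x
    using kernels(2) by (auto simp: a_kernel_def')
  have kB0: "x \<in> carrier B0 \<Longrightarrow> \<epsilon>B x = \<zero>\<^bsub>N\<^esub> \<Longrightarrow> x \<in> dB0 ` carrier B1" for x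
    using kernels(3) by (auto simp: a_kernel_def')
  have zB0: "y \<in> carrier B1 \<Longrightarrow> \<epsilon>B (dB0 y) = \<zero>\<^bsub>N\<^esub>" and zB1: "z \<in> carrier B2 \<Longrightarrow> dB0 (dB1 z) = \<zero>\<^bsub>B0\<^esub>" for y z
    using kernels(3,4) by (auto simp: a_kernel_def')
  note cl = module_hom_closed
  obtain f0 where f0: "f0 \<in> module_hom R A0 B0" and f0_eq: "\<And>x. x \<in> carrier A0 \<Longrightarrow> \<epsilon>B (f0 x) = \<epsilon>A x"
    by (rule retract_free_lift[OF free(2) modules(7,4) eB eA]) (use surj in auto)
  obtain f1 where f1: "f1 \<in> module_hom R A1 B1" and f1_eq: "\<And>x. x \<in> carrier A1 \<Longrightarrow> dB0 (f1 x) = f0 (dA0 x)"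
    by (rule retract_free_lift[OF free(1) modules(6,7) hB0 module_hom_comp[OF hA0 f0]])
      (use kB0 cl[OF f0 cl[OF hA0]] f0_eq[OF cl[OF hA0]] zA0 in auto)
  obtain g0 where g0: "g0 \<in> module_hom R B0 A0" and g0_eq: "\<And>x. x \<in> carrier B0 \<Longrightarrow> \<epsilon>A (g0 x) = \<epsilon>B x"
    by (rule retract_free_lift[OF free(5) modules(3,4) eA eB]) (use surj in auto)
  obtain g1 where g1: "g1 \<in> module_hom R B1 A1" and g1_eq: "\<And>x. x \<in> carrier B1 \<Longrightarrow> dA0 (g1 x) = g0 (dB0 x)"
    by (rule retract_free_lift[OF free(4) modules(2,3) hA0 module_hom_comp[OF hB0 g0]])
      (use kA0 cl[OF g0 cl[OF hB0]] g0_eq[OF cl[OF hB0]] zB0 in auto)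
  \<comment> \<open>The map \<open>g\<close> is lifted one degree further than \<open>f\<close>,
    because a preimage found in \<open>tensor R B2 M\<close> has to be carried back to
    \<open>tensor R A2 M\<close>.\<close>
  have "g1 (dB1 x) \<in> dA1 ` carrier A2" if "x \<in> carrier B2" for x
    using kA1[OF cl[OF g1 cl[OF hB1 that]]] g1_eq[OF cl[OF hB1 that]] zB1[OF that]
      module_hom_zero[OF modules(7,3) g0] by simp
  then obtain g2 where g2: "g2 \<in> module_hom R B2 A2" and g2_eq: "\<And>x. x \<in> carrier B2 \<Longrightarrow> dA1 (g2 x) = g1 (dB1 x)"
    by (rule retract_free_lift[OF free(3) modules(1,2) hA1 module_hom_comp[OF hB1 g1]]) (assumption, rule that)
  note gf0 = module_hom_comp[OF f0 g0] and gf1 = module_hom_comp[OF f1 g1]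
  have "g0 (f0 x) \<ominus>\<^bsub>A0\<^esub> x \<in> dA0 ` carrier A1" if x: "x \<in> carrier A0" for x
  proof (rule kA0)
    interpret N: Module.module R N by fact
    show "\<epsilon>A (g0 (f0 x) \<ominus>\<^bsub>A0\<^esub> x) = \<zero>\<^bsub>N\<^esub>"
      using x cl[OF f0 x] cl[OF gf0 x] cl[OF eA x]
      by (simp add: module_hom_diff[OF modules(3,4) eA] g0_eq f0_eq N.diff_eq_zero_iff)
  qed (use x cl[OF gf0 x] in simp)
  then obtain s0 where s0: "s0 \<in> module_hom R A0 A1"
    and s0_eq: "\<And>x. x \<in> carrier A0 \<Longrightarrow> dA0 (s0 x) = g0 (f0 x) \<ominus>\<^bsub>A0\<^esub> x"
    by (rule retract_free_lift[OF free(2) modules(2,3) hA0 A0.module_hom_diff_map[OF gf0 module_hom_id]]) (assumption, rule that)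
  note sd = module_hom_comp[OF hA0 s0]
  note u = A1.module_hom_diff_map[OF A1.module_hom_diff_map[OF gf1 module_hom_id] sd]
  have "(g1 (f1 x) \<ominus>\<^bsub>A1\<^esub> x) \<ominus>\<^bsub>A1\<^esub> s0 (dA0 x) \<in> dA1 ` carrier A2" if x: "x \<in> carrier A1" for x
  proof (rule kA1)
    show "dA0 ((g1 (f1 x) \<ominus>\<^bsub>A1\<^esub> x) \<ominus>\<^bsub>A1\<^esub> s0 (dA0 x)) = \<zero>\<^bsub>A0\<^esub>"
      using x cl[OF f1 x] cl[OF gf1 x] cl[OF hA0 x] cl[OF sd x] cl[OF gf0 cl[OF hA0 x]]
      by (simp add: module_hom_diff[OF modules(2,3) hA0] g1_eq f1_eq s0_eq A0.diff_eq_zero_iff)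
  qed (use cl[OF u x] in simp)
  then obtain s1 where s1: "s1 \<in> module_hom R A1 A2"
    and s1_eq: "\<And>x. x \<in> carrier A1 \<Longrightarrow> dA1 (s1 x) = (g1 (f1 x) \<ominus>\<^bsub>A1\<^esub> x) \<ominus>\<^bsub>A1\<^esub> s0 (dA0 x)"
    by (rule retract_free_lift[OF free(1) modules(1,2) hA1 u]) (assumption, rule that)
  note ds = module_hom_comp[OF s1 hA1]
  have homotopy: "g1 (f1 x) = x \<oplus>\<^bsub>A1\<^esub> (dA1 (s1 x) \<oplus>\<^bsub>A1\<^esub> s0 (dA0 x))" if x: "x \<in> carrier A1" for x
    using x cl[OF gf1 x] cl[OF sd x]
    by (simp add: s1_eq a_minus_def A1.M.a_ac A1.M.r_neg A1.M.r_neg1 A1.M.r_neg2)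
  show ?thesis
    unfolding tensor_exact_def
  proof (intro ballI impI)
    fix X assume X: "X \<in> carrier (tensor R A1 M)" and dX: "tensor_map R A0 M dA0 X = \<one>\<^bsub>tensor R A0 M\<^esub>"
    interpret T1: comm_group "tensor R A1 M" by (rule comm_group_tensor[OF modules(2) M])
    interpret T2: comm_group "tensor R A2 M" by (rule comm_group_tensor[OF modules(1) M])
    interpret tA1: group_hom "tensor R A2 M" "tensor R A1 M" "tensor_map R A1 M dA1"
      using tensor_map_hom[OF modules(1,2) M hA1]
      by (simp add: group_hom_def group_hom_axioms_def T1.is_group T2.is_group)
    define Y where "Y = tensor_map R B1 M f1 X"
    have Y: "Y \<in> carrier (tensor R B1 M)"
      unfolding Y_def by (rule tensor_map_closed[OF modules(2,6) M f1 X])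
    have "tensor_map R B0 M dB0 Y = tensor_map R B0 M (\<lambda>x. dB0 (f1 x)) X"
      unfolding Y_def by (rule tensor_map_comp[OF modules(2,6,7) M f1 hB0 X])
    also have "\<dots> = tensor_map R B0 M (\<lambda>x. f0 (dA0 x)) X"
      by (rule tensor_map_cong[OF modules(2,7) M module_hom_comp[OF f1 hB0] module_hom_comp[OF hA0 f0] f1_eq X])
    also have "\<dots> = tensor_map R B0 M f0 (tensor_map R A0 M dA0 X)"
      by (rule tensor_map_comp[OF modules(2,3,7) M hA0 f0 X, symmetric])
    also have "\<dots> = \<one>\<^bsub>tensor R B0 M\<^esub>"
      by (simp add: dX tensor_map_one[OF modules(3,7) M f0])
    finally obtain Z where Z: "Z \<in> carrier (tensor R B2 M)" "Y = tensor_map R B1 M dB1 Z"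
      using exact Y by (auto simp: tensor_exact_def)
    have W: "tensor_map R A2 M g2 Z \<in> carrier (tensor R A2 M)"
      by (rule tensor_map_closed[OF modules(5,1) M g2 Z(1)])
    have V: "tensor_map R A2 M s1 X \<in> carrier (tensor R A2 M)"
      by (rule tensor_map_closed[OF modules(2,1) M s1 X])
    have "tensor_map R A1 M g1 Y = tensor_map R A1 M (\<lambda>x. g1 (dB1 x)) Z"
      unfolding Z(2) by (rule tensor_map_comp[OF modules(5,6,2) M hB1 g1 Z(1)])
    also have "\<dots> = tensor_map R A1 M (\<lambda>x. dA1 (g2 x)) Z"
      by (rule tensor_map_cong[OF modules(5,2) M module_hom_comp[OF hB1 g1] module_hom_comp[OF g2 hA1] g2_eq[symmetric] Z(1)])
    also have "\<dots> = tensor_map R A1 M dA1 (tensor_map R A2 M g2 Z)"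
      by (rule tensor_map_comp[OF modules(5,1,2) M g2 hA1 Z(1), symmetric])
    finally have 1: "tensor_map R A1 M g1 Y = tensor_map R A1 M dA1 (tensor_map R A2 M g2 Z)" .
    have "tensor_map R A1 M g1 Y = tensor_map R A1 M (\<lambda>x. g1 (f1 x)) X"
      unfolding Y_def by (rule tensor_map_comp[OF modules(2,6,2) M f1 g1 X])
    also have "\<dots> = tensor_map R A1 M (\<lambda>x. x \<oplus>\<^bsub>A1\<^esub> (dA1 (s1 x) \<oplus>\<^bsub>A1\<^esub> s0 (dA0 x))) X"
      by (rule tensor_map_cong[OF modules(2,2) M gf1
            A1.module_hom_add_map[OF module_hom_id A1.module_hom_add_map[OF ds sd]] homotopy X])
    also have "\<dots> = X \<otimes>\<^bsub>tensor R A1 M\<^esub> (tensor_map R A1 M (\<lambda>x. dA1 (s1 x)) X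
        \<otimes>\<^bsub>tensor R A1 M\<^esub> tensor_map R A1 M (\<lambda>x. s0 (dA0 x)) X)"
      by (simp add: tensor_map_add[OF modules(2,2) M module_hom_id A1.module_hom_add_map[OF ds sd] X]
          tensor_map_add[OF modules(2,2) M ds sd X] tensor_map_id[OF modules(2) M X])
    \<comment> \<open>The half of the homotopy that passes through \<open>dA0\<close> dies since
      \<open>X\<close> is a cycle. What remains says that \<open>X\<close> and its image under
      \<open>g1 \<circ> f1\<close> differ by a boundary.\<close>
    also have "tensor_map R A1 M (\<lambda>x. s0 (dA0 x)) X = \<one>\<^bsub>tensor R A1 M\<^esub>"
      by (simp add: tensor_map_comp[OF modules(2,3,2) M hA0 s0 X, symmetric] dX
          tensor_map_one[OF modules(3,2) M s0])
    also have "tensor_map R A1 M (\<lambda>x. dA1 (s1 x)) X = tensor_map R A1 M dA1 (tensor_map R A2 M s1 X)"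
      by (rule tensor_map_comp[OF modules(2,1,2) M s1 hA1 X, symmetric])
    finally have "tensor_map R A1 M dA1 (tensor_map R A2 M g2 Z)
        = X \<otimes>\<^bsub>tensor R A1 M\<^esub> tensor_map R A1 M dA1 (tensor_map R A2 M s1 X)"
      using 1 V by simp
    then have "X = tensor_map R A1 M dA1 (tensor_map R A2 M g2 Z)
        \<otimes>\<^bsub>tensor R A1 M\<^esub> inv\<^bsub>tensor R A1 M\<^esub> tensor_map R A1 M dA1 (tensor_map R A2 M s1 X)"
      using X V W by (simp add: T1.inv_solve_right)
    also have "\<dots> = tensor_map R A1 M dA1
        (tensor_map R A2 M g2 Z \<otimes>\<^bsub>tensor R A2 M\<^esub> inv\<^bsub>tensor R A2 M\<^esub> tensor_map R A2 M s1 X)"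
      using V W by simp
    finally show "X \<in> tensor_map R A1 M dA1 ` carrier (tensor R A2 M)"
      using V W by blast
  qed
qed

section \<open>The canonical free resolution and its first Tor group\<close>

lemma cover_map_surj_hom:
  assumes N: "Module.module R N"
  shows "cover_map R N \<in> module_hom R (cover R N) N" "cover_map R N ` carrier (cover R N) = carrier N"
proof -
  interpret N: Module.module R N by fact
  have lin: "lincomb R N (\<lambda>x. x) \<in> module_hom R (cover R N) N"
    unfolding cover_def by (rule N.lincomb_hom) simp
  have eq: "cover_map R N f = lincomb R N (\<lambda>x. x) f" if "f \<in> carrier (cover R N)" for f
  proof -
    have "{x \<in> carrier N. f x \<noteq> \<zero>\<^bsub>R\<^esub>} = {x. f x \<noteq> \<zero>\<^bsub>R\<^esub>}"
      using that by (auto simp: cover_def carrier_free_module)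
    then show ?thesis
      by (simp add: cover_map_def lincomb_def)
  qed
  interpret F: Module.module R "cover R N"
    unfolding cover_def by (rule N.R.module_free_module)
  show hom: "cover_map R N \<in> module_hom R (cover R N) N"
    by (rule module_homI) (use lin in \<open>auto simp: eq module_hom_closed module_hom_add module_hom_smult\<close>)
  have "x \<in> cover_map R N ` carrier (cover R N)" if x: "x \<in> carrier N" for x
  proof -
    have d: "delta R x \<in> carrier (cover R N)"
      unfolding cover_def by (rule N.R.delta_closed[OF x])
    show ?thesis
      using x by (intro image_eqI[OF _ d]) (simp add: eq[OF d] N.lincomb_delta)
  qed
  then show "cover_map R N ` carrier (cover R N) = carrier N"
    using module_hom_closed[OF hom] by auto
qed

lemma cover_module: "Module.module R N \<Longrightarrow> Module.module R (cover R N)"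
  unfolding cover_def by (rule cring.module_free_module[OF module.axioms(1)])

lemma syzygy_module: "Module.module R N \<Longrightarrow> Module.module R (syzygy R N)"
  unfolding syzygy_def
  by (rule module_hom_kernel_module[OF _ _ cover_map_surj_hom(1)])
    (auto intro: cover_module)

lemma cover_map_syzygy_hom:
  assumes "Module.module R N"
  shows "cover_map R (syzygy R N) \<in> module_hom R (cover R (syzygy R N)) (cover R N)"
    and "cover_map R (syzygy R N) ` carrier (cover R (syzygy R N)) = a_kernel (cover R N) N (cover_map R N)"
proof -
  note K = cover_map_surj_hom[OF syzygy_module[OF assms]]
  have "(\<lambda>x. x) \<in> module_hom R (syzygy R N) (cover R N)"
    unfolding syzygy_def by (rule module_hom_incl) (auto simp: a_kernel_def')
  from module_hom_comp[OF K(1) this] show "cover_map R (syzygy R N) \<in> module_hom R (cover R (syzygy R N)) (cover R N)" .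
  show "cover_map R (syzygy R N) ` carrier (cover R (syzygy R N)) = a_kernel (cover R N) N (cover_map R N)"
    using K(2) by (simp add: syzygy_def)
qed

lemma aug_exact_cover:
  assumes "Module.module R N"
  shows "aug_exact R (cover R (syzygy R (syzygy R N))) (cover_map R (syzygy R (syzygy R N)))
    (cover R (syzygy R N)) (cover_map R (syzygy R N)) (cover R N) (cover_map R N) N"
proof -
  note K0 = syzygy_module[OF assms]
  have zero: "\<zero>\<^bsub>syzygy R N\<^esub> = \<zero>\<^bsub>cover R N\<^esub>"
    by (simp add: syzygy_def)
  show ?thesis
    using assms K0 cover_map_syzygy_hom[OF K0] cover_map_syzygy_hom[OF assms] cover_map_surj_hom[OF assms]
    by (auto simp: aug_exact_def cover_module syzygy_module a_kernel_def' zero)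
qed

text \<open>The quotient is trivial iff every coset of the image in the kernel is the image itself.
  Condition \<open>uv\<close> makes the image a subgroup of the kernel, so that the quotient is a
  group at all.\<close>

lemma trivial_homology_iff:
  assumes G: "comm_group G" and H: "group H" and G': "group G'"
    and u: "u \<in> hom G H" and v: "v \<in> hom G' G"
    and uv: "\<And>x. x \<in> carrier G' \<Longrightarrow> u (v x) = \<one>\<^bsub>H\<^esub>"
  shows "trivial_group (G\<lparr>carrier := kernel G H u\<rparr> Mod (v ` carrier G')) \<longleftrightarrow>
    kernel G H u \<subseteq> v ` carrier G'"
proof -
  let ?K = "G\<lparr>carrier := kernel G H u\<rparr>" and ?I = "v ` carrier G'"
  interpret G: comm_group G by fact
  interpret u: group_hom G H u
    using H u by (simp add: group_hom_def group_hom_axioms_def G.is_group)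
  interpret v: group_hom G' G v
    using G' v by (simp add: group_hom_def group_hom_axioms_def G.is_group)
  have I: "subgroup ?I G" by (rule v.img_is_subgroup)
  have IK: "?I \<subseteq> kernel G H u"
    using uv by (auto simp: kernel_def)
  have K: "comm_group ?K"
    by (rule group.group_comm_groupI[OF G.subgroup_imp_group[OF u.subgroup_kernel]])
      (auto simp: kernel_def G.m_comm)
  interpret K: comm_group ?K by fact
  have sub: "subgroup ?I ?K"
    using G.subgroup_incl[OF I u.subgroup_kernel IK] .
  have carr: "carrier (?K Mod ?I) = (\<lambda>x. ?I #>\<^bsub>?K\<^esub> x) ` kernel G H u"
    by (simp add: carrier_FactGroup)
  have grp: "group (?K Mod ?I)"
    using K.abelian_FactGroup[OF sub] comm_group.axioms(2) by blast
  have "trivial_group (?K Mod ?I) \<longleftrightarrow> (\<forall>x\<in>kernel G H u. ?I #>\<^bsub>?K\<^esub> x = ?I)"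
    using grp u.subgroup_kernel[THEN subgroup.one_closed] unfolding trivial_group_def carr
    by (auto simp: image_iff)
  also have "\<dots> \<longleftrightarrow> kernel G H u \<subseteq> ?I"
    using K.coset_join1[OF _ _ sub] K.coset_join2[OF _ sub] subgroup.subset[OF sub] by auto
  finally show ?thesis .
qed

lemma trivial_Tor1_iff:
  assumes N: "Module.module R N" and M: "Module.module R M"
  shows "trivial_group (Tor1 R N M) \<longleftrightarrow>
    tensor_exact R M (cover R (syzygy R (syzygy R N))) (cover_map R (syzygy R (syzygy R N)))
      (cover R (syzygy R N)) (cover_map R (syzygy R N)) (cover R N)"
proof -
  let ?F0 = "cover R N" and ?F1 = "cover R (syzygy R N)" and ?F2 = "cover R (syzygy R (syzygy R N))"
  let ?d0 = "cover_map R (syzygy R N)" and ?d1 = "cover_map R (syzygy R (syzygy R N))"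
  have F: "Module.module R ?F2" "Module.module R ?F1" "Module.module R ?F0"
    and d: "?d1 \<in> module_hom R ?F2 ?F1" "?d0 \<in> module_hom R ?F1 ?F0"
    and k: "a_kernel ?F1 ?F0 ?d0 = ?d1 ` carrier ?F2"
    using aug_exact_cover[OF N] by (auto simp: aug_exact_def)
  interpret F0: Module.module R ?F0 by fact
  have "tensor_map R ?F0 M ?d0 (tensor_map R ?F1 M ?d1 X) = \<one>\<^bsub>tensor R ?F0 M\<^esub>"
    if X: "X \<in> carrier (tensor R ?F2 M)" for X
  proof -
    have dd: "?d0 (?d1 x) = \<zero>\<^bsub>?F0\<^esub>" if "x \<in> carrier ?F2" for x
      using k that by (auto simp: a_kernel_def')
    have "tensor_map R ?F0 M ?d0 (tensor_map R ?F1 M ?d1 X) = tensor_map R ?F0 M (\<lambda>x. ?d0 (?d1 x)) X"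
      by (rule tensor_map_comp[OF F M d X])
    also have "\<dots> = tensor_map R ?F0 M (\<lambda>x. \<zero>\<^bsub>?F0\<^esub>) X"
      by (rule tensor_map_cong[OF F(1,3) M module_hom_comp[OF d] F0.module_hom_zero_map[OF F(1)] dd X])
    finally show ?thesis
      by (simp add: tensor_map_zero[OF F(1,3) M X])
  qed
  then show ?thesis
    unfolding Tor1_def Let_def tensor_exact_def
    by (subst trivial_homology_iff[OF comm_group_tensor[OF F(2) M] group_tensor[OF F(3) M] group_tensor[OF F(1) M]
          tensor_map_hom[OF F(2,3) M d(2)] tensor_map_hom[OF F(1,2) M d(1)]])
      (auto simp: kernel_def)
qed

section \<open>Matrices acting on tuples of module elements\<close>

text \<open>A tuple of length \<open>n\<close> is zero from index \<open>n\<close> on, so that equality of tuples is equality of functions.\<close>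

definition tuples :: "('r, 'm, 'y) module_scheme \<Rightarrow> nat \<Rightarrow> (nat \<Rightarrow> 'm) set"
  where "tuples M n = {x. (\<forall>i<n. x i \<in> carrier M) \<and> (\<forall>i\<ge>n. x i = \<zero>\<^bsub>M\<^esub>)}"

definition tuple_group :: "('r, 'm, 'y) module_scheme \<Rightarrow> nat \<Rightarrow> (nat \<Rightarrow> 'm) monoid"
  where "tuple_group M n = \<lparr>carrier = tuples M n, monoid.mult = (\<lambda>x y i. x i \<oplus>\<^bsub>M\<^esub> y i), one = (\<lambda>i. \<zero>\<^bsub>M\<^esub>)\<rparr>"

text \<open>Matrices are functions of two indices of which only the entries below \<open>r\<close>
  and \<open>c\<close> are read, so the size is passed explicitly. The entries are scalars while the
  vector lies in any module: the same matrix acts on tuples of every coefficient module.\<close>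

definition mv :: "('r, 'm, 'y) module_scheme \<Rightarrow> nat \<Rightarrow> nat \<Rightarrow> (nat \<Rightarrow> nat \<Rightarrow> 'r) \<Rightarrow> (nat \<Rightarrow> 'm) \<Rightarrow> nat \<Rightarrow> 'm"
  where "mv M r c A x = (\<lambda>j. if j < r then msum M (\<lambda>l. A j l \<odot>\<^bsub>M\<^esub> x l) c else \<zero>\<^bsub>M\<^esub>)"

definition mat_in :: "('r, 'x) ring_scheme \<Rightarrow> nat \<Rightarrow> nat \<Rightarrow> (nat \<Rightarrow> nat \<Rightarrow> 'r) \<Rightarrow> bool"
  where "mat_in R r c A \<longleftrightarrow> (\<forall>j<r. \<forall>l<c. A j l \<in> carrier R)"

lemma tuple_group_simps [simp]:
  "carrier (tuple_group M n) = tuples M n"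
  "x \<otimes>\<^bsub>tuple_group M n\<^esub> y = (\<lambda>i. x i \<oplus>\<^bsub>M\<^esub> y i)"
  "\<one>\<^bsub>tuple_group M n\<^esub> = (\<lambda>i. \<zero>\<^bsub>M\<^esub>)"
  by (simp_all add: tuple_group_def)

lemma carrier_free_module_tuples: "carrier (free_module R {..<n}) = tuples (ring_as_module R) n"
proof (intro Set.set_eqI iffI)
  fix f assume f: "f \<in> tuples (ring_as_module R) n"
  have "finite {x. f x \<noteq> \<zero>\<^bsub>R\<^esub>}"
    by (rule finite_subset[of _ "{..<n}"]) (use f in \<open>auto simp: tuples_def ring_as_module_def not_less[symmetric]\<close>)
  with f show "f \<in> carrier (free_module R {..<n})"
    by (auto simp: carrier_free_module tuples_def ring_as_module_def)
qed (auto simp: carrier_free_module tuples_def ring_as_module_def)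

lemma ring_as_module_simps [simp]:
  "carrier (ring_as_module R) = carrier R" "\<zero>\<^bsub>ring_as_module R\<^esub> = \<zero>\<^bsub>R\<^esub>"
  "x \<oplus>\<^bsub>ring_as_module R\<^esub> y = x \<oplus>\<^bsub>R\<^esub> y" "r \<odot>\<^bsub>ring_as_module R\<^esub> x = r \<otimes>\<^bsub>R\<^esub> x"
  by (simp_all add: ring_as_module_def)

lemma (in cring) module_ring_as_module: "Module.module R (ring_as_module R)"
proof (rule moduleI)
  show "abelian_group (ring_as_module R)"
    by (rule abelian_groupI) (auto simp: a_ac intro: exI[of _ "\<ominus> _"] bexI[of _ "\<ominus> _"] l_neg)
qed (auto simp: is_cring l_distr r_distr m_assoc)

lemma msum_ring_as_module [simp]: "msum (ring_as_module R) f n = msum R f n"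
  by (induction n) auto

context Module.module
begin

lemma tuples_closed: "x \<in> tuples M n \<Longrightarrow> x i \<in> carrier M"
  by (cases "i < n") (auto simp: tuples_def)

lemma tuples_zero: "(\<lambda>i. \<zero>\<^bsub>M\<^esub>) \<in> tuples M n"
  by (simp add: tuples_def)

lemma tuples_add: "x \<in> tuples M n \<Longrightarrow> y \<in> tuples M n \<Longrightarrow> (\<lambda>i. x i \<oplus>\<^bsub>M\<^esub> y i) \<in> tuples M n"
  by (simp add: tuples_def)

lemma tuples_minus: "x \<in> tuples M n \<Longrightarrow> (\<lambda>i. \<ominus>\<^bsub>M\<^esub> x i) \<in> tuples M n"
  by (simp add: tuples_def)

lemma tuples_diff: "x \<in> tuples M n \<Longrightarrow> y \<in> tuples M n \<Longrightarrow> (\<lambda>i. x i \<ominus>\<^bsub>M\<^esub> y i) \<in> tuples M n"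
  by (simp add: tuples_def a_minus_def)

lemma comm_group_tuple_group: "comm_group (tuple_group M n)"
proof (rule comm_groupI)
  fix x assume x: "x \<in> carrier (tuple_group M n)"
  have "(\<lambda>i. \<ominus>\<^bsub>M\<^esub> x i \<oplus>\<^bsub>M\<^esub> x i) = (\<lambda>i. \<zero>\<^bsub>M\<^esub>)"
    using x by (auto simp: M.l_neg tuples_closed)
  then show "\<exists>y\<in>carrier (tuple_group M n). y \<otimes>\<^bsub>tuple_group M n\<^esub> x = \<one>\<^bsub>tuple_group M n\<^esub>"
    using x by (intro bexI[of _ "\<lambda>i. \<ominus>\<^bsub>M\<^esub> x i"]) (auto simp: tuples_minus)
qed (auto simp: tuples_zero tuples_add tuples_closed M.a_ac)

lemma iprod_tuple_group: "iprod (tuple_group M k) f n = (\<lambda>i. msum M (\<lambda>l. f l i) n)"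
  by (induction n) auto

lemma mv_closed:
  assumes "mat_in R r c A" "x \<in> tuples M c"
  shows "mv M r c A x \<in> tuples M r"
  using assms by (auto simp: mv_def tuples_def mat_in_def intro!: M.msum_closed)

lemma mv_diff:
  assumes "mat_in R r c A" "x \<in> tuples M c" "y \<in> tuples M c"
  shows "mv M r c A (\<lambda>i. x i \<ominus>\<^bsub>M\<^esub> y i) = (\<lambda>i. mv M r c A x i \<ominus>\<^bsub>M\<^esub> mv M r c A y i)"
proof
  fix j
  have "msum M (\<lambda>l. A j l \<odot>\<^bsub>M\<^esub> (x l \<ominus>\<^bsub>M\<^esub> y l)) n = msum M (\<lambda>l. A j l \<odot>\<^bsub>M\<^esub> x l) n \<ominus>\<^bsub>M\<^esub> msum M (\<lambda>l. A j l \<odot>\<^bsub>M\<^esub> y l) n"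
    if "j < r" "n \<le> c" for n
    using that(2)
  proof (induction n)
    case 0
    then show ?case using diff_eq_zero_iff[of "\<zero>\<^bsub>M\<^esub>" "\<zero>\<^bsub>M\<^esub>"] by simp
  next
    case (Suc n)
    have A: "A j l \<in> carrier R" if "l < Suc n" for l
      using assms(1) \<open>j < r\<close> Suc.prems that by (auto simp: mat_in_def)
    then have "msum M (\<lambda>l. A j l \<odot>\<^bsub>M\<^esub> x l) n \<in> carrier M" "msum M (\<lambda>l. A j l \<odot>\<^bsub>M\<^esub> y l) n \<in> carrier M"
      using assms by (auto intro!: M.msum_closed simp: tuples_closed)
    then show ?case
      using Suc A[of n] tuples_closed[OF assms(2), of n] tuples_closed[OF assms(3), of n]
      by (simp add: a_minus_def smult_r_distr smult_r_minus M.minus_add M.a_ac)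
  qed
  then show "mv M r c A (\<lambda>i. x i \<ominus>\<^bsub>M\<^esub> y i) j = mv M r c A x j \<ominus>\<^bsub>M\<^esub> mv M r c A y j"
    using diff_eq_zero_iff[of "\<zero>\<^bsub>M\<^esub>" "\<zero>\<^bsub>M\<^esub>"] by (simp add: mv_def)
qed

lemma mv_zero_tuple:
  "mat_in R r c A \<Longrightarrow> mv M r c A (\<lambda>_. \<zero>\<^bsub>M\<^esub>) = (\<lambda>_. \<zero>\<^bsub>M\<^esub>)"
  by (auto simp: mv_def mat_in_def fun_eq_iff intro!: M.msum_zero)

lemma mv_add:
  assumes A: "mat_in R r c A" and x: "x \<in> tuples M c" and y: "y \<in> tuples M c"
  shows "mv M r c A (\<lambda>i. x i \<oplus>\<^bsub>M\<^esub> y i) = (\<lambda>i. mv M r c A x i \<oplus>\<^bsub>M\<^esub> mv M r c A y i)"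
proof
  fix j
  show "mv M r c A (\<lambda>i. x i \<oplus>\<^bsub>M\<^esub> y i) j = mv M r c A x j \<oplus>\<^bsub>M\<^esub> mv M r c A y j"
  proof (cases "j < r")
    case True
    then have "A j l \<in> carrier R" if "l < c" for l
      using A that by (auto simp: mat_in_def)
    with True show ?thesis
      using tuples_closed[OF x] tuples_closed[OF y]
      by (simp add: mv_def M.msum_add[symmetric] smult_r_distr cong: msum_cong)
  qed (simp add: mv_def)
qed

lemma mv_minus:
  assumes A: "mat_in R r c A" and x: "x \<in> tuples M c"
  shows "mv M r c A (\<lambda>i. \<ominus>\<^bsub>M\<^esub> x i) = (\<lambda>i. \<ominus>\<^bsub>M\<^esub> mv M r c A x i)"
  using mv_diff[OF A tuples_zero x] mv_zero_tuple[OF A] tuples_closed[OF x] tuples_closed[OF mv_closed[OF A x]]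
  by (simp add: a_minus_def)

text \<open>Associativity is the interchange of two finite sums. The product matrix is described by
  its entries within the size, as a matrix is arbitrary outside.\<close>

lemma mv_mv:
  assumes A: "mat_in R r c A" and B: "mat_in R c d B" and x: "x \<in> tuples M d"
    and AB: "\<And>j l. j < r \<Longrightarrow> l < d \<Longrightarrow> msum R (\<lambda>p. A j p \<otimes> B p l) c = C j l"
  shows "mv M r c A (mv M c d B x) = mv M r d C x"
proof
  fix j
  show "mv M r c A (mv M c d B x) j = mv M r d C x j"
  proof (cases "j < r")
    case True
    have a: "A j l \<in> carrier R" if "l < c" for l
      using A True that by (auto simp: mat_in_def)
    have b: "B l p \<in> carrier R" if "l < c" "p < d" for l p
      using B that by (auto simp: mat_in_def)
    have "mv M r c A (mv M c d B x) j = msum M (\<lambda>l. A j l \<odot>\<^bsub>M\<^esub> msum M (\<lambda>p. B l p \<odot>\<^bsub>M\<^esub> x p) d) c"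
      using True by (auto simp: mv_def intro: msum_cong)
    also have "\<dots> = msum M (\<lambda>l. msum M (\<lambda>p. (A j l \<otimes> B l p) \<odot>\<^bsub>M\<^esub> x p) d) c"
      using a b tuples_closed[OF x] by (intro msum_cong) (auto simp: smult_msum smult_assoc1 intro!: msum_cong)
    also have "\<dots> = msum M (\<lambda>p. msum M (\<lambda>l. (A j l \<otimes> B l p) \<odot>\<^bsub>M\<^esub> x p) c) d"
      using a b tuples_closed[OF x] by (intro M.msum_swap) auto
    also have "\<dots> = msum M (\<lambda>p. C j p \<odot>\<^bsub>M\<^esub> x p) d"
      using a b tuples_closed[OF x] True by (intro msum_cong) (simp add: msum_smult[symmetric] AB)
    finally show ?thesis
      using True by (simp add: mv_def)
  qed (simp add: mv_def)
qed

end

lemma tuples_module_hom: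
  assumes "Module.module R A" "Module.module R B" "f \<in> module_hom R A B" "x \<in> tuples A n"
  shows "(\<lambda>i. f (x i)) \<in> tuples B n"
  using assms(4) module_hom_zero[OF assms(1-3)] by (auto simp: tuples_def module_hom_closed[OF assms(3)])

text \<open>Matrices act naturally in the coefficient module. All diagram chases between complexes
  with different coefficients rest on this.\<close>

lemma mv_module_hom:
  assumes A: "Module.module R A" and B: "Module.module R B" and f: "f \<in> module_hom R A B"
    and "mat_in R r c D" "x \<in> tuples A c"
  shows "mv B r c D (\<lambda>i. f (x i)) = (\<lambda>i. f (mv A r c D x i))"
proof
  fix j
  interpret A: Module.module R A by fact
  show "mv B r c D (\<lambda>i. f (x i)) j = f (mv A r c D x j)"
    using assms(4) A.tuples_closed[OF assms(5)]
    by (auto simp: mv_def mat_in_def module_hom_zero[OF A B f] msum_module_hom[OF A B f]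
        module_hom_smult[OF f] intro!: msum_cong)
qed

lemma (in cring) free_module_hom_expand:
  assumes A: "Module.module R A" and u: "u \<in> module_hom R (free_module R {..<n}) A"
    and f: "f \<in> carrier (free_module R {..<n})"
  shows "u f = msum A (\<lambda>l. f l \<odot>\<^bsub>A\<^esub> u (delta R l)) n"
proof -
  interpret A: Module.module R A by fact
  have d: "u (delta R l) \<in> carrier A" if "l < n" for l
    using module_hom_closed[OF u delta_closed] that by simp
  have v: "(\<lambda>f. msum A (\<lambda>l. f l \<odot>\<^bsub>A\<^esub> u (delta R l)) n) \<in> module_hom R (free_module R {..<n}) A"
  proof (rule module_homI)
    fix f g r assume f: "f \<in> carrier (free_module R {..<n})"
    note fl = free_module_closed[OF f] d
    show "msum A (\<lambda>l. f l \<odot>\<^bsub>A\<^esub> u (delta R l)) n \<in> carrier A"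
      using fl by (intro A.M.msum_closed) auto
    show "msum A (\<lambda>l. (r \<odot>\<^bsub>free_module R {..<n}\<^esub> f) l \<odot>\<^bsub>A\<^esub> u (delta R l)) n
        = r \<odot>\<^bsub>A\<^esub> msum A (\<lambda>l. f l \<odot>\<^bsub>A\<^esub> u (delta R l)) n" if "r \<in> carrier R"
      using fl that by (simp add: A.smult_msum A.smult_assoc1 cong: msum_cong)
    assume "g \<in> carrier (free_module R {..<n})"
    note gl = free_module_closed[OF this]
    show "msum A (\<lambda>l. (f \<oplus>\<^bsub>free_module R {..<n}\<^esub> g) l \<odot>\<^bsub>A\<^esub> u (delta R l)) n
        = msum A (\<lambda>l. f l \<odot>\<^bsub>A\<^esub> u (delta R l)) n \<oplus>\<^bsub>A\<^esub> msum A (\<lambda>l. g l \<odot>\<^bsub>A\<^esub> u (delta R l)) n"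
      using fl gl by (simp add: A.M.msum_add[symmetric] A.smult_l_distr cong: msum_cong)
  qed
  show ?thesis
  proof (rule free_module_hom_eqI[OF A u v _ f])
    fix x assume x: "x \<in> {..<n}"
    have "msum A (\<lambda>l. delta R x l \<odot>\<^bsub>A\<^esub> u (delta R l)) n
        = msum A (\<lambda>l. if l = x then u (delta R x) else \<zero>\<^bsub>A\<^esub>) n"
      using d by (intro msum_cong) (auto simp: delta_def)
    then show "u (delta R x) = msum A (\<lambda>l. delta R x l \<odot>\<^bsub>A\<^esub> u (delta R l)) n"
      using x d by (simp add: A.M.msum_single)
  qed
qed

section \<open>Tensor products with retracts of finite free modules in coordinates\<close>

lemma tens_zero_left:
  assumes A: "Module.module R A" and M: "Module.module R M" and m: "m \<in> carrier M"
  shows "tens R A M \<zero>\<^bsub>A\<^esub> m = \<one>\<^bsub>tensor R A M\<^esub>"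
proof -
  interpret A: Module.module R A by fact
  have "tensor_map R A M (\<lambda>x. \<zero>\<^bsub>A\<^esub>) (tens R A M \<zero>\<^bsub>A\<^esub> m) = tens R A M \<zero>\<^bsub>A\<^esub> m"
    by (rule tensor_map_tens[OF A A M A.module_hom_zero_map[OF A] A.M.zero_closed m])
  then show ?thesis
    using tensor_map_zero[OF A A M tens_closed[OF A.M.zero_closed m]] by metis
qed

lemma tens_msum_left:
  assumes A: "Module.module R A" and M: "Module.module R M" and m: "m \<in> carrier M"
    and f: "\<And>i. i < n \<Longrightarrow> f i \<in> carrier A"
  shows "tens R A M (msum A f n) m = iprod (tensor R A M) (\<lambda>i. tens R A M (f i) m) n"
proof -
  interpret A: Module.module R A by fact
  show ?thesis
    using f by (induction n)
      (auto simp: tens_zero_left[OF A M m] tens_add_left[OF A M] m A.M.msum_closed)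
qed

text \<open>The map from \<open>k\<close>-tuples in \<open>M\<close> to \<open>P \<otimes> M\<close>
  that sends \<open>x\<close> to the sum of the tensors of \<open>p (delta R l)\<close> with
  \<open>x l\<close>. It inverts the coordinate map of \<open>tuple_of_tensor\<close> from the
  left.\<close>

definition tens_of_tuple where
  "tens_of_tuple R P M k p x = iprod (tensor R P M) (\<lambda>l. tens R P M (p (delta R l)) (x l)) k"

lemma tens_of_tuple_closed:
  assumes "retract_free R P {..<k} i p" "Module.module R M" "x \<in> tuples M k"
  shows "tens_of_tuple R P M k p x \<in> carrier (tensor R P M)"
proof -
  have P: "Module.module R P" and p: "p \<in> module_hom R (free_module R {..<k}) P"
    using assms(1) by (auto simp: retract_free_def)
  interpret P: Module.module R P by fact
  show ?thesis
    unfolding tens_of_tuple_def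
    by (rule comm_group.iprod_closed[OF comm_group_tensor[OF P assms(2)]] tens_closed)+
      (use module_hom_closed[OF p P.R.delta_closed] assms(3) in \<open>auto simp: tuples_def\<close>)
qed

lemma tens_of_tuple_zero:
  assumes "retract_free R P {..<k} i p" "Module.module R M"
  shows "tens_of_tuple R P M k p (\<lambda>_. \<zero>\<^bsub>M\<^esub>) = \<one>\<^bsub>tensor R P M\<^esub>"
proof -
  have P: "Module.module R P" and p: "p \<in> module_hom R (free_module R {..<k}) P"
    using assms(1) by (auto simp: retract_free_def)
  interpret P: Module.module R P by fact
  interpret M: Module.module R M by fact
  have "tens R P M (p (delta R l)) \<zero>\<^bsub>M\<^esub> = \<one>\<^bsub>tensor R P M\<^esub>" if "l < k" for l
  proof -
    have pl: "p (delta R l) \<in> carrier P"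
      using module_hom_closed[OF p P.R.delta_closed] that by simp
    have "tens R P M (p (delta R l)) (\<zero>\<^bsub>R\<^esub> \<odot>\<^bsub>M\<^esub> \<zero>\<^bsub>M\<^esub>) = tens R P M (\<zero>\<^bsub>R\<^esub> \<odot>\<^bsub>P\<^esub> p (delta R l)) \<zero>\<^bsub>M\<^esub>"
      using tens_smult[OF P assms(2) P.R.zero_closed pl M.M.zero_closed] by simp
    then show ?thesis
      using pl by (simp add: tens_zero_left[OF P assms(2)])
  qed
  then show ?thesis
    unfolding tens_of_tuple_def
    by (intro comm_group.iprod_one[OF comm_group_tensor[OF P assms(2)]]) auto
qed

text \<open>The coordinates of \<open>a\<close> given by \<open>i\<close> turn the tensor of
  \<open>a\<close> and \<open>m\<close> into the tuple of all \<open>i a j * m\<close>. Going back,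
  the coefficients move to the left factor and add up to \<open>p (i a) = a\<close>. Thus
  \<open>P \<otimes> M\<close> is embedded in the tuples as a direct summand.\<close>

lemma tuple_of_tensor:
  assumes free: "retract_free R P {..<k} i p" and M: "Module.module R M"
  obtains \<Psi> where "\<Psi> \<in> hom (tensor R P M) (tuple_group M k)"
    "\<And>a m. a \<in> carrier P \<Longrightarrow> m \<in> carrier M \<Longrightarrow> \<Psi> (tens R P M a m) = (\<lambda>j. i a j \<odot>\<^bsub>M\<^esub> m)"
    "\<And>X. X \<in> carrier (tensor R P M) \<Longrightarrow> tens_of_tuple R P M k p (\<Psi> X) = X"
proof -
  have P: "Module.module R P" and p: "p \<in> module_hom R (free_module R {..<k}) P"
    and i: "i \<in> module_hom R P (free_module R {..<k})" and pi: "\<And>x. x \<in> carrier P \<Longrightarrow> p (i x) = x"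
    using free by (auto simp: retract_free_def)
  interpret P: Module.module R P by fact
  interpret M: Module.module R M by fact
  interpret T: comm_group "tensor R P M" by (rule comm_group_tensor[OF P M])
  note ic = module_hom_closed[OF i] P.R.free_module_closed[OF module_hom_closed[OF i]]
  have beyond: "i a j = \<zero>\<^bsub>R\<^esub>" if "a \<in> carrier P" "j \<ge> k" for a j
    using ic(1)[OF that(1)] that(2) by (auto simp: carrier_free_module)
  obtain \<Psi> where \<Psi>: "\<Psi> \<in> hom (tensor R P M) (tuple_group M k)"
    "\<And>a m. a \<in> carrier P \<Longrightarrow> m \<in> carrier M \<Longrightarrow> \<Psi> (tens R P M a m) = (\<lambda>j. i a j \<odot>\<^bsub>M\<^esub> m)"
    by (rule tensor_universal[OF P M M.comm_group_tuple_group, of "\<lambda>a m j. i a j \<odot>\<^bsub>M\<^esub> m" k])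
      (auto simp: tuples_def ic beyond module_hom_add[OF i] module_hom_smult[OF i] M.smult_l_distr
        M.smult_r_distr M.smult_assoc1 P.R.m_comm[of _ "i _ _"])
  have pd: "p (delta R l) \<in> carrier P" if "l < k" for l
    using module_hom_closed[OF p P.R.delta_closed] that by simp
  have \<Psi>c: "\<Psi> X \<in> tuples M k" if "X \<in> carrier (tensor R P M)" for X
    using hom_in_carrier[OF \<Psi>(1) that] by simp
  have \<Phi>_add: "tens_of_tuple R P M k p (\<lambda>j. x j \<oplus>\<^bsub>M\<^esub> y j)
      = tens_of_tuple R P M k p x \<otimes>\<^bsub>tensor R P M\<^esub> tens_of_tuple R P M k p y"
    if "x \<in> tuples M k" "y \<in> tuples M k" for x y
    unfolding tens_of_tuple_def using that pd
    by (simp add: T.iprod_mult[symmetric] tens_closed M.tuples_closed tens_add_right[OF P M] cong: iprod_cong)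
  have "tens_of_tuple R P M k p (\<Psi> X) = X" if X: "X \<in> carrier (tensor R P M)" for X
  proof (rule tensor_hom_eqI[OF P M T.is_group _ _ _ X])
    show "(\<lambda>X. tens_of_tuple R P M k p (\<Psi> X)) \<in> hom (tensor R P M) (tensor R P M)"
      by (rule homI) (auto simp: tens_of_tuple_closed[OF free M] \<Psi>c hom_mult[OF \<Psi>(1)] \<Phi>_add)
    show "(\<lambda>X. X) \<in> hom (tensor R P M) (tensor R P M)" by (auto simp: hom_def)
    fix a m assume a: "a \<in> carrier P" and m: "m \<in> carrier M"
    have "tens_of_tuple R P M k p (\<Psi> (tens R P M a m))
        = iprod (tensor R P M) (\<lambda>l. tens R P M (i a l \<odot>\<^bsub>P\<^esub> p (delta R l)) m) k"
      unfolding tens_of_tuple_def \<Psi>(2)[OF a m]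
      by (rule iprod_cong) (simp add: tens_smult[OF P M] ic[OF a] pd m)
    also have "\<dots> = tens R P M (msum P (\<lambda>l. i a l \<odot>\<^bsub>P\<^esub> p (delta R l)) k) m"
      by (rule tens_msum_left[OF P M m, symmetric]) (simp add: pd ic[OF a])
    also have "msum P (\<lambda>l. i a l \<odot>\<^bsub>P\<^esub> p (delta R l)) k = a"
      using P.R.free_module_hom_expand[OF P p ic(1)[OF a]] pi[OF a] by simp
    finally show "tens_of_tuple R P M k p (\<Psi> (tens R P M a m)) = tens R P M a m" .
  qed
  with \<Psi> show thesis by (rule that)
qed

text \<open>In coordinates \<open>d \<otimes> id\<close> is the matrix of
  \<open>i' \<circ> d \<circ> p\<close>. With \<open>Q = P\<close> and \<open>d\<close> the identity
  this matrix is the idempotent of the retract.\<close>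

lemma tuple_of_tensor_map:
  assumes freeP: "retract_free R P {..<k} i p" and freeQ: "retract_free R Q {..<k'} i' p'"
    and M: "Module.module R M" and d: "d \<in> module_hom R P Q"
    and \<Psi>: "\<Psi> \<in> hom (tensor R Q M) (tuple_group M k')"
      "\<And>a m. a \<in> carrier Q \<Longrightarrow> m \<in> carrier M \<Longrightarrow> \<Psi> (tens R Q M a m) = (\<lambda>j. i' a j \<odot>\<^bsub>M\<^esub> m)"
    and D: "\<And>j l. j < k' \<Longrightarrow> l < k \<Longrightarrow> D j l = i' (d (p (delta R l))) j"
    and x: "x \<in> tuples M k"
  shows "\<Psi> (tensor_map R Q M d (tens_of_tuple R P M k p x)) = mv M k' k D x"
proof -
  have P: "Module.module R P" and p: "p \<in> module_hom R (free_module R {..<k}) P"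
    and Q: "Module.module R Q" and i': "i' \<in> module_hom R Q (free_module R {..<k'})"
    using freeP freeQ by (auto simp: retract_free_def)
  interpret P: Module.module R P by fact
  interpret M: Module.module R M by fact
  have pd: "p (delta R l) \<in> carrier P" if "l < k" for l
    using module_hom_closed[OF p P.R.delta_closed] that by simp
  note dd = module_hom_closed[OF d pd]
  have xl: "x l \<in> carrier M" if "l < k" for l
    using x that by (auto simp: tuples_def)
  have "\<Psi> (tensor_map R Q M d (tens_of_tuple R P M k p x))
      = \<Psi> (iprod (tensor R Q M) (\<lambda>l. tensor_map R Q M d (tens R P M (p (delta R l)) (x l))) k)"
    unfolding tens_of_tuple_def
    by (subst hom_iprod(1)[OF group_tensor[OF P M] group_tensor[OF Q M] tensor_map_hom[OF P Q M d]])
      (auto simp: tens_closed pd xl)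
  also have "\<dots> = \<Psi> (iprod (tensor R Q M) (\<lambda>l. tens R Q M (d (p (delta R l))) (x l)) k)"
    by (intro arg_cong[of _ _ \<Psi>] iprod_cong) (simp add: tensor_map_tens[OF P Q M d] pd xl)
  also have "\<dots> = iprod (tuple_group M k') (\<lambda>l. \<Psi> (tens R Q M (d (p (delta R l))) (x l))) k"
    by (rule hom_iprod(1)[OF group_tensor[OF Q M] comm_group.axioms(2)[OF M.comm_group_tuple_group] \<Psi>(1)])
      (simp add: tens_closed dd xl)
  also have "\<dots> = iprod (tuple_group M k') (\<lambda>l j. i' (d (p (delta R l))) j \<odot>\<^bsub>M\<^esub> x l) k"
    by (rule iprod_cong) (simp add: \<Psi>(2) dd xl)
  also have "\<dots> = mv M k' k D x"
  proof
    fix j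
    show "iprod (tuple_group M k') (\<lambda>l j. i' (d (p (delta R l))) j \<odot>\<^bsub>M\<^esub> x l) k j = mv M k' k D x j"
    proof (cases "j < k'")
      case True
      then show ?thesis
        by (simp add: M.iprod_tuple_group mv_def D cong: msum_cong)
    next
      case False
      then have "i' (d (p (delta R l))) j = \<zero>\<^bsub>R\<^esub>" if "l < k" for l
        using module_hom_closed[OF i' dd[OF that]] by (auto simp: carrier_free_module)
      with False show ?thesis
        by (auto simp: M.iprod_tuple_group mv_def xl intro!: M.M.msum_zero)
    qed
  qed
  finally show ?thesis .
qed

text \<open>A tuple \<open>x\<close> stands for the tensor
  \<open>tens_of_tuple R P1 M k1 p1 x\<close>, whose coordinates are \<open>E x\<close> and not
  \<open>x\<close>. Hence being a boundary reads \<open>E x = D1 y\<close>, while \<open>x\<close>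
  itself may run through all tuples.\<close>

lemma tensor_exact_iff:
  assumes free: "retract_free R P2 {..<k2} i2 p2" "retract_free R P1 {..<k1} i1 p1" "retract_free R P0 {..<k0} i0 p0"
    and d1: "d1 \<in> module_hom R P2 P1" and d0: "d0 \<in> module_hom R P1 P0" and M: "Module.module R M"
    and E: "\<And>j l. j < k1 \<Longrightarrow> l < k1 \<Longrightarrow> E j l = i1 (p1 (delta R l)) j"
    and D1: "\<And>j l. j < k1 \<Longrightarrow> l < k2 \<Longrightarrow> D1 j l = i1 (d1 (p2 (delta R l))) j"
    and D0: "\<And>j l. j < k0 \<Longrightarrow> l < k1 \<Longrightarrow> D0 j l = i0 (d0 (p1 (delta R l))) j"
  shows "tensor_exact R M P2 d1 P1 d0 P0 \<longleftrightarrow>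
    (\<forall>x\<in>tuples M k1. mv M k0 k1 D0 x = (\<lambda>_. \<zero>\<^bsub>M\<^esub>) \<longrightarrow> (\<exists>y\<in>tuples M k2. mv M k1 k1 E x = mv M k1 k2 D1 y))"
proof -
  have P: "Module.module R P2" "Module.module R P1" "Module.module R P0"
    using free by (auto simp: retract_free_def)
  obtain \<Psi>2 where \<Psi>2: "\<Psi>2 \<in> hom (tensor R P2 M) (tuple_group M k2)"
    "\<And>a m. a \<in> carrier P2 \<Longrightarrow> m \<in> carrier M \<Longrightarrow> \<Psi>2 (tens R P2 M a m) = (\<lambda>j. i2 a j \<odot>\<^bsub>M\<^esub> m)"
    "\<And>X. X \<in> carrier (tensor R P2 M) \<Longrightarrow> tens_of_tuple R P2 M k2 p2 (\<Psi>2 X) = X"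
    by (rule tuple_of_tensor[OF free(1) M]) metis
  obtain \<Psi>1 where \<Psi>1: "\<Psi>1 \<in> hom (tensor R P1 M) (tuple_group M k1)"
    "\<And>a m. a \<in> carrier P1 \<Longrightarrow> m \<in> carrier M \<Longrightarrow> \<Psi>1 (tens R P1 M a m) = (\<lambda>j. i1 a j \<odot>\<^bsub>M\<^esub> m)"
    "\<And>X. X \<in> carrier (tensor R P1 M) \<Longrightarrow> tens_of_tuple R P1 M k1 p1 (\<Psi>1 X) = X"
    by (rule tuple_of_tensor[OF free(2) M]) metis
  obtain \<Psi>0 where \<Psi>0: "\<Psi>0 \<in> hom (tensor R P0 M) (tuple_group M k0)"
    "\<And>a m. a \<in> carrier P0 \<Longrightarrow> m \<in> carrier M \<Longrightarrow> \<Psi>0 (tens R P0 M a m) = (\<lambda>j. i0 a j \<odot>\<^bsub>M\<^esub> m)"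
    "\<And>X. X \<in> carrier (tensor R P0 M) \<Longrightarrow> tens_of_tuple R P0 M k0 p0 (\<Psi>0 X) = X"
    by (rule tuple_of_tensor[OF free(3) M]) metis
  let ?\<Phi>2 = "tens_of_tuple R P2 M k2 p2" and ?\<Phi>1 = "tens_of_tuple R P1 M k1 p1"
    and ?\<Phi>0 = "tens_of_tuple R P0 M k0 p0"
  interpret M: Module.module R M by fact
  note \<Phi>c = tens_of_tuple_closed[OF free(1) M] tens_of_tuple_closed[OF free(2) M]
  have \<Psi>c: "X \<in> carrier (tensor R P1 M) \<Longrightarrow> \<Psi>1 X \<in> tuples M k1"
    "Y \<in> carrier (tensor R P2 M) \<Longrightarrow> \<Psi>2 Y \<in> tuples M k2" for X Y
    using hom_in_carrier[OF \<Psi>1(1), of X] hom_in_carrier[OF \<Psi>2(1), of Y] by simp_all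
  have 0: "\<Psi>0 (tensor_map R P0 M d0 (?\<Phi>1 x)) = mv M k0 k1 D0 x" if "x \<in> tuples M k1" for x
    by (rule tuple_of_tensor_map[OF free(2,3) M d0 \<Psi>0(1,2) D0 that])
  have 1: "\<Psi>1 (tensor_map R P1 M d1 (?\<Phi>2 y)) = mv M k1 k2 D1 y" if "y \<in> tuples M k2" for y
    by (rule tuple_of_tensor_map[OF free(1,2) M d1 \<Psi>1(1,2) D1 that])
  have 2: "\<Psi>1 (?\<Phi>1 x) = mv M k1 k1 E x" if "x \<in> tuples M k1" for x
    using tuple_of_tensor_map[OF free(2,2) M module_hom_id \<Psi>1(1,2) E that]
      tensor_map_id[OF P(2) M \<Phi>c(2)[OF that]] by simp
  have \<Psi>0_one: "\<Psi>0 \<one>\<^bsub>tensor R P0 M\<^esub> = (\<lambda>_. \<zero>\<^bsub>M\<^esub>)"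
    using hom_one[OF \<Psi>0(1) group_tensor[OF P(3) M] comm_group.axioms(2)[OF M.comm_group_tuple_group]] by simp
  show ?thesis
  proof
    assume exact: "tensor_exact R M P2 d1 P1 d0 P0"
    show "\<forall>x\<in>tuples M k1. mv M k0 k1 D0 x = (\<lambda>_. \<zero>\<^bsub>M\<^esub>) \<longrightarrow> (\<exists>y\<in>tuples M k2. mv M k1 k1 E x = mv M k1 k2 D1 y)"
    proof (intro ballI impI)
      fix x assume x: "x \<in> tuples M k1" and zero: "mv M k0 k1 D0 x = (\<lambda>_. \<zero>\<^bsub>M\<^esub>)"
      have "?\<Phi>0 (\<Psi>0 (tensor_map R P0 M d0 (?\<Phi>1 x))) = \<one>\<^bsub>tensor R P0 M\<^esub>"
        by (simp add: 0[OF x] zero tens_of_tuple_zero[OF free(3) M])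
      then have "tensor_map R P0 M d0 (?\<Phi>1 x) = \<one>\<^bsub>tensor R P0 M\<^esub>"
        by (simp add: \<Psi>0(3) tensor_map_closed[OF P(2,3) M d0 \<Phi>c(2)[OF x]])
      then obtain Y where Y: "Y \<in> carrier (tensor R P2 M)" "?\<Phi>1 x = tensor_map R P1 M d1 Y"
        using exact \<Phi>c(2)[OF x] unfolding tensor_exact_def by blast
      have "mv M k1 k1 E x = mv M k1 k2 D1 (\<Psi>2 Y)"
        using 1[OF \<Psi>c(2)[OF Y(1)]] 2[OF x] Y \<Psi>2(3)[OF Y(1)] by simp
      then show "\<exists>y\<in>tuples M k2. mv M k1 k1 E x = mv M k1 k2 D1 y"
        using \<Psi>c(2)[OF Y(1)] by blast
    qed
  next
    assume exact: "\<forall>x\<in>tuples M k1. mv M k0 k1 D0 x = (\<lambda>_. \<zero>\<^bsub>M\<^esub>) \<longrightarrow> (\<exists>y\<in>tuples M k2. mv M k1 k1 E x = mv M k1 k2 D1 y)"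
    show "tensor_exact R M P2 d1 P1 d0 P0"
      unfolding tensor_exact_def
    proof (intro ballI impI)
      fix X assume X: "X \<in> carrier (tensor R P1 M)" and zero: "tensor_map R P0 M d0 X = \<one>\<^bsub>tensor R P0 M\<^esub>"
      have "mv M k0 k1 D0 (\<Psi>1 X) = (\<lambda>_. \<zero>\<^bsub>M\<^esub>)"
        using 0[OF \<Psi>c(1)[OF X]] by (simp add: \<Psi>1(3)[OF X] zero \<Psi>0_one)
      then obtain y where y: "y \<in> tuples M k2" "mv M k1 k1 E (\<Psi>1 X) = mv M k1 k2 D1 y"
        using exact \<Psi>c(1)[OF X] by blast
      have "\<Psi>1 X = \<Psi>1 (tensor_map R P1 M d1 (?\<Phi>2 y))"
        using 1[OF y(1)] 2[OF \<Psi>c(1)[OF X]] y(2) by (simp add: \<Psi>1(3)[OF X])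
      \<comment> \<open>\<open>\<Psi>1\<close> is injective, having the left inverse
        \<open>?\<Phi>1\<close>.\<close>
      then have "X = tensor_map R P1 M d1 (?\<Phi>2 y)"
        using \<Psi>1(3)[OF X] \<Psi>1(3)[OF tensor_map_closed[OF P(1,2) M d1 \<Phi>c(1)[OF y(1)]]] by metis
      then show "X \<in> tensor_map R P1 M d1 ` carrier (tensor R P2 M)"
        using \<Phi>c(1)[OF y(1)] by blast
    qed
  qed
qed

section \<open>Finite resolutions by finitely generated projectives as matrices\<close>

text \<open>A finitely generated projective module is the image of an idempotent matrix \<open>e i\<close> of size \<open>k i\<close>, and a map
  \<open>P (i + 1) \<rightarrow> P i\<close> is a matrix \<open>D i\<close> with \<open>e i * D i = D i = D i * e (i + 1)\<close>. Then \<open>P i \<otimes> M\<close> is the set of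
  tuples in \<open>M\<close> fixed by \<open>e i\<close>, and \<open>mexact M k e D i\<close> says that the complex with coefficients in \<open>M\<close> is
  exact in degree \<open>i + 1\<close>. Exactness in degree \<open>0\<close> is not required.\<close>

definition mexact :: "('r, 'm, 'y) module_scheme \<Rightarrow> (nat \<Rightarrow> nat) \<Rightarrow> (nat \<Rightarrow> nat \<Rightarrow> nat \<Rightarrow> 'r) \<Rightarrow>
    (nat \<Rightarrow> nat \<Rightarrow> nat \<Rightarrow> 'r) \<Rightarrow> nat \<Rightarrow> bool"
  where "mexact M k e D i \<longleftrightarrow>
    (\<forall>x\<in>tuples M (k (Suc i)). mv M (k i) (k (Suc i)) (D i) x = (\<lambda>_. \<zero>\<^bsub>M\<^esub>) \<longrightarrow>
      (\<exists>y\<in>tuples M (k (Suc (Suc i))). mv M (k (Suc i)) (k (Suc i)) (e (Suc i)) x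
        = mv M (k (Suc i)) (k (Suc (Suc i))) (D (Suc i)) y))"

definition mat_prod :: "('r, 'x) ring_scheme \<Rightarrow> nat \<Rightarrow> nat \<Rightarrow> nat \<Rightarrow> (nat \<Rightarrow> nat \<Rightarrow> 'r) \<Rightarrow>
    (nat \<Rightarrow> nat \<Rightarrow> 'r) \<Rightarrow> (nat \<Rightarrow> nat \<Rightarrow> 'r) \<Rightarrow> bool" where
  "mat_prod R r c d A B C \<longleftrightarrow> (\<forall>j<r. \<forall>l<d. msum R (\<lambda>p. A j p \<otimes>\<^bsub>R\<^esub> B p l) c = C j l)"

text \<open>The families are infinite, with size 0 from some index on, instead of having a length.
  Truncation is then a mere shift of indices, without a case distinction at the end of the
  complex.\<close>

definition fp_complex :: "('r, 'x) ring_scheme \<Rightarrow> (nat \<Rightarrow> nat) \<Rightarrow> (nat \<Rightarrow> nat \<Rightarrow> nat \<Rightarrow> 'r) \<Rightarrow>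
    (nat \<Rightarrow> nat \<Rightarrow> nat \<Rightarrow> 'r) \<Rightarrow> bool"
  where "fp_complex R k e D \<longleftrightarrow>
    (\<forall>i. mat_in R (k i) (k i) (e i) \<and> mat_in R (k i) (k (Suc i)) (D i) \<and>
      mat_prod R (k i) (k i) (k i) (e i) (e i) (e i) \<and>
      mat_prod R (k i) (k i) (k (Suc i)) (e i) (D i) (D i) \<and>
      mat_prod R (k i) (k (Suc i)) (k (Suc i)) (D i) (e (Suc i)) (D i) \<and>
      mat_prod R (k i) (k (Suc i)) (k (Suc (Suc i))) (D i) (D (Suc i)) (\<lambda>_ _. \<zero>\<^bsub>R\<^esub>)) \<and>
    (\<exists>n. \<forall>i>n. k i = 0)"

text \<open>With the ring itself as coefficients the tuples fixed by the idempotents are the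
  projective modules, so this is exactness of the complex of projectives in positive
  degrees.\<close>

definition fp_resolution :: "('r, 'x) ring_scheme \<Rightarrow> (nat \<Rightarrow> nat) \<Rightarrow> (nat \<Rightarrow> nat \<Rightarrow> nat \<Rightarrow> 'r) \<Rightarrow>
    (nat \<Rightarrow> nat \<Rightarrow> nat \<Rightarrow> 'r) \<Rightarrow> bool"
  where "fp_resolution R k e D \<longleftrightarrow> fp_complex R k e D \<and> (\<forall>i. mexact (ring_as_module R) k e D i)"

lemma (in Module.module) mv_zero_matrix:
  "x \<in> tuples M c \<Longrightarrow> mv M r c (\<lambda>_ _. \<zero>) x = (\<lambda>_. \<zero>\<^bsub>M\<^esub>)"
  by (auto simp: mv_def tuples_closed intro!: M.msum_zero)

text \<open>The matrix identities over \<open>R\<close> become identities of maps on tuples in every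
  coefficient module; the chases below use them only in this form.\<close>

lemma (in Module.module) fp_complex_mv:
  assumes "fp_complex R k e D"
  shows "x \<in> tuples M (k i) \<Longrightarrow> mv M (k i) (k i) (e i) x \<in> tuples M (k i)"
    and "y \<in> tuples M (k (Suc i)) \<Longrightarrow> mv M (k i) (k (Suc i)) (D i) y \<in> tuples M (k i)"
    and "x \<in> tuples M (k i) \<Longrightarrow> mv M (k i) (k i) (e i) (mv M (k i) (k i) (e i) x) = mv M (k i) (k i) (e i) x"
    and "y \<in> tuples M (k (Suc i)) \<Longrightarrow>
      mv M (k i) (k i) (e i) (mv M (k i) (k (Suc i)) (D i) y) = mv M (k i) (k (Suc i)) (D i) y"
    and "y \<in> tuples M (k (Suc i)) \<Longrightarrow>
      mv M (k i) (k (Suc i)) (D i) (mv M (k (Suc i)) (k (Suc i)) (e (Suc i)) y) = mv M (k i) (k (Suc i)) (D i) y"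
    and "z \<in> tuples M (k (Suc (Suc i))) \<Longrightarrow>
      mv M (k i) (k (Suc i)) (D i) (mv M (k (Suc i)) (k (Suc (Suc i))) (D (Suc i)) z) = (\<lambda>_. \<zero>\<^bsub>M\<^esub>)"
proof -
  have c: "mat_in R (k i) (k i) (e i)" "mat_in R (k i) (k (Suc i)) (D i)"
      "mat_prod R (k i) (k i) (k i) (e i) (e i) (e i)"
      "mat_prod R (k i) (k i) (k (Suc i)) (e i) (D i) (D i)"
      "mat_prod R (k i) (k (Suc i)) (k (Suc i)) (D i) (e (Suc i)) (D i)"
      "mat_prod R (k i) (k (Suc i)) (k (Suc (Suc i))) (D i) (D (Suc i)) (\<lambda>_ _. \<zero>)" for i
    using assms unfolding fp_complex_def by blast+
  show "x \<in> tuples M (k i) \<Longrightarrow> mv M (k i) (k i) (e i) x \<in> tuples M (k i)"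
    by (rule mv_closed[OF c(1)])
  show "y \<in> tuples M (k (Suc i)) \<Longrightarrow> mv M (k i) (k (Suc i)) (D i) y \<in> tuples M (k i)"
    by (rule mv_closed[OF c(2)])
  show "x \<in> tuples M (k i) \<Longrightarrow> mv M (k i) (k i) (e i) (mv M (k i) (k i) (e i) x) = mv M (k i) (k i) (e i) x"
    by (rule mv_mv[OF c(1) c(1)]) (use c(3) in \<open>auto simp: mat_prod_def\<close>)
  show "y \<in> tuples M (k (Suc i)) \<Longrightarrow>
      mv M (k i) (k i) (e i) (mv M (k i) (k (Suc i)) (D i) y) = mv M (k i) (k (Suc i)) (D i) y"
    by (rule mv_mv[OF c(1) c(2)]) (use c(4) in \<open>auto simp: mat_prod_def\<close>)
  show "y \<in> tuples M (k (Suc i)) \<Longrightarrow>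
      mv M (k i) (k (Suc i)) (D i) (mv M (k (Suc i)) (k (Suc i)) (e (Suc i)) y) = mv M (k i) (k (Suc i)) (D i) y"
    by (rule mv_mv[OF c(2) c(1)]) (use c(5) in \<open>auto simp: mat_prod_def\<close>)
  have "mv M (k i) (k (Suc i)) (D i) (mv M (k (Suc i)) (k (Suc (Suc i))) (D (Suc i)) z)
      = mv M (k i) (k (Suc (Suc i))) (\<lambda>_ _. \<zero>) z" if "z \<in> tuples M (k (Suc (Suc i)))"
    by (rule mv_mv[OF c(2) c(2) that]) (use c(6) in \<open>auto simp: mat_prod_def\<close>)
  then show "z \<in> tuples M (k (Suc (Suc i))) \<Longrightarrow>
      mv M (k i) (k (Suc i)) (D i) (mv M (k (Suc i)) (k (Suc (Suc i))) (D (Suc i)) z) = (\<lambda>_. \<zero>\<^bsub>M\<^esub>)"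
    by (simp add: mv_zero_matrix)
qed

context cring
begin

lemma msum_free_module: "msum (free_module R X) f n x = msum R (\<lambda>l. f l x) n"
  by (induction n) auto

lemma mv_hom_matrix:
  assumes u: "u \<in> module_hom R (free_module R {..<c}) (free_module R {..<r})"
    and x: "x \<in> carrier (free_module R {..<c})"
  shows "mv (ring_as_module R) r c (\<lambda>j l. u (delta R l) j) x = u x"
proof
  fix j
  note c = free_module_closed[OF module_hom_closed[OF u delta_closed]] free_module_closed[OF x]
  have "u x j = msum R (\<lambda>l. x l \<otimes> u (delta R l) j) c"
    by (subst free_module_hom_expand[OF module_free_module u x]) (simp add: msum_free_module)
  also have "\<dots> = msum R (\<lambda>l. u (delta R l) j \<otimes> x l) c"
    using c by (intro msum_cong) (simp add: m_comm)
  finally show "mv (ring_as_module R) r c (\<lambda>j l. u (delta R l) j) x j = u x j"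
    using module_hom_closed[OF u x] by (auto simp: mv_def carrier_free_module)
qed

lemma mat_in_hom:
  assumes u: "u \<in> module_hom R (free_module R {..<c}) (free_module R {..<r})"
  shows "mat_in R r c (\<lambda>j l. u (delta R l) j)"
  using free_module_closed[OF module_hom_closed[OF u delta_closed]] by (auto simp: mat_in_def)

lemma mat_prod_hom:
  assumes u: "u \<in> module_hom R (free_module R {..<c}) (free_module R {..<r})"
    and v: "v \<in> module_hom R (free_module R {..<d}) (free_module R {..<c})"
    and w: "\<And>j l. j < r \<Longrightarrow> l < d \<Longrightarrow> u (v (delta R l)) j = C j l"
  shows "mat_prod R r c d (\<lambda>j l. u (delta R l) j) (\<lambda>j l. v (delta R l) j) C"
  unfolding mat_prod_def
proof (intro allI impI)
  fix j l assume j: "j < r" and l: "l < d"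
  have "v (delta R l) \<in> carrier (free_module R {..<c})"
    using l by (intro module_hom_closed[OF v] delta_closed) simp
  from mv_hom_matrix[OF u this] show "msum R (\<lambda>p. u (delta R p) j \<otimes> v (delta R l) p) c = C j l"
    using j w[OF j l] by (auto simp: mv_def dest: fun_cong[of _ _ j])
qed

lemma mv_module_hom_free:
  assumes "mat_in R r c A"
  shows "mv (ring_as_module R) r c A \<in> module_hom R (free_module R {..<c}) (free_module R {..<r})"
proof -
  interpret Rm: Module.module R "ring_as_module R" by (rule module_ring_as_module)
  show ?thesis
  proof (rule module_homI)
    fix x y s assume x: "x \<in> carrier (free_module R {..<c})"
    note xc = free_module_closed[OF x]
    have a: "A j l \<in> carrier R" if "j < r" "l < c" for j l
      using assms that by (auto simp: mat_in_def)
    show "mv (ring_as_module R) r c A x \<in> carrier (free_module R {..<r})"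
      using Rm.mv_closed[OF assms] x by (simp add: carrier_free_module_tuples)
    show "mv (ring_as_module R) r c A (s \<odot>\<^bsub>free_module R {..<c}\<^esub> x)
        = s \<odot>\<^bsub>free_module R {..<r}\<^esub> mv (ring_as_module R) r c A x" if s: "s \<in> carrier R"
    proof
      fix j
      have "msum R (\<lambda>l. A j l \<otimes> (s \<otimes> x l)) c = s \<otimes> msum R (\<lambda>l. A j l \<otimes> x l) c" if "j < r"
      proof -
        have "s \<odot>\<^bsub>ring_as_module R\<^esub> msum (ring_as_module R) (\<lambda>l. A j l \<otimes> x l) c
            = msum (ring_as_module R) (\<lambda>l. s \<odot>\<^bsub>ring_as_module R\<^esub> (A j l \<otimes> x l)) c"
          using a[OF that] xc s by (intro Rm.smult_msum) auto
        also have "\<dots> = msum (ring_as_module R) (\<lambda>l. A j l \<otimes> (s \<otimes> x l)) c"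
          using a[OF that] xc s by (intro msum_cong) (simp add: m_lcomm)
        finally show ?thesis by simp
      qed
      then show "mv (ring_as_module R) r c A (s \<odot>\<^bsub>free_module R {..<c}\<^esub> x) j
          = (s \<odot>\<^bsub>free_module R {..<r}\<^esub> mv (ring_as_module R) r c A x) j"
        using s by (simp add: mv_def)
    qed
    assume "y \<in> carrier (free_module R {..<c})"
    note yc = free_module_closed[OF this]
    show "mv (ring_as_module R) r c A (x \<oplus>\<^bsub>free_module R {..<c}\<^esub> y)
        = mv (ring_as_module R) r c A x \<oplus>\<^bsub>free_module R {..<r}\<^esub> mv (ring_as_module R) r c A y"
    proof
      fix j
      have "msum R (\<lambda>l. A j l \<otimes> (x l \<oplus> y l)) c = msum R (\<lambda>l. A j l \<otimes> x l) c \<oplus> msum R (\<lambda>l. A j l \<otimes> y l) c"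
        if "j < r"
        using a[OF that] xc yc by (simp add: msum_add[symmetric] r_distr cong: msum_cong)
      then show "mv (ring_as_module R) r c A (x \<oplus>\<^bsub>free_module R {..<c}\<^esub> y) j
          = (mv (ring_as_module R) r c A x \<oplus>\<^bsub>free_module R {..<r}\<^esub> mv (ring_as_module R) r c A y) j"
        by (simp add: mv_def)
    qed
  qed
qed

lemma mv_delta:
  assumes "mat_in R r c A" "j < r" "l < c"
  shows "mv (ring_as_module R) r c A (delta R l) j = A j l"
proof -
  have "msum R (\<lambda>p. A j p \<otimes> delta R l p) c = msum R (\<lambda>p. if p = l then A j l else \<zero>) c"
    using assms by (intro msum_cong) (auto simp: delta_def mat_in_def)
  then show ?thesis
    using assms by (simp add: mv_def msum_single mat_in_def)
qed

text \<open>The data are the matrices of \<open>r i \<circ> p i\<close> and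
  \<open>r i \<circ> d i \<circ> p (i + 1)\<close>, and the identities come from
  \<open>p i (r i x) = x\<close>. For exactness a tuple is sent into the module by \<open>p\<close>,
  a preimage is found there, and \<open>r\<close> turns this preimage into a tuple again.\<close>

lemma fp_resolution_of_retracts:
  assumes free: "\<And>i. retract_free R (P i) {..<k i} (r i) (p i)"
    and d: "\<And>i. d i \<in> module_hom R (P (Suc i)) (P i)"
    and exact: "\<And>i. a_kernel (P (Suc i)) (P i) (d i) = d (Suc i) ` carrier (P (Suc (Suc i)))"
    and bound: "\<And>i. i > n \<Longrightarrow> k i = 0"
  shows "fp_resolution R k (\<lambda>i j l. r i (p i (delta R l)) j) (\<lambda>i j l. r i (d i (p (Suc i) (delta R l))) j)"
proof -
  let ?F = "\<lambda>i. free_module R {..<k i}"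
  let ?e = "\<lambda>i j l. r i (p i (delta R l)) j" and ?D = "\<lambda>i j l. r i (d i (p (Suc i) (delta R l))) j"
  have P: "Module.module R (P i)" and r: "r i \<in> module_hom R (P i) (?F i)"
    and p: "p i \<in> module_hom R (?F i) (P i)" and pr: "\<And>x. x \<in> carrier (P i) \<Longrightarrow> p i (r i x) = x" for i
    using free[of i] by (auto simp: retract_free_def)
  note F = module_free_module
  note e = module_hom_comp[OF p r] and D = module_hom_comp[OF module_hom_comp[OF p d] r]
  have dl: "p i (delta R l) \<in> carrier (P i)" if "l < k i" for i l
    using that by (intro module_hom_closed[OF p] delta_closed) simp
  have dd: "d i (d (Suc i) x) = \<zero>\<^bsub>P i\<^esub>" if "x \<in> carrier (P (Suc (Suc i)))" for i x
    using exact[of i] that by (auto simp: a_kernel_def')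
  have dc: "d i x \<in> carrier (P i)" if "x \<in> carrier (P (Suc i))" for i x
    by (rule module_hom_closed[OF d that])
  have complex: "fp_complex R k ?e ?D"
    unfolding fp_complex_def
  proof (intro conjI allI impI exI[of _ n])
    fix i
    show "mat_in R (k i) (k i) (?e i)" by (rule mat_in_hom[OF e])
    show "mat_in R (k i) (k (Suc i)) (?D i)" by (rule mat_in_hom[OF D])
    show "mat_prod R (k i) (k i) (k i) (?e i) (?e i) (?e i)"
      by (rule mat_prod_hom[OF e e]) (simp add: pr dl)
    show "mat_prod R (k i) (k i) (k (Suc i)) (?e i) (?D i) (?D i)"
      by (rule mat_prod_hom[OF e D]) (simp add: pr dl dc)
    show "mat_prod R (k i) (k (Suc i)) (k (Suc i)) (?D i) (?e (Suc i)) (?D i)"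
      by (rule mat_prod_hom[OF D e]) (simp add: pr dl)
    show "mat_prod R (k i) (k (Suc i)) (k (Suc (Suc i))) (?D i) (?D (Suc i)) (\<lambda>_ _. \<zero>)"
      by (rule mat_prod_hom[OF D D]) (simp add: pr dl dc dd module_hom_zero[OF P F r])
  next
    fix i assume "n < i"
    then show "k i = 0" by (rule bound)
  qed
  have "mexact (ring_as_module R) k ?e ?D i" for i
    unfolding mexact_def
  proof (intro ballI impI)
    fix x assume x: "x \<in> tuples (ring_as_module R) (k (Suc i))"
      and zero: "mv (ring_as_module R) (k i) (k (Suc i)) (?D i) x = (\<lambda>_. \<zero>\<^bsub>ring_as_module R\<^esub>)"
    have xF: "x \<in> carrier (?F (Suc i))"
      using x by (simp add: carrier_free_module_tuples)
    note px = module_hom_closed[OF p xF]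
    have "r i (d i (p (Suc i) x)) = \<zero>\<^bsub>?F i\<^esub>"
      using zero by (simp add: mv_hom_matrix[OF D xF])
    then have "d i (p (Suc i) x) = \<zero>\<^bsub>P i\<^esub>"
      using pr[OF dc[OF px]] module_hom_zero[OF F P p, of i] by metis
    then have "p (Suc i) x \<in> d (Suc i) ` carrier (P (Suc (Suc i)))"
      using exact[of i] px by (auto simp: a_kernel_def')
    then obtain z where z: "z \<in> carrier (P (Suc (Suc i)))" "p (Suc i) x = d (Suc i) z" by blast
    note rz = module_hom_closed[OF r z(1)]
    have "mv (ring_as_module R) (k (Suc i)) (k (Suc i)) (?e (Suc i)) x
        = mv (ring_as_module R) (k (Suc i)) (k (Suc (Suc i))) (?D (Suc i)) (r (Suc (Suc i)) z)"
      by (simp add: mv_hom_matrix[OF e xF] mv_hom_matrix[OF D rz] pr z)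
    then show "\<exists>y\<in>tuples (ring_as_module R) (k (Suc (Suc i))).
        mv (ring_as_module R) (k (Suc i)) (k (Suc i)) (?e (Suc i)) x
        = mv (ring_as_module R) (k (Suc i)) (k (Suc (Suc i))) (?D (Suc i)) y"
      using rz by (auto simp: carrier_free_module_tuples)
  qed
  with complex show ?thesis by (simp add: fp_resolution_def)
qed

end

section \<open>Finitely generated projectives as retracts of finite free modules\<close>

text \<open>Encodes a tuple of scalars as a formal element; \<open>Comb []\<close> is a dummy
  partner of each scalar. Since no element of type \<open>'x\<close> occurs, finite free modules fit
  into \<open>formal\<close> whatever the second type argument is.\<close>

definition formal_tuple :: "nat \<Rightarrow> (nat \<Rightarrow> 'r) \<Rightarrow> ('r, 'x) formal"
  where "formal_tuple n f = Comb (map (\<lambda>l. (f l, Comb [])) [0..<n])"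

lemma inj_on_formal_tuple: "inj_on (formal_tuple n) (carrier (free_module R {..<n}))"
proof (rule inj_onI)
  fix f g assume fg: "f \<in> carrier (free_module R {..<n})" "g \<in> carrier (free_module R {..<n})"
    and eq: "(formal_tuple n f :: ('a, 'x) formal) = formal_tuple n g"
  show "f = g"
  proof
    fix l
    show "f l = g l"
      using eq fg by (cases "l < n") (auto simp: formal_tuple_def carrier_free_module)
  qed
qed

lemma retract_free_fg_projective:
  fixes k :: nat
  assumes free: "retract_free R P {..<k} i p"
  shows "fg_projective R P"
proof -
  let ?F = "free_module R {..<k}" and ?S = "(\<lambda>l. p (delta R l)) ` {..<k}"
  have P: "Module.module R P" and i: "i \<in> module_hom R P ?F"
    and p: "p \<in> module_hom R ?F P" and pi: "\<And>x. x \<in> carrier P \<Longrightarrow> p (i x) = x"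
    using free by (auto simp: retract_free_def)
  interpret P: Module.module R P by fact
  have S: "?S \<subseteq> carrier P"
    using module_hom_closed[OF p P.R.delta_closed] by auto
  have u: "lincomb R P (\<lambda>s. s) \<in> module_hom R (free_module R ?S) P"
    by (rule P.lincomb_hom) (use S in auto)
  interpret FS: Module.module R "free_module R ?S" by (rule P.R.module_free_module)
  \<comment> \<open>Distinct indices may name the same generator, whereas
    \<open>finitely_generated\<close> asks for coefficients indexed by the set of generators. The
    map \<open>v\<close> moves coefficients from indices to generators and adds those that
    meet.\<close>
  define v where "v = lincomb R (free_module R ?S) (\<lambda>l. delta R (p (delta R l)))"
  have v: "v \<in> module_hom R ?F (free_module R ?S)"
    unfolding v_def by (rule FS.lincomb_hom) (auto intro!: P.R.delta_closed)
  have uv: "lincomb R P (\<lambda>s. s) (v y) = p y" if "y \<in> carrier ?F" for y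
  proof (rule P.R.free_module_hom_eqI[OF P module_hom_comp[OF v u] p _ that])
    fix l assume l: "l \<in> {..<k}"
    then show "lincomb R P (\<lambda>s. s) (v (delta R l)) = p (delta R l)"
      using S unfolding v_def
      by (subst FS.lincomb_delta) (auto intro!: P.R.delta_closed P.lincomb_delta)
  qed
  have fg: "finitely_generated R P"
    unfolding finitely_generated_def
  proof (intro exI[of _ ?S] conjI ballI)
    fix x assume x: "x \<in> carrier P"
    note vix = module_hom_closed[OF v module_hom_closed[OF i x]]
    have "x = lincomb R P (\<lambda>s. s) (v (i x))"
      by (simp add: uv module_hom_closed[OF i x] pi x)
    also have "\<dots> = (\<Oplus>\<^bsub>P\<^esub>s\<in>?S. v (i x) s \<odot>\<^bsub>P\<^esub> s)"
      by (rule P.lincomb_finsum) (use P.R.free_module_closed[OF vix] vix[unfolded carrier_free_module] S in auto)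
    finally show "\<exists>c\<in>?S \<rightarrow> carrier R. x = (\<Oplus>\<^bsub>P\<^esub>s\<in>?S. c s \<odot>\<^bsub>P\<^esub> s)"
      using P.R.free_module_closed[OF vix] by (intro bexI[of _ "v (i x)"]) auto
  qed (use S in auto)
  have "projective_module R P"
    unfolding projective_module_def
  proof (intro conjI allI impI ballI P)
    fix A B :: "('a, ('a, 'c) formal) module" and g f
    assume "Module.module R A" "Module.module R B" "g \<in> module_hom R A B" "g ` carrier A = carrier B"
      "f \<in> module_hom R P B"
    then show "\<exists>h\<in>module_hom R P A. \<forall>x\<in>carrier P. g (h x) = f x"
      using retract_free_lift[OF free, of A B g f] module_hom_closed[of f R P B] by metis
  qed
  with fg show ?thesis by (simp add: fg_projective_def)
qed

text \<open>Generators give a surjection from a finite free module onto \<open>P\<close>, and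
  lifting the identity of \<open>P\<close> along it gives the splitting.\<close>

lemma fg_projective_retract_free:
  fixes P :: "('r, 'p, 'y) module_scheme"
  assumes "fg_projective R P"
  obtains k :: nat and i p where "retract_free R P {..<k} i p"
proof -
  have P: "Module.module R P" and fg: "finitely_generated R P" and proj: "projective_module R P"
    using assms by (auto simp: fg_projective_def projective_module_def)
  interpret P: Module.module R P by fact
  obtain S where S: "finite S" "S \<subseteq> carrier P"
    "\<And>x. x \<in> carrier P \<Longrightarrow> \<exists>c\<in>S \<rightarrow> carrier R. x = (\<Oplus>\<^bsub>P\<^esub>s\<in>S. c s \<odot>\<^bsub>P\<^esub> s)"
    using fg unfolding finitely_generated_def by blast
  obtain h where h: "bij_betw h {..<card S} S"
    using ex_bij_betw_nat_finite[OF S(1)] by (auto simp: atLeast0LessThan)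
  define k where "k = card S"
  let ?F = "free_module R {..<k}"
  have hS: "h l \<in> carrier P" if "l < k" for l
    using h S(2) that by (auto simp: k_def bij_betw_def)
  define \<pi> where "\<pi> = lincomb R P h"
  have \<pi>: "\<pi> \<in> module_hom R ?F P"
    unfolding \<pi>_def by (rule P.lincomb_hom) (use hS in auto)
  have surj: "\<exists>f\<in>carrier ?F. \<pi> f = x" if x: "x \<in> carrier P" for x
  proof -
    obtain c where c: "c \<in> S \<rightarrow> carrier R" "x = (\<Oplus>\<^bsub>P\<^esub>s\<in>S. c s \<odot>\<^bsub>P\<^esub> s)"
      using S(3)[OF x] by blast
    define f where "f l = (if l < k then c (h l) else \<zero>\<^bsub>R\<^esub>)" for l
    have ch: "c (h l) \<in> carrier R" if "l < k" for l
      using h c(1) that by (auto simp: k_def bij_betw_def)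
    have sub: "{l. f l \<noteq> \<zero>\<^bsub>R\<^esub>} \<subseteq> {..<k}" by (auto simp: f_def)
    have f: "f \<in> carrier ?F"
      using finite_subset[OF sub] ch by (auto simp: carrier_free_module f_def)
    have "\<pi> f = (\<Oplus>\<^bsub>P\<^esub>l\<in>{..<k}. f l \<odot>\<^bsub>P\<^esub> h l)"
      unfolding \<pi>_def by (rule P.lincomb_finsum) (use sub hS P.R.free_module_closed[OF f] in auto)
    also have "\<dots> = (\<Oplus>\<^bsub>P\<^esub>l\<in>{..<k}. c (h l) \<odot>\<^bsub>P\<^esub> h l)"
      by (rule P.M.finsum_cong') (use ch hS in \<open>auto simp: f_def\<close>)
    also have "\<dots> = (\<Oplus>\<^bsub>P\<^esub>s\<in>h ` {..<k}. c s \<odot>\<^bsub>P\<^esub> s)"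
      by (rule P.M.finsum_reindex[symmetric]) (use h c(1) S(2) in \<open>auto simp: k_def bij_betw_def\<close>)
    also have "h ` {..<k} = S" using h by (simp add: k_def bij_betw_def)
    finally show ?thesis using f c(2) by auto
  qed
  \<comment> \<open>\<open>projective_module\<close> tests only maps between modules with elements
    in \<open>('r, 'p) formal\<close>, so both the free module and \<open>P\<close> are replaced by
    copies in that type. The map to be lifted is then \<open>Gen\<close> instead of the
    identity.\<close>
  let ?emb = "formal_tuple k :: (nat \<Rightarrow> 'r) \<Rightarrow> ('r, 'p) formal"
  let ?A = "image_module ?F ?emb" and ?B = "image_module P (Gen :: 'p \<Rightarrow> ('r, 'p) formal)"
  have inj_emb: "inj_on ?emb (carrier ?F)" by (rule inj_on_formal_tuple)
  note A = image_module_inj[OF P.R.module_free_module inj_emb]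
  have inj_Gen: "inj_on (Gen :: 'p \<Rightarrow> ('r, 'p) formal) (carrier P)" by (simp add: inj_on_def)
  note B = image_module_inj[OF P inj_Gen]
  note g = module_hom_comp[OF module_hom_comp[OF A(3) \<pi>] B(2)]
  have onto: "(\<lambda>u. Gen (\<pi> (inv_into (carrier ?F) ?emb u))) ` carrier ?A = carrier ?B"
  proof
    show "(\<lambda>u. Gen (\<pi> (inv_into (carrier ?F) ?emb u))) ` carrier ?A \<subseteq> carrier ?B"
      using module_hom_closed[OF g] by blast
    show "carrier ?B \<subseteq> (\<lambda>u. Gen (\<pi> (inv_into (carrier ?F) ?emb u))) ` carrier ?A"
    proof
      fix b :: "('r, 'p) formal" assume "b \<in> carrier ?B"
      then obtain x where x: "x \<in> carrier P" "b = Gen x" by auto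
      obtain f where f: "f \<in> carrier ?F" "\<pi> f = x" using surj[OF x(1)] by blast
      then show "b \<in> (\<lambda>u. Gen (\<pi> (inv_into (carrier ?F) ?emb u))) ` carrier ?A"
        using x by (intro image_eqI[of _ _ "?emb f"]) (auto simp: inv_into_f_f[OF inj_on_formal_tuple])
    qed
  qed
  have "\<exists>h\<in>module_hom R P ?A. \<forall>x\<in>carrier P. Gen (\<pi> (inv_into (carrier ?F) ?emb (h x))) = (Gen x :: ('r, 'p) formal)"
    by (rule proj[unfolded projective_module_def, THEN conjunct2, rule_format, OF A(1) B(1) g onto B(2)])
  then obtain i where i: "i \<in> module_hom R P ?A"
    "\<And>x. x \<in> carrier P \<Longrightarrow> Gen (\<pi> (inv_into (carrier ?F) ?emb (i x))) = (Gen x :: ('r, 'p) formal)"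
    by blast
  have "retract_free R P {..<k} (\<lambda>x. inv_into (carrier ?F) ?emb (i x)) \<pi>"
    unfolding retract_free_def using P module_hom_comp[OF i(1) A(3)] \<pi> i(2) by auto
  then show thesis by (rule that)
qed

section \<open>FT-flat modules in terms of matrices\<close>

text \<open>The intermediate form between \<open>resolution\<close> and
  \<open>fp_resolution\<close>: modules with chosen splittings, indexed by all natural numbers, and
  exact in positive degrees. The map \<open>d i\<close> starts at \<open>P (Suc i)\<close>.\<close>

definition retract_complex where
  "retract_complex R P k r p d \<longleftrightarrow>
    (\<forall>i::nat. retract_free R (P i) {..<k i :: nat} (r i) (p i)) \<and>
    (\<forall>i. d i \<in> module_hom R (P (Suc i)) (P i)) \<and>
    (\<forall>i. a_kernel (P (Suc i)) (P i) (d i) = d (Suc i) ` carrier (P (Suc (Suc i))))"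

lemma retract_complexD:
  assumes "retract_complex R P k r p d"
  shows "retract_free R (P i) {..<k i} (r i) (p i)" "Module.module R (P i)"
    "r i \<in> module_hom R (P i) (free_module R {..<k i})" "p i \<in> module_hom R (free_module R {..<k i}) (P i)"
    "x \<in> carrier (P i) \<Longrightarrow> p i (r i x) = x"
    "d i \<in> module_hom R (P (Suc i)) (P i)"
    "a_kernel (P (Suc i)) (P i) (d i) = d (Suc i) ` carrier (P (Suc (Suc i)))"
  using assms by (auto simp: retract_complex_def retract_free_def)

lemma retract_complex_transport:
  fixes f :: "nat \<Rightarrow> 'p \<Rightarrow> 'q"
  assumes P: "retract_complex R P k r p d" and inj: "\<And>i. inj_on (f i) (carrier (P i))"
  defines "g \<equiv> \<lambda>i. inv_into (carrier (P i)) (f i)"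
  shows "retract_complex R (\<lambda>i. image_module (P i) (f i)) k (\<lambda>i u. r i (g i u)) (\<lambda>i x. f i (p i x))
    (\<lambda>i u. f i (d i (g (Suc i) u)))"
proof -
  note PD = retract_complexD[OF P]
  have "Module.module R (image_module (P i) (f i))"
    and f: "f i \<in> module_hom R (P i) (image_module (P i) (f i))"
    and g: "g i \<in> module_hom R (image_module (P i) (f i)) (P i)" for i
    using image_module_inj[OF PD(2) inj[of i]] by (auto simp: g_def)
  have gf: "g i (f i x) = x" if "x \<in> carrier (P i)" for i x
    using inj[of i] that by (simp add: g_def)
  have zero: "\<zero>\<^bsub>image_module (P i) (f i)\<^esub> = f i \<zero>\<^bsub>P i\<^esub>" for i
    by (simp add: image_module_def)
  have dc: "d i x \<in> carrier (P i)" if "x \<in> carrier (P (Suc i))" for i x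
    by (rule module_hom_closed[OF PD(6) that])
  have "a_kernel (image_module (P (Suc i)) (f (Suc i))) (image_module (P i) (f i)) (\<lambda>u. f i (d i (g (Suc i) u)))
      = f (Suc i) ` a_kernel (P (Suc i)) (P i) (d i)" for i
  proof -
    interpret P: Module.module R "P i" by (rule PD(2))
    show ?thesis
      using inj[of i] by (auto simp: a_kernel_def' zero gf dc inj_on_eq_iff)
  qed
  then show ?thesis
    unfolding retract_complex_def retract_free_def
    using PD(2) module_hom_comp[OF g PD(3)] module_hom_comp[OF PD(4) f]
      module_hom_comp[OF module_hom_comp[OF g PD(6)] f] PD(5) module_hom_closed[OF PD(4)] image_module_inj(1)[OF PD(2) inj]
    by (auto simp: gf PD(7) dc image_image)
qed

text \<open>\<open>P i\<close> is the image of the idempotent \<open>e i\<close> in the free module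
  of rank \<open>k i\<close>, split by the inclusion and by \<open>e i\<close>. The identity
  \<open>e i * D i = D i\<close> lets \<open>D i\<close> restrict to these images.\<close>

lemma fp_resolution_retract_complex:
  fixes R :: "('r, 'x) ring_scheme"
  assumes R: "cring R" and res: "fp_resolution R k e D"
  obtains P :: "nat \<Rightarrow> ('r, nat \<Rightarrow> 'r) module" and r p d where
    "retract_complex R P k r p d" "\<And>i. carrier (P i) \<subseteq> carrier (free_module R {..<k i})"
    "\<And>i j l. j < k i \<Longrightarrow> l < k i \<Longrightarrow> e i j l = r i (p i (delta R l)) j"
    "\<And>i j l. j < k i \<Longrightarrow> l < k (Suc i) \<Longrightarrow> D i j l = r i (d i (p (Suc i) (delta R l))) j"
proof -
  interpret R: cring R by fact
  let ?Rm = "ring_as_module R"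
  interpret Rm: Module.module R ?Rm by (rule R.module_ring_as_module)
  have complex: "fp_complex R k e D" and exact: "mexact ?Rm k e D i" for i
    using res by (auto simp: fp_resolution_def)
  define F where "F i = free_module R {..<k i}" for i
  define E where "E i = mv ?Rm (k i) (k i) (e i)" for i
  define d where "d i = mv ?Rm (k i) (k (Suc i)) (D i)" for i
  define P where "P i = F i\<lparr>carrier := E i ` carrier (F i)\<rparr>" for i
  have mat: "mat_in R (k i) (k i) (e i)" "mat_in R (k i) (k (Suc i)) (D i)" for i
    using complex by (auto simp: fp_complex_def)
  have E: "E i \<in> module_hom R (F i) (F i)" and d: "d i \<in> module_hom R (F (Suc i)) (F i)" for i
    unfolding E_def d_def F_def by (rule R.mv_module_hom_free[OF mat(1)] R.mv_module_hom_free[OF mat(2)])+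
  have F: "Module.module R (F i)" for i
    unfolding F_def by (rule R.module_free_module)
  have tup: "carrier (F i) = tuples ?Rm (k i)" for i
    unfolding F_def by (rule carrier_free_module_tuples)
  note fc = Rm.fp_complex_mv[OF complex, folded E_def d_def tup]
  have Psub: "carrier (P i) \<subseteq> carrier (F i)" for i
    using module_hom_closed[OF E[of i]] by (auto simp: P_def)
  have EP: "E i x = x" if "x \<in> carrier (P i)" for i x
    using that fc(3) by (auto simp: P_def)
  have zeroP: "\<zero>\<^bsub>P i\<^esub> = (\<lambda>_. \<zero>\<^bsub>R\<^esub>)" for i
    by (simp add: P_def F_def)
  have "retract_free R (P i) {..<k i} (\<lambda>x. x) (E i)" for i
    unfolding retract_free_def
  proof (intro conjI ballI)
    show "Module.module R (P i)"
      unfolding P_def by (rule image_submodule[OF F F E])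
    show "(\<lambda>x. x) \<in> module_hom R (P i) (free_module R {..<k i})"
      using module_hom_incl[OF Psub[of i]] unfolding P_def F_def by simp
    show "E i \<in> module_hom R (free_module R {..<k i}) (P i)"
      using module_hom_restrict[OF E[of i], of "E i ` carrier (F i)"] module_hom_closed[OF E[of i]]
      unfolding P_def F_def by blast
  qed (rule EP)
  moreover have dP: "d i \<in> module_hom R (P (Suc i)) (P i)" for i
  proof -
    have "d i ` carrier (P (Suc i)) \<subseteq> E i ` carrier (F i)"
    proof
      fix y assume "y \<in> d i ` carrier (P (Suc i))"
      then obtain x where x: "x \<in> carrier (F (Suc i))" "y = d i x" using Psub by blast
      then have "y = E i y" using fc(4) by simp
      then show "y \<in> E i ` carrier (F i)" using x fc(2) by blast
    qed
    then have "d i \<in> module_hom R (F (Suc i)\<lparr>carrier := carrier (P (Suc i))\<rparr>) (F i\<lparr>carrier := E i ` carrier (F i)\<rparr>)"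
      using fc(1) by (intro module_hom_restrict module_hom_restrict_source[OF d Psub]) auto
    then show ?thesis by (simp add: P_def)
  qed
  moreover have "a_kernel (P (Suc i)) (P i) (d i) = d (Suc i) ` carrier (P (Suc (Suc i)))" for i
  proof (intro Set.set_eqI iffI)
    fix x assume "x \<in> a_kernel (P (Suc i)) (P i) (d i)"
    then have x: "x \<in> carrier (P (Suc i))" "d i x = (\<lambda>_. \<zero>\<^bsub>R\<^esub>)"
      by (auto simp: a_kernel_def' zeroP)
    then have "\<exists>y\<in>carrier (F (Suc (Suc i))). E (Suc i) x = d (Suc i) y"
      using exact[of i] Psub unfolding mexact_def tup[symmetric] E_def[symmetric] d_def[symmetric] by auto
    then obtain y where y: "y \<in> carrier (F (Suc (Suc i)))" "x = d (Suc i) y"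
      using EP[OF x(1)] by auto
    \<comment> \<open>The preimage \<open>y\<close> need not lie in the image of the idempotent; its
      projection does and has the same boundary.\<close>
    then have "x = d (Suc i) (E (Suc (Suc i)) y)"
      using fc(5) by simp
    then show "x \<in> d (Suc i) ` carrier (P (Suc (Suc i)))"
      using y(1) by (auto simp: P_def)
  next
    fix x assume "x \<in> d (Suc i) ` carrier (P (Suc (Suc i)))"
    then obtain y where y: "y \<in> carrier (P (Suc (Suc i)))" "x = d (Suc i) y" by blast
    then show "x \<in> a_kernel (P (Suc i)) (P i) (d i)"
      using module_hom_closed[OF dP y(1)] fc(6)[of y i] Psub by (auto simp: a_kernel_def' zeroP)
  qed
  ultimately have "retract_complex R P k (\<lambda>i x. x) E d"
    by (simp add: retract_complex_def)
  moreover have "e i j l = E i (delta R l) j" if "j < k i" "l < k i" for i j l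
    using that by (simp add: E_def R.mv_delta[OF mat(1)])
  moreover have "D i j l = d i (E (Suc i) (delta R l)) j" if "j < k i" "l < k (Suc i)" for i j l
  proof -
    have "delta R l \<in> carrier (F (Suc i))"
      using that by (simp add: F_def R.delta_closed)
    then have "d i (E (Suc i) (delta R l)) = d i (delta R l)" by (rule fc(5))
    then show ?thesis
      using that by (simp add: d_def R.mv_delta[OF mat(2)])
  qed
  ultimately show thesis
    by (intro that[of P "\<lambda>i x. x" E d]) (use Psub in \<open>auto simp: F_def\<close>)
qed

text \<open>Cosets as sets would lie in a larger type. The quotient is instead carried by one
  representative from each coset, so that it fits wherever \<open>f\<close> embeds
  \<open>A\<close>.\<close>

lemma module_cokernel:
  fixes A :: "('r, 'a, 'y) module_scheme" and f :: "'a \<Rightarrow> 'u"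
  assumes A: "Module.module R A" and B: "Module.module R B" and d: "d \<in> module_hom R B A"
    and f: "inj_on f (carrier A)"
  obtains N :: "('r, 'u) module" and \<epsilon> where "Module.module R N" "\<epsilon> \<in> module_hom R A N"
    "\<epsilon> ` carrier A = carrier N" "a_kernel A N \<epsilon> = d ` carrier B"
proof -
  interpret A: Module.module R A by fact
  interpret B: Module.module R B by fact
  note dc = module_hom_closed[OF d]
  define C where "C x = (\<lambda>b. x \<oplus>\<^bsub>A\<^esub> d b) ` carrier B" for x
  have self: "x \<in> C x" if "x \<in> carrier A" for x
    unfolding C_def using that module_hom_zero[OF B A d] by (intro image_eqI[of _ _ "\<zero>\<^bsub>B\<^esub>"]) auto
  have C_eq: "C (x \<oplus>\<^bsub>A\<^esub> d b) = C x" if "x \<in> carrier A" "b \<in> carrier B" for x b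
  proof (intro Set.set_eqI iffI)
    fix y assume "y \<in> C (x \<oplus>\<^bsub>A\<^esub> d b)"
    then obtain b' where "b' \<in> carrier B" "y = x \<oplus>\<^bsub>A\<^esub> d b \<oplus>\<^bsub>A\<^esub> d b'" by (auto simp: C_def)
    then show "y \<in> C x"
      unfolding C_def using that dc
      by (intro image_eqI[of _ _ "b \<oplus>\<^bsub>B\<^esub> b'"]) (auto simp: module_hom_add[OF d] A.M.a_assoc)
  next
    fix y assume "y \<in> C x"
    then obtain b' where "b' \<in> carrier B" "y = x \<oplus>\<^bsub>A\<^esub> d b'" by (auto simp: C_def)
    then show "y \<in> C (x \<oplus>\<^bsub>A\<^esub> d b)"
      unfolding C_def using that dc
      by (intro image_eqI[of _ _ "\<ominus>\<^bsub>B\<^esub> b \<oplus>\<^bsub>B\<^esub> b'"])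
        (auto simp: module_hom_add[OF d] module_hom_minus[OF B A d] A.M.a_assoc A.M.r_neg2)
  qed
  \<comment> \<open>The choice depends on the set \<open>C x\<close> alone, hence congruent elements
    receive the same representative.\<close>
  define rep where "rep x = (SOME y. y \<in> C x)" for x
  have rep: "rep x \<in> C x" if "x \<in> carrier A" for x
    unfolding rep_def using self[OF that] by (rule someI)
  have rep_eq: "rep x = rep x' \<longleftrightarrow> (\<exists>b\<in>carrier B. x' = x \<oplus>\<^bsub>A\<^esub> d b)"
    if "x \<in> carrier A" "x' \<in> carrier A" for x x'
  proof
    assume "rep x = rep x'"
    then have "C x = C x'"
      using rep[OF that(1)] rep[OF that(2)] C_eq that by (metis (no_types, lifting) C_def imageE)
    then show "\<exists>b\<in>carrier B. x' = x \<oplus>\<^bsub>A\<^esub> d b"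
      using self[OF that(2)] by (auto simp: C_def)
  next
    assume "\<exists>b\<in>carrier B. x' = x \<oplus>\<^bsub>A\<^esub> d b"
    then show "rep x = rep x'" using C_eq[OF that(1)] by (auto simp: rep_def)
  qed
  have repA: "rep x \<in> carrier A" if "x \<in> carrier A" for x
    using rep[OF that] that dc by (auto simp: C_def)
  define q where "q x = f (rep x)" for x
  have q_eq: "q x = q x' \<longleftrightarrow> (\<exists>b\<in>carrier B. x' = x \<oplus>\<^bsub>A\<^esub> d b)"
    if "x \<in> carrier A" "x' \<in> carrier A" for x x'
    using rep_eq[OF that] inj_on_eq_iff[OF f repA[OF that(1)] repA[OF that(2)]] by (simp add: q_def)
  have add: "q (x \<oplus>\<^bsub>A\<^esub> y) = q (x' \<oplus>\<^bsub>A\<^esub> y')"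
    if x: "x \<in> carrier A" "x' \<in> carrier A" and y: "y \<in> carrier A" "y' \<in> carrier A"
      and eq: "q x = q x'" "q y = q y'" for x x' y y'
  proof -
    obtain b c where bc: "b \<in> carrier B" "c \<in> carrier B" "x' = x \<oplus>\<^bsub>A\<^esub> d b" "y' = y \<oplus>\<^bsub>A\<^esub> d c"
      using eq x y by (auto simp: q_eq)
    have "x' \<oplus>\<^bsub>A\<^esub> y' = x \<oplus>\<^bsub>A\<^esub> y \<oplus>\<^bsub>A\<^esub> d (b \<oplus>\<^bsub>B\<^esub> c)"
      using bc x y dc by (simp add: module_hom_add[OF d] A.M.a_ac)
    then have "\<exists>a\<in>carrier B. x' \<oplus>\<^bsub>A\<^esub> y' = x \<oplus>\<^bsub>A\<^esub> y \<oplus>\<^bsub>A\<^esub> d a"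
      using bc(1,2) by blast
    then show ?thesis
      using q_eq[of "x \<oplus>\<^bsub>A\<^esub> y" "x' \<oplus>\<^bsub>A\<^esub> y'"] x y by simp
  qed
  have smult: "q (s \<odot>\<^bsub>A\<^esub> x) = q (s \<odot>\<^bsub>A\<^esub> x')"
    if s: "s \<in> carrier R" and x: "x \<in> carrier A" "x' \<in> carrier A" and eq: "q x = q x'" for s x x'
  proof -
    obtain b where b: "b \<in> carrier B" "x' = x \<oplus>\<^bsub>A\<^esub> d b"
      using eq x by (auto simp: q_eq)
    have "s \<odot>\<^bsub>A\<^esub> x' = s \<odot>\<^bsub>A\<^esub> x \<oplus>\<^bsub>A\<^esub> d (s \<odot>\<^bsub>B\<^esub> b)"
      using b x s dc by (simp add: module_hom_smult[OF d] A.smult_r_distr)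
    then have "\<exists>a\<in>carrier B. s \<odot>\<^bsub>A\<^esub> x' = s \<odot>\<^bsub>A\<^esub> x \<oplus>\<^bsub>A\<^esub> d a"
      using b(1) s by blast
    then show ?thesis
      using q_eq[of "s \<odot>\<^bsub>A\<^esub> x" "s \<odot>\<^bsub>A\<^esub> x'"] x s by simp
  qed
  have N: "Module.module R (image_module A q)" "q \<in> module_hom R A (image_module A q)"
    by (rule image_module_quotient[OF A], rule add, assumption+, rule smult, assumption+)+
  have ker: "a_kernel A (image_module A q) q = d ` carrier B"
  proof -
    have "q x = q \<zero>\<^bsub>A\<^esub> \<longleftrightarrow> x \<in> d ` carrier B" if "x \<in> carrier A" for x
      using q_eq[OF A.M.zero_closed that] dc by (auto simp: eq_commute[of "q x"])
    then show ?thesis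
      using dc by (auto simp: a_kernel_def' image_module_def)
  qed
  show thesis
    by (rule that[OF N _ ker]) simp
qed

lemma retract_complex_FPR:
  fixes N :: "('r, 'n, 'y) module_scheme" and P :: "nat \<Rightarrow> ('r, ('r, 'n) formal) module"
  assumes P: "retract_complex R P k r p d" and bound: "\<And>i. i > n \<Longrightarrow> k i = 0"
    and N: "Module.module R N" and \<epsilon>: "\<epsilon> \<in> module_hom R (P 0) N" "\<epsilon> ` carrier (P 0) = carrier N"
      "a_kernel (P 0) N \<epsilon> = d 0 ` carrier (P (Suc 0))"
  shows "FPR R N"
proof -
  note PD = retract_complexD[OF P]
  have zero: "d n ` carrier (P (Suc n)) = {\<zero>\<^bsub>P n\<^esub>}"
  proof -
    interpret P: Module.module R "P (Suc n)" by (rule PD(2))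
    have "x = \<zero>\<^bsub>P (Suc n)\<^esub>" if x: "x \<in> carrier (P (Suc n))" for x
    proof -
      have "r (Suc n) x = \<zero>\<^bsub>free_module R {..<k (Suc n)}\<^esub>"
        using module_hom_closed[OF PD(3) x] bound[of "Suc n"] by (auto simp: carrier_free_module)
      then have "p (Suc n) (r (Suc n) x) = \<zero>\<^bsub>P (Suc n)\<^esub>"
        using module_hom_zero[OF P.R.module_free_module PD(2,4)] by metis
      then show ?thesis using PD(5)[OF x] by simp
    qed
    then have "carrier (P (Suc n)) = {\<zero>\<^bsub>P (Suc n)\<^esub>}" by auto
    then show ?thesis using module_hom_zero[OF PD(2,2,6)] by simp
  qed
  \<comment> \<open>In \<open>resolution\<close> the map with index \<open>i\<close> starts at
    \<open>P i\<close>, here it ends there; hence the shift by one.\<close>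
  have "resolution (fg_projective R) R N n P (\<lambda>i. d (i - 1)) \<epsilon>"
    unfolding resolution_def Let_def
  proof (intro conjI allI impI ballI N \<epsilon>(1,2))
    fix i
    show "Module.module R (P i)" by (rule PD(2))
    show "fg_projective R (P i)" by (rule retract_free_fg_projective[OF PD(1)])
  next
    fix i assume "i \<in> {1..n}"
    then obtain m where m: "i = Suc m" by (cases i) auto
    show "d (i - 1) \<in> module_hom R (P i) (P (i - 1))"
      using PD(6)[of m] m by simp
    show "a_kernel (P i) (P (i - 1)) (d (i - 1)) =
        (if i = n then {\<zero>\<^bsub>P i\<^esub>} else d (Suc i - 1) ` carrier (P (Suc i)))"
      using PD(7)[of m] m zero by auto
  next
    show "a_kernel (P 0) N \<epsilon> = (if 0 = n then {\<zero>\<^bsub>P 0\<^esub>} else d (Suc 0 - 1) ` carrier (P (Suc 0)))"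
      using \<epsilon>(3) zero by auto
  qed
  then show ?thesis unfolding FPR_def by blast
qed

lemma FPR_retract_complex:
  fixes N :: "('r, 'n, 'y) module_scheme"
  assumes "FPR R N"
  obtains P :: "nat \<Rightarrow> ('r, ('r, 'n) formal) module" and k r p d \<epsilon> n where
    "retract_complex R P k r p d" "\<And>i. i > n \<Longrightarrow> k i = 0"
    "Module.module R N" "\<epsilon> \<in> module_hom R (P 0) N" "\<epsilon> ` carrier (P 0) = carrier N"
    "a_kernel (P 0) N \<epsilon> = d 0 ` carrier (P (Suc 0))"
proof -
  obtain n and Q :: "nat \<Rightarrow> ('r, ('r, 'n) formal) module" and d \<epsilon>
    where res: "resolution (fg_projective R) R N n Q d \<epsilon>"
    using assms unfolding FPR_def by blast
  have N: "Module.module R N" and Q: "\<And>i. i \<le> n \<Longrightarrow> Module.module R (Q i)" "\<And>i. i \<le> n \<Longrightarrow> fg_projective R (Q i)"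
    and \<epsilon>: "\<epsilon> \<in> module_hom R (Q 0) N" "\<epsilon> ` carrier (Q 0) = carrier N"
    and d: "\<And>i. 1 \<le> i \<Longrightarrow> i \<le> n \<Longrightarrow> d i \<in> module_hom R (Q i) (Q (i - 1))"
    and k0: "a_kernel (Q 0) N \<epsilon> = (if 0 = n then {\<zero>\<^bsub>Q 0\<^esub>} else d (Suc 0) ` carrier (Q (Suc 0)))"
    and ki: "\<And>i. 1 \<le> i \<Longrightarrow> i \<le> n \<Longrightarrow> a_kernel (Q i) (Q (i - 1)) (d i) =
      (if i = n then {\<zero>\<^bsub>Q i\<^esub>} else d (Suc i) ` carrier (Q (Suc i)))"
    using res unfolding resolution_def Let_def by auto
  interpret N: Module.module R N by fact
  interpret Q0: Module.module R "Q 0" by (rule Q(1)) simp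
  \<comment> \<open>A zero module in the type of the resolution, used to continue it beyond degree
    \<open>n\<close>.\<close>
  define Z where "Z = (Q 0)\<lparr>carrier := {\<zero>\<^bsub>Q 0\<^esub>}\<rparr>"
  have Z: "Module.module R Z"
    unfolding Z_def by (rule module_submoduleI[OF Q0.module_axioms]) auto
  have zeroZ: "carrier Z = {\<zero>\<^bsub>Z\<^esub>}" by (simp add: Z_def)
  have "\<exists>K. \<forall>i\<le>n. \<exists>r p. retract_free R (Q i) {..<K i :: nat} r p"
    using fg_projective_retract_free[OF Q(2)] by (intro choice_iff[THEN iffD1]) metis
  then obtain K rQ pQ where ret: "\<And>i. i \<le> n \<Longrightarrow> retract_free R (Q i) {..<K i :: nat} (rQ i) (pQ i)"
    by metis
  define P where "P i = (if i \<le> n then Q i else Z)" for i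
  define k where "k i = (if i \<le> n then K i else 0)" for i
  define r where "r i = (if i \<le> n then rQ i else (\<lambda>_ _. \<zero>\<^bsub>R\<^esub>))" for i
  define p where "p i = (if i \<le> n then pQ i else (\<lambda>_. \<zero>\<^bsub>Z\<^esub>))" for i
  define d' where "d' i = (if Suc i \<le> n then d (Suc i) else (\<lambda>_. \<zero>\<^bsub>P i\<^esub>))" for i
  have P: "Module.module R (P i)" for i
    using Q(1) Z by (simp add: P_def)
  have retP: "retract_free R (P i) {..<k i} (r i) (p i)" for i
  proof (cases "i \<le> n")
    case True
    then show ?thesis using ret by (simp add: P_def k_def r_def p_def)
  next
    case False
    interpret Z: Module.module R Z by fact
    interpret F: Module.module R "free_module R {..<k i}" by (rule N.R.module_free_module)
    show ?thesis
      using False Z F.module_hom_zero_map[OF Z] Z.module_hom_zero_map[OF F.module_axioms] zeroZ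
      by (auto simp: retract_free_def P_def r_def p_def)
  qed
  have dP: "d' i \<in> module_hom R (P (Suc i)) (P i)" for i
  proof (cases "Suc i \<le> n")
    case True
    then show ?thesis using d[of "Suc i"] by (simp add: d'_def P_def)
  next
    case False
    interpret P: Module.module R "P i" by (rule P)
    show ?thesis using False P.module_hom_zero_map[OF P] by (simp add: d'_def)
  qed
  have carrier_P: "carrier (P i) = {\<zero>\<^bsub>P i\<^esub>}" if "i > n" for i
    using that zeroZ by (simp add: P_def)
  have img: "d' i ` carrier (P (Suc i)) = (if i < n then d (Suc i) ` carrier (Q (Suc i)) else {\<zero>\<^bsub>P i\<^esub>})" for i
    using carrier_P[of "Suc i"] by (auto simp: d'_def P_def)
  have "a_kernel (P (Suc i)) (P i) (d' i) = d' (Suc i) ` carrier (P (Suc (Suc i)))" for i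
  proof (cases "Suc i \<le> n")
    case True
    then show ?thesis
      unfolding img using ki[of "Suc i"] by (auto simp: P_def d'_def)
  next
    case False
    then show ?thesis
      unfolding img using carrier_P[of "Suc i"] by (auto simp: a_kernel_def' d'_def)
  qed
  then have "retract_complex R P k r p d'"
    using retP dP by (simp add: retract_complex_def)
  moreover have "a_kernel (P 0) N \<epsilon> = d' 0 ` carrier (P (Suc 0))"
    unfolding img using k0 by (simp add: P_def)
  ultimately show thesis
    using N \<epsilon> by (intro that[of P k r p d' n \<epsilon>]) (auto simp: k_def P_def)
qed

lemma retract_free_cover: "cring R \<Longrightarrow> retract_free R (cover R N) (carrier N) (\<lambda>x. x) (\<lambda>x. x)"
  unfolding cover_def by (rule cring.retract_free_free_module)

lemma tensor_exact_mexact: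
  assumes P: "retract_complex R P k r p d" and M: "Module.module R M"
    and e: "\<And>j l. j < k (Suc 0) \<Longrightarrow> l < k (Suc 0) \<Longrightarrow> e (Suc 0) j l = r (Suc 0) (p (Suc 0) (delta R l)) j"
    and D: "\<And>i j l. j < k i \<Longrightarrow> l < k (Suc i) \<Longrightarrow> D i j l = r i (d i (p (Suc i) (delta R l))) j"
  shows "tensor_exact R M (P (Suc (Suc 0))) (d (Suc 0)) (P (Suc 0)) (d 0) (P 0) \<longleftrightarrow> mexact M k e D 0"
proof -
  note PD = retract_complexD[OF P]
  show ?thesis
    unfolding mexact_def by (rule tensor_exact_iff[OF PD(1,1,1,6,6) M e D D])
qed

text \<open>\<open>Tor1\<close> is defined by free modules on all elements of \<open>N\<close> and
  of its syzygies, which matrices of finite size cannot describe. Comparison in both directions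
  replaces that resolution by the one made of retracts of finite free modules.\<close>

lemma Tor1_mexact:
  assumes P: "retract_complex R P k r p d" and M: "Module.module R M" and N: "Module.module R N"
    and \<epsilon>: "\<epsilon> \<in> module_hom R (P 0) N" "\<epsilon> ` carrier (P 0) = carrier N"
      "a_kernel (P 0) N \<epsilon> = d 0 ` carrier (P (Suc 0))"
    and e: "\<And>j l. j < k (Suc 0) \<Longrightarrow> l < k (Suc 0) \<Longrightarrow> e (Suc 0) j l = r (Suc 0) (p (Suc 0) (delta R l)) j"
    and D: "\<And>i j l. j < k i \<Longrightarrow> l < k (Suc i) \<Longrightarrow> D i j l = r i (d i (p (Suc i) (delta R l))) j"
  shows "trivial_group (Tor1 R N M) \<longleftrightarrow> mexact M k e D 0"
proof -
  note PD = retract_complexD[OF P]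
  interpret N: Module.module R N by fact
  have augP: "aug_exact R (P (Suc (Suc 0))) (d (Suc 0)) (P (Suc 0)) (d 0) (P 0) \<epsilon> N"
    unfolding aug_exact_def using PD(2,6,7) N \<epsilon> by blast
  have tensor_mexact: "tensor_exact R M (P (Suc (Suc 0))) (d (Suc 0)) (P (Suc 0)) (d 0) (P 0) \<longleftrightarrow> mexact M k e D 0"
    by (rule tensor_exact_mexact[OF P M]) (use e D in auto)
  note freeF = retract_free_cover[OF N.R.is_cring]
  show ?thesis
    unfolding trivial_Tor1_iff[OF N M] tensor_mexact[symmetric]
    using tensor_exact_compare[OF augP aug_exact_cover[OF N] PD(1,1) freeF freeF freeF M]
      tensor_exact_compare[OF aug_exact_cover[OF N] augP freeF freeF PD(1,1,1) M]
    by blast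
qed

text \<open>Test modules of one fixed type give way to matrices over \<open>R\<close>. From right to
  left, each module in \<open>FPR\<close> yields such matrices. From left to right, a resolution by
  matrices must be turned into a test module of the prescribed type: its elements are built from
  tuples of scalars, which \<open>formal_tuple\<close> encodes at whichever level of nesting of
  \<open>formal\<close> is asked for.\<close>

theorem FT_flat_iff:
  fixes M :: "('r, 'm, 'y) module_scheme"
  assumes R: "cring R"
  shows "FT_flat R M \<longleftrightarrow> Module.module R M \<and> (\<forall>k e D. fp_resolution R k e D \<longrightarrow> mexact M k e D 0)"
proof (intro iffI conjI allI impI)
  interpret R: cring R by fact
  assume flat: "FT_flat R M"
  then show M: "Module.module R M" by (simp add: FT_flat_def)
  fix k e D assume res: "fp_resolution R k e D"
  obtain P :: "nat \<Rightarrow> ('r, nat \<Rightarrow> 'r) module" and r p d where P: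
    "retract_complex R P k r p d" "\<And>i. carrier (P i) \<subseteq> carrier (free_module R {..<k i})"
    "\<And>i j l. j < k i \<Longrightarrow> l < k i \<Longrightarrow> e i j l = r i (p i (delta R l)) j"
    "\<And>i j l. j < k i \<Longrightarrow> l < k (Suc i) \<Longrightarrow> D i j l = r i (d i (p (Suc i) (delta R l))) j"
    by (rule fp_resolution_retract_complex[OF R res]) (rule that)
  obtain n where n: "\<And>i. i > n \<Longrightarrow> k i = 0"
    using res unfolding fp_resolution_def fp_complex_def by blast
  let ?f = "\<lambda>i. formal_tuple (k i) :: (nat \<Rightarrow> 'r) \<Rightarrow> ('r, ('r, 'm) formal) formal"
  let ?g = "\<lambda>i. inv_into (carrier (P i)) (?f i)"
  let ?P = "\<lambda>i. image_module (P i) (?f i)"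
  have inj: "inj_on (?f i) (carrier (P i))" for i
    using inj_on_formal_tuple P(2) by (rule inj_on_subset)
  note P' = retract_complex_transport[of R P k r p d ?f, OF P(1) inj]
  note PD = retract_complexD[OF P(1)] and PD' = retract_complexD[OF P']
  have gf: "?g i (?f i x) = x" if "x \<in> carrier (P i)" for i x
    using inj[of i] that by simp
  \<comment> \<open>The terms of the resolution live one level of \<open>formal\<close> above the
    test module. To obtain the cokernel in the lower type, the tuples behind \<open>?P 0\<close> are
    encoded anew.\<close>
  let ?h = "\<lambda>u. formal_tuple (k 0) (?g 0 u) :: ('r, 'm) formal"
  have "inj_on ?h (carrier (?P 0))"
  proof (rule inj_onI)
    fix u v assume uv: "u \<in> carrier (?P 0)" "v \<in> carrier (?P 0)" and eq: "?h u = ?h v"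
    then obtain x y where xy: "x \<in> carrier (P 0)" "y \<in> carrier (P 0)" "u = ?f 0 x" "v = ?f 0 y" by auto
    have "inj_on (formal_tuple (k 0) :: _ \<Rightarrow> ('r, 'm) formal) (carrier (P 0))"
      using inj_on_formal_tuple P(2) by (rule inj_on_subset)
    then show "u = v" using eq xy by (simp add: gf inj_on_eq_iff)
  qed
  then obtain N :: "('r, ('r, 'm) formal) module" and \<epsilon> where N: "Module.module R N"
    "\<epsilon> \<in> module_hom R (?P 0) N" "\<epsilon> ` carrier (?P 0) = carrier N"
    "a_kernel (?P 0) N \<epsilon> = (\<lambda>u. ?f 0 (d 0 (?g (Suc 0) u))) ` carrier (?P (Suc 0))"
    by (rule module_cokernel[OF PD'(2,2,6)]) (rule that)
  have "FPR R N"
    by (rule retract_complex_FPR[OF P' n N])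
  then have "trivial_group (Tor1 R N M)"
    using flat by (simp add: FT_flat_def)
  moreover have pc: "p i (delta R l) \<in> carrier (P i)" if "l < k i" for i l
    using that by (intro module_hom_closed[OF PD(4)] R.delta_closed) simp
  have "trivial_group (Tor1 R N M) \<longleftrightarrow> mexact M k e D 0"
    by (rule Tor1_mexact[OF P' M N]) (simp_all add: P(3,4) gf pc module_hom_closed[OF PD(6)])
  ultimately show "mexact M k e D 0" by simp
next
  interpret R: cring R by fact
  assume asm: "Module.module R M \<and> (\<forall>k e D. fp_resolution R k e D \<longrightarrow> mexact M k e D 0)"
  have "trivial_group (Tor1 R N M)" if fpr: "FPR R N" for N :: "('r, ('r, 'm) formal) module"
  proof -
    obtain P :: "nat \<Rightarrow> ('r, ('r, ('r, 'm) formal) formal) module" and k r p d \<epsilon> n where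
      P: "retract_complex R P k r p d" and n: "\<And>i. i > n \<Longrightarrow> k i = 0"
      and N: "Module.module R N" "\<epsilon> \<in> module_hom R (P 0) N" "\<epsilon> ` carrier (P 0) = carrier N"
        "a_kernel (P 0) N \<epsilon> = d 0 ` carrier (P (Suc 0))"
      by (rule FPR_retract_complex[OF fpr]) (rule that)
    note PD = retract_complexD[OF P]
    have "fp_resolution R k (\<lambda>i j l. r i (p i (delta R l)) j) (\<lambda>i j l. r i (d i (p (Suc i) (delta R l))) j)"
      by (rule R.fp_resolution_of_retracts[of P k r p d n, OF PD(1,6,7) n])
    with asm show ?thesis
      by (subst Tor1_mexact[OF P _ N]) auto
  qed
  with asm show "FT_flat R M" by (simp add: FT_flat_def)
qed

section \<open>Dimension shifting\<close>

lemma msum_submodule [simp]: "msum (A\<lparr>carrier := H\<rparr>) f n = msum A f n"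
  by (induction n) auto

lemma mv_submodule [simp]: "mv (A\<lparr>carrier := H\<rparr>) r c D x = mv A r c D x"
  by (simp add: mv_def cong: if_cong)

text \<open>The terms from degree \<open>m\<close> on resolve the cokernel of \<open>D m\<close>.
  Dimension shifting in the resolved module is therefore a reindexing of matrices.\<close>

lemma fp_resolution_shift:
  assumes "fp_resolution R k e D"
  shows "fp_resolution R (\<lambda>i. k (i + m)) (\<lambda>i. e (i + m)) (\<lambda>i. D (i + m))"
proof -
  have complex: "fp_complex R k e D" and exact: "mexact (ring_as_module R) k e D i" for i
    using assms by (auto simp: fp_resolution_def)
  then obtain n where n: "\<forall>i>n. k i = 0"
    unfolding fp_complex_def by blast
  have "fp_complex R (\<lambda>i. k (i + m)) (\<lambda>i. e (i + m)) (\<lambda>i. D (i + m))"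
    unfolding fp_complex_def
  proof (intro conjI)
    show "\<exists>n. \<forall>i>n. k (i + m) = 0"
      using n by (intro exI[of _ n]) auto
  qed (use complex in \<open>simp add: fp_complex_def\<close>)
  moreover have "mexact (ring_as_module R) (\<lambda>i. k (i + m)) (\<lambda>i. e (i + m)) (\<lambda>i. D (i + m)) i" for i
    using exact[of "i + m"] by (simp add: mexact_def)
  ultimately show ?thesis by (simp add: fp_resolution_def)
qed

lemma mexact_shift: "mexact M (\<lambda>i. k (i + m)) (\<lambda>i. e (i + m)) (\<lambda>i. D (i + m)) i \<longleftrightarrow> mexact M k e D (i + m)"
  by (simp add: mexact_def)

text \<open>FT-flatness concerns the first Tor group of all modules in \<open>FPR\<close>; applied
  to the shifted data it yields vanishing in every positive degree.\<close>

lemma FT_flat_mexact: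
  assumes "cring R" "FT_flat R M" "fp_resolution R k e D"
  shows "mexact M k e D i"
  using FT_flat_iff[OF assms(1), of M] assms(2) fp_resolution_shift[OF assms(3), of i]
    mexact_shift[of M k i e D 0] by simp

lemma fp_complex_mat:
  assumes "fp_complex R k e D"
  shows "mat_in R (k i) (k i) (e i)" "mat_in R (k i) (k (Suc i)) (D i)"
  using assms by (auto simp: fp_complex_def)

section \<open>Matrix homology under change of the coefficient module\<close>

text \<open>A cycle is pushed forward by \<open>u\<close>, bounded in \<open>B\<close>, and the
  solution is pulled back by \<open>v\<close>. The lemma serves to replace modules by isomorphic
  copies.\<close>

lemma mexact_retract:
  assumes A: "Module.module R A" and B: "Module.module R B"
    and u: "u \<in> module_hom R A B" and v: "v \<in> module_hom R B A" and vu: "\<And>a. a \<in> carrier A \<Longrightarrow> v (u a) = a"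
    and complex: "fp_complex R k e D" and exact: "mexact B k e D i"
  shows "mexact A k e D i"
  unfolding mexact_def
proof (intro ballI impI)
  note mat = fp_complex_mat[OF complex]
  interpret A: Module.module R A by fact
  fix x assume x: "x \<in> tuples A (k (Suc i))" and zero: "mv A (k i) (k (Suc i)) (D i) x = (\<lambda>_. \<zero>\<^bsub>A\<^esub>)"
  note ux = tuples_module_hom[OF A B u x]
  have "mv B (k i) (k (Suc i)) (D i) (\<lambda>j. u (x j)) = (\<lambda>_. \<zero>\<^bsub>B\<^esub>)"
    using mv_module_hom[OF A B u mat(2) x] zero module_hom_zero[OF A B u] by simp
  then obtain y where y: "y \<in> tuples B (k (Suc (Suc i)))"
    "mv B (k (Suc i)) (k (Suc i)) (e (Suc i)) (\<lambda>j. u (x j)) = mv B (k (Suc i)) (k (Suc (Suc i))) (D (Suc i)) y"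
    using exact ux unfolding mexact_def by blast
  have "(\<lambda>j. v (u (mv A (k (Suc i)) (k (Suc i)) (e (Suc i)) x j)))
      = mv A (k (Suc i)) (k (Suc (Suc i))) (D (Suc i)) (\<lambda>j. v (y j))"
    using mv_module_hom[OF A B u mat(1) x] mv_module_hom[OF B A v mat(2) y(1)] y(2) by metis
  then have "mv A (k (Suc i)) (k (Suc i)) (e (Suc i)) x
      = mv A (k (Suc i)) (k (Suc (Suc i))) (D (Suc i)) (\<lambda>j. v (y j))"
    using A.tuples_closed[OF A.mv_closed[OF mat(1) x]] by (simp add: vu)
  then show "\<exists>y\<in>tuples A (k (Suc (Suc i))). mv A (k (Suc i)) (k (Suc i)) (e (Suc i)) x
      = mv A (k (Suc i)) (k (Suc (Suc i))) (D (Suc i)) y"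
    using tuples_module_hom[OF B A v y(1)] by blast
qed

lemma tuples_lift:
  assumes P: "Module.module R P" and M: "Module.module R M" and p: "p \<in> module_hom R P M"
    and surj: "p ` carrier P = carrier M" and x: "x \<in> tuples M n"
  obtains y where "y \<in> tuples P n" "(\<lambda>i. p (y i)) = x"
proof -
  interpret P: Module.module R P by fact
  have x_simps: "\<And>i. i < n \<Longrightarrow> x i \<in> carrier M" "\<And>i. n \<le> i \<Longrightarrow> x i = \<zero>\<^bsub>M\<^esub>"
    using x by (auto simp: tuples_def)
  define y where "y i = (if i < n then inv_into (carrier P) p (x i) else \<zero>\<^bsub>P\<^esub>)" for i
  have y: "y i \<in> carrier P \<and> p (y i) = x i" for i
    using x_simps[of i] surj module_hom_zero[OF P M p]
    by (cases "i < n") (auto simp: y_def inv_into_into f_inv_into_f)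
  show thesis
    by (rule that[of y]) (simp_all add: y tuples_def, simp add: y_def)
qed

lemma tuples_kernel:
  assumes "Module.module R P" "Module.module R M" "p \<in> module_hom R P M"
  shows "x \<in> tuples (P\<lparr>carrier := a_kernel P M p\<rparr>) n \<longleftrightarrow> x \<in> tuples P n \<and> (\<lambda>i. p (x i)) = (\<lambda>_. \<zero>\<^bsub>M\<^esub>)"
proof -
  have "p (x i) = \<zero>\<^bsub>M\<^esub>" if "\<forall>i<n. p (x i) = \<zero>\<^bsub>M\<^esub>" "\<forall>i\<ge>n. x i = \<zero>\<^bsub>P\<^esub>" for i
    using that module_hom_zero[OF assms] by (cases "i < n") auto
  then show ?thesis
    by (auto simp: tuples_def a_kernel_def' fun_eq_iff)
qed

text \<open>From the long exact sequence of \<open>0 \<rightarrow> K \<rightarrow> P \<rightarrow> M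
  \<rightarrow> 0\<close>: the homology of \<open>M\<close> in degree \<open>i + 2\<close> sits
  between that of \<open>P\<close> in degree \<open>i + 2\<close> and that of \<open>K\<close> in
  degree \<open>i + 1\<close>.\<close>

lemma mexact_cokernel:
  assumes P: "Module.module R P" and M: "Module.module R M" and p: "p \<in> module_hom R P M"
    and surj: "p ` carrier P = carrier M" and complex: "fp_complex R k e D"
    and exactP: "mexact P k e D (Suc i)" and exactK: "mexact (P\<lparr>carrier := a_kernel P M p\<rparr>) k e D i"
  shows "mexact M k e D (Suc i)"
  unfolding mexact_def
proof (intro ballI impI)
  note mat = fp_complex_mat[OF complex] and K = tuples_kernel[OF P M p]
  interpret P: Module.module R P by fact
  interpret M: Module.module R M by fact
  note fcP = P.fp_complex_mv[OF complex]
  let ?k1 = "k (Suc i)" and ?k2 = "k (Suc (Suc i))" and ?k3 = "k (Suc (Suc (Suc i)))"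
  let ?D1 = "D (Suc i)" and ?D2 = "D (Suc (Suc i))" and ?e1 = "e (Suc i)" and ?e2 = "e (Suc (Suc i))"
  fix x assume x: "x \<in> tuples M ?k2" and zero: "mv M ?k1 ?k2 ?D1 x = (\<lambda>_. \<zero>\<^bsub>M\<^esub>)"
  obtain w where w: "w \<in> tuples P ?k2" "(\<lambda>j. p (w j)) = x"
    by (rule tuples_lift[OF P M p surj x])
  have "(\<lambda>j. p (mv P ?k1 ?k2 ?D1 w j)) = (\<lambda>_. \<zero>\<^bsub>M\<^esub>)"
    using mv_module_hom[OF P M p mat(2) w(1)] w(2) zero by simp
  then have "mv P ?k1 ?k2 ?D1 w \<in> tuples (P\<lparr>carrier := a_kernel P M p\<rparr>) ?k1"
    using fcP(2)[OF w(1)] by (simp add: K)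
  then obtain z where z: "z \<in> tuples (P\<lparr>carrier := a_kernel P M p\<rparr>) ?k2"
    "mv P ?k1 ?k1 ?e1 (mv P ?k1 ?k2 ?D1 w) = mv P ?k1 ?k2 ?D1 z"
    using exactK fcP(6)[OF w(1)] unfolding mexact_def by auto
  then have zP: "z \<in> tuples P ?k2" and pz: "(\<lambda>j. p (z j)) = (\<lambda>_. \<zero>\<^bsub>M\<^esub>)"
    by (auto simp: K)
  \<comment> \<open>Subtracting \<open>z\<close> turns the lift \<open>w\<close> into a cycle and,
    as \<open>z\<close> lies in the kernel of \<open>p\<close>, does not change its image in
    \<open>M\<close>.\<close>
  define v where "v = (\<lambda>j. w j \<ominus>\<^bsub>P\<^esub> z j)"
  have v: "v \<in> tuples P ?k2"
    unfolding v_def by (rule P.tuples_diff[OF w(1) zP])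
  have "mv P ?k1 ?k2 ?D1 v = (\<lambda>_. \<zero>\<^bsub>P\<^esub>)"
    unfolding v_def P.mv_diff[OF mat(2) w(1) zP]
    using z(2) fcP(4)[OF w(1)] P.tuples_closed[OF fcP(2)[OF w(1)]] by (simp add: P.diff_eq_zero_iff fun_eq_iff)
  then obtain y where y: "y \<in> tuples P ?k3" "mv P ?k2 ?k2 ?e2 v = mv P ?k2 ?k3 ?D2 y"
    using exactP v unfolding mexact_def by auto
  have "p (v j) = x j" for j
  proof -
    have "p (v j) = p (w j) \<ominus>\<^bsub>M\<^esub> p (z j)"
      unfolding v_def using P.tuples_closed[OF w(1)] P.tuples_closed[OF zP] by (simp add: module_hom_diff[OF P M p])
    also have "\<dots> = x j"
      using fun_cong[OF w(2), of j] fun_cong[OF pz, of j] M.tuples_closed[OF x, of j] by (simp add: M.diff_zero)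
    finally show ?thesis .
  qed
  then have "mv M ?k2 ?k2 ?e2 x = mv M ?k2 ?k3 ?D2 (\<lambda>j. p (y j))"
    using mv_module_hom[OF P M p mat(1) v] mv_module_hom[OF P M p mat(2) y(1)] y(2) by simp
  then show "\<exists>y\<in>tuples M ?k3. mv M ?k2 ?k2 ?e2 x = mv M ?k2 ?k3 ?D2 y"
    using tuples_module_hom[OF P M p y(1)] by blast
qed

text \<open>The neighbouring piece of the same long exact sequence: the homology of \<open>K\<close>
  in degree \<open>i + 1\<close> sits between that of \<open>M\<close> in degree
  \<open>i + 2\<close> and that of \<open>P\<close> in degree \<open>i + 1\<close>.\<close>

lemma mexact_kernel:
  assumes P: "Module.module R P" and M: "Module.module R M" and p: "p \<in> module_hom R P M"
    and surj: "p ` carrier P = carrier M" and complex: "fp_complex R k e D"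
    and exactP: "mexact P k e D i" and exactM: "mexact M k e D (Suc i)"
  shows "mexact (P\<lparr>carrier := a_kernel P M p\<rparr>) k e D i"
  unfolding mexact_def
proof (intro ballI impI)
  note mat = fp_complex_mat[OF complex] and K = tuples_kernel[OF P M p]
  interpret P: Module.module R P by fact
  interpret M: Module.module R M by fact
  note fcP = P.fp_complex_mv[OF complex]
  let ?K = "P\<lparr>carrier := a_kernel P M p\<rparr>"
  let ?k0 = "k i" and ?k1 = "k (Suc i)" and ?k2 = "k (Suc (Suc i))" and ?k3 = "k (Suc (Suc (Suc i)))"
  let ?D0 = "D i" and ?D1 = "D (Suc i)" and ?D2 = "D (Suc (Suc i))" and ?e1 = "e (Suc i)" and ?e2 = "e (Suc (Suc i))"
  fix x assume x: "x \<in> tuples ?K ?k1" and zero: "mv ?K ?k0 ?k1 ?D0 x = (\<lambda>_. \<zero>\<^bsub>?K\<^esub>)"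
  have xP: "x \<in> tuples P ?k1" and px: "(\<lambda>j. p (x j)) = (\<lambda>_. \<zero>\<^bsub>M\<^esub>)"
    using x by (auto simp: K)
  obtain y where y: "y \<in> tuples P ?k2" "mv P ?k1 ?k1 ?e1 x = mv P ?k1 ?k2 ?D1 y"
    using exactP xP zero unfolding mexact_def by auto
  note py = tuples_module_hom[OF P M p y(1)]
  have "mv M ?k1 ?k2 ?D1 (\<lambda>j. p (y j)) = mv M ?k1 ?k1 ?e1 (\<lambda>j. p (x j))"
    using mv_module_hom[OF P M p mat(1) xP] mv_module_hom[OF P M p mat(2) y(1)] y(2) by simp
  also have "\<dots> = (\<lambda>_. \<zero>\<^bsub>M\<^esub>)"
    unfolding px by (rule M.mv_zero_tuple[OF mat(1)])
  finally obtain w where w: "w \<in> tuples M ?k3" "mv M ?k2 ?k2 ?e2 (\<lambda>j. p (y j)) = mv M ?k2 ?k3 ?D2 w"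
    using exactM py unfolding mexact_def by auto
  obtain v where v: "v \<in> tuples P ?k3" "(\<lambda>j. p (v j)) = w"
    by (rule tuples_lift[OF P M p surj w(1)])
  \<comment> \<open>Both corrections keep the boundary: \<open>?D1\<close> absorbs
    \<open>?e2\<close>, and \<open>?D1\<close> after \<open>?D2\<close> is zero. By the choice of
    \<open>v\<close> the difference is killed by \<open>p\<close>.\<close>
  define z where "z = (\<lambda>j. mv P ?k2 ?k2 ?e2 y j \<ominus>\<^bsub>P\<^esub> mv P ?k2 ?k3 ?D2 v j)"
  note ey = fcP(1)[OF y(1)] and Dv = fcP(2)[OF v(1)]
  have zP: "z \<in> tuples P ?k2"
    unfolding z_def by (rule P.tuples_diff[OF ey Dv])
  have "p (z j) = \<zero>\<^bsub>M\<^esub>" for j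
  proof -
    have "p (z j) = p (mv P ?k2 ?k2 ?e2 y j) \<ominus>\<^bsub>M\<^esub> p (mv P ?k2 ?k3 ?D2 v j)"
      unfolding z_def using P.tuples_closed[OF ey] P.tuples_closed[OF Dv] by (simp add: module_hom_diff[OF P M p])
    also have "p (mv P ?k2 ?k2 ?e2 y j) = p (mv P ?k2 ?k3 ?D2 v j)"
      using mv_module_hom[OF P M p mat(1) y(1)] mv_module_hom[OF P M p mat(2) v(1)] v(2) w(2) by metis
    finally show ?thesis
      using module_hom_closed[OF p P.tuples_closed[OF Dv]] by (simp add: M.diff_eq_zero_iff)
  qed
  then have "z \<in> tuples ?K ?k2"
    using zP by (simp add: K)
  moreover have "mv P ?k1 ?k2 ?D1 z = mv P ?k1 ?k1 ?e1 x"
  proof -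
    have "mv P ?k1 ?k2 ?D1 z = (\<lambda>j. mv P ?k1 ?k2 ?D1 y j \<ominus>\<^bsub>P\<^esub> \<zero>\<^bsub>P\<^esub>)"
      unfolding z_def P.mv_diff[OF mat(2) ey Dv] fcP(5)[OF y(1)] fcP(6)[OF v(1)] ..
    then show ?thesis
      using y(2) P.tuples_closed[OF fcP(2)[OF y(1)]] by (simp add: P.diff_zero)
  qed
  ultimately show "\<exists>y\<in>tuples ?K ?k2. mv ?K ?k1 ?k1 ?e1 x = mv ?K ?k1 ?k2 ?D1 y"
    unfolding mv_submodule by (intro bexI[of _ z]) simp_all
qed

text \<open>Evaluation at a point \<open>t\<close> of \<open>X\<close> is a homomorphism to
  \<open>R\<close>, so a solution can be sought at each point separately by exactness over
  \<open>R\<close>.\<close>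

lemma (in cring) mexact_free_module:
  assumes res: "fp_resolution R k e D"
  shows "mexact (free_module R X) k e D i"
  unfolding mexact_def
proof (intro ballI impI)
  let ?F = "free_module R X" and ?Rm = "ring_as_module R"
  have complex: "fp_complex R k e D" and exact: "mexact ?Rm k e D i"
    using res by (auto simp: fp_resolution_def)
  note mat = fp_complex_mat[OF complex]
  note F = module_free_module[of X] and Rm = module_ring_as_module
  interpret F: Module.module R ?F by (rule F)
  interpret Rm: Module.module R ?Rm by (rule Rm)
  have ev: "(\<lambda>f. f t) \<in> module_hom R ?F ?Rm" for t
    by (rule module_homI) (auto simp: free_module_closed)
  fix x assume x: "x \<in> tuples ?F (k (Suc i))" and zero: "mv ?F (k i) (k (Suc i)) (D i) x = (\<lambda>_. \<zero>\<^bsub>?F\<^esub>)"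
  \<comment> \<open>As \<open>X\<close> may be infinite, solutions chosen pointwise could have
    infinite support. Choosing zero wherever all entries of \<open>x\<close> vanish confines the
    support to a finite union of finite sets.\<close>
  have "\<exists>y\<in>tuples ?Rm (k (Suc (Suc i))).
      mv ?Rm (k (Suc i)) (k (Suc i)) (e (Suc i)) (\<lambda>j. x j t) = mv ?Rm (k (Suc i)) (k (Suc (Suc i))) (D (Suc i)) y \<and>
      ((\<forall>j. x j t = \<zero>) \<longrightarrow> y = (\<lambda>_. \<zero>))" for t
  proof (cases "\<forall>j. x j t = \<zero>")
    case True
    then show ?thesis
      using Rm.mv_zero_tuple[OF mat(1)[of "Suc i"]] Rm.mv_zero_tuple[OF mat(2)[of "Suc i"]] Rm.tuples_zero
      by (intro bexI[of _ "\<lambda>_. \<zero>"]) auto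
  next
    case False
    have "mv ?Rm (k i) (k (Suc i)) (D i) (\<lambda>j. x j t) = (\<lambda>_. \<zero>\<^bsub>?Rm\<^esub>)"
      using mv_module_hom[OF F Rm ev mat(2) x, of t] zero by simp
    with False show ?thesis
      using exact tuples_module_hom[OF F Rm ev x, of t] unfolding mexact_def by auto
  qed
  then obtain y where y: "\<And>t. y t \<in> tuples ?Rm (k (Suc (Suc i)))"
    "\<And>t. mv ?Rm (k (Suc i)) (k (Suc i)) (e (Suc i)) (\<lambda>j. x j t) = mv ?Rm (k (Suc i)) (k (Suc (Suc i))) (D (Suc i)) (y t)"
    "\<And>t. (\<And>j. x j t = \<zero>) \<Longrightarrow> y t = (\<lambda>_. \<zero>)"
    by metis
  define Y where "Y = (\<lambda>j t. y t j)"
  have xF: "x j \<in> carrier ?F" for j by (rule F.tuples_closed[OF x])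
  have xz: "x j t = \<zero>" if "\<And>j. j < k (Suc i) \<Longrightarrow> x j t = \<zero>" for j t
    using that x by (cases "j < k (Suc i)") (auto simp: tuples_def)
  have "Y j \<in> carrier ?F" for j
  proof -
    have "{t. Y j t \<noteq> \<zero>} \<subseteq> (\<Union>j<k (Suc i). {t. x j t \<noteq> \<zero>})"
      using y(3) xz unfolding Y_def by fastforce
    moreover have "finite (\<Union>j<k (Suc i). {t. x j t \<noteq> \<zero>})"
      using xF by (auto simp: carrier_free_module)
    ultimately have "finite {t. Y j t \<noteq> \<zero>}" by (rule finite_subset)
    moreover have "Y j t = \<zero>" if "t \<notin> X" for t
      using y(3)[of t] xF that by (auto simp: carrier_free_module Y_def)
    ultimately show ?thesis
      using Rm.tuples_closed[OF y(1)] by (auto simp: carrier_free_module Y_def)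
  qed
  then have Y: "Y \<in> tuples ?F (k (Suc (Suc i)))"
    using y(1) by (auto simp: tuples_def Y_def fun_eq_iff)
  have "mv ?F (k (Suc i)) (k (Suc i)) (e (Suc i)) x = mv ?F (k (Suc i)) (k (Suc (Suc i))) (D (Suc i)) Y"
  proof (intro ext)
    fix j t
    show "mv ?F (k (Suc i)) (k (Suc i)) (e (Suc i)) x j t = mv ?F (k (Suc i)) (k (Suc (Suc i))) (D (Suc i)) Y j t"
      using fun_cong[OF mv_module_hom[OF F Rm ev mat(1) x, of t], of j]
        fun_cong[OF mv_module_hom[OF F Rm ev mat(2) Y, of t], of j] fun_cong[OF y(2)[of t], of j]
      by (simp add: Y_def)
  qed
  then show "\<exists>y\<in>tuples ?F (k (Suc (Suc i))). mv ?F (k (Suc i)) (k (Suc i)) (e (Suc i)) x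
      = mv ?F (k (Suc i)) (k (Suc (Suc i))) (D (Suc i)) y"
    using Y by blast
qed

section \<open>Bounds on the FT-flat dimension as vanishing of matrix homology\<close>

lemma inverse_module_hom:
  assumes A: "Module.module R A" and f: "f \<in> module_hom R A B"
    and inj: "inj_on f (carrier A)" and surj: "f ` carrier A = carrier B"
  shows "inv_into (carrier A) f \<in> module_hom R B A"
proof (rule module_homI)
  interpret A: Module.module R A by fact
  let ?g = "inv_into (carrier A) f"
  have g: "?g x \<in> carrier A" "f (?g x) = x" if "x \<in> carrier B" for x
    using that surj by (auto simp: inv_into_into f_inv_into_f)
  have gf: "?g (f x) = x" if "x \<in> carrier A" for x
    using inj that by simp
  fix x assume x: "x \<in> carrier B"
  show "?g x \<in> carrier A" using g x by simp
  show "?g (x \<oplus>\<^bsub>B\<^esub> y) = ?g x \<oplus>\<^bsub>A\<^esub> ?g y" if "y \<in> carrier B" for y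
    using gf[of "?g x \<oplus>\<^bsub>A\<^esub> ?g y"] g x that by (simp add: module_hom_add[OF f])
  show "?g (r \<odot>\<^bsub>B\<^esub> x) = r \<odot>\<^bsub>A\<^esub> ?g x" if "r \<in> carrier R" for r
    using gf[of "r \<odot>\<^bsub>A\<^esub> ?g x"] g x that by (simp add: module_hom_smult[OF f])
qed

lemma trivial_kernel_inj:
  assumes A: "Module.module R A" and B: "Module.module R B" and f: "f \<in> module_hom R A B"
    and ker: "a_kernel A B f = {\<zero>\<^bsub>A\<^esub>}"
  shows "inj_on f (carrier A)"
proof (rule inj_onI)
  interpret A: Module.module R A by fact
  interpret B: Module.module R B by fact
  fix x y assume xy: "x \<in> carrier A" "y \<in> carrier A" "f x = f y"
  then have "x \<ominus>\<^bsub>A\<^esub> y \<in> a_kernel A B f"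
    using module_hom_closed[OF f] by (simp add: a_kernel_def' module_hom_diff[OF A B f] B.diff_eq_zero_iff)
  with ker xy show "x = y" by (simp add: A.diff_eq_zero_iff)
qed

text \<open>A resolution of length 0 is an isomorphism from an FT-flat module onto
  \<open>M\<close>.\<close>

lemma resolution_0_mexact:
  assumes res: "resolution (FT_flat R) R M 0 P d \<epsilon>" and R: "cring R" and fp: "fp_resolution R k e D"
  shows "mexact M k e D i"
proof -
  have M: "Module.module R M" and P: "Module.module R (P 0)" "FT_flat R (P 0)"
    and \<epsilon>: "\<epsilon> \<in> module_hom R (P 0) M" "\<epsilon> ` carrier (P 0) = carrier M" "a_kernel (P 0) M \<epsilon> = {\<zero>\<^bsub>P 0\<^esub>}"
    using res by (auto simp: resolution_def)
  have inj: "inj_on \<epsilon> (carrier (P 0))"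
    by (rule trivial_kernel_inj[OF P(1) M \<epsilon>(1,3)])
  have complex: "fp_complex R k e D"
    using fp by (simp add: fp_resolution_def)
  show ?thesis
    by (rule mexact_retract[OF M P(1) inverse_module_hom[OF P(1) \<epsilon>(1) inj \<epsilon>(2)] \<epsilon>(1) _ complex
          FT_flat_mexact[OF R P(2) fp]])
      (simp add: f_inv_into_f \<epsilon>(2))
qed

lemma resolution_Suc_mexact:
  assumes res: "resolution (FT_flat R) R M (Suc n) P d \<epsilon>" and R: "cring R" and fp: "fp_resolution R k e D"
    and K: "\<And>i. n \<le> i \<Longrightarrow> mexact ((P 0)\<lparr>carrier := a_kernel (P 0) M \<epsilon>\<rparr>) k e D i"
    and i: "Suc n \<le> i"
  shows "mexact M k e D i"
proof -
  have M: "Module.module R M" and P: "Module.module R (P 0)" "FT_flat R (P 0)"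
    and \<epsilon>: "\<epsilon> \<in> module_hom R (P 0) M" "\<epsilon> ` carrier (P 0) = carrier M"
    using res by (auto simp: resolution_def)
  have complex: "fp_complex R k e D"
    using fp by (simp add: fp_resolution_def)
  obtain m where m: "i = Suc m" "n \<le> m"
    using i by (cases i) auto
  show ?thesis
    unfolding m(1)
    by (rule mexact_cokernel[OF P(1) M \<epsilon> complex FT_flat_mexact[OF R P(2) fp] K[OF m(2)]])
qed

lemma resolution_kernel:
  assumes res: "resolution \<C> R M (Suc n) P d \<epsilon>"
  shows "resolution \<C> R ((P 0)\<lparr>carrier := a_kernel (P 0) M \<epsilon>\<rparr>) n (\<lambda>i. P (Suc i)) (\<lambda>i. d (Suc i)) (d 1)"
proof -
  have M: "Module.module R M" and P: "\<And>i. i \<le> Suc n \<Longrightarrow> Module.module R (P i) \<and> \<C> (P i)"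
    and \<epsilon>: "\<epsilon> \<in> module_hom R (P 0) M"
    and d: "\<And>i. 1 \<le> i \<Longrightarrow> i \<le> Suc n \<Longrightarrow> d i \<in> module_hom R (P i) (P (i - 1))"
    and k0: "a_kernel (P 0) M \<epsilon> = d (Suc 0) ` carrier (P (Suc 0))"
    and ki: "\<And>i. 1 \<le> i \<Longrightarrow> i \<le> Suc n \<Longrightarrow> a_kernel (P i) (P (i - 1)) (d i) =
      (if i = Suc n then {\<zero>\<^bsub>P i\<^esub>} else d (Suc i) ` carrier (P (Suc i)))"
    using res unfolding resolution_def Let_def by auto
  let ?K = "(P 0)\<lparr>carrier := a_kernel (P 0) M \<epsilon>\<rparr>"
  have "Module.module R ?K"
    by (rule module_hom_kernel_module[OF _ M \<epsilon>]) (use P in auto)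
  moreover have "d 1 \<in> module_hom R (P (Suc 0)) ?K"
    using d[of 1] by (intro module_hom_restrict) (auto simp: k0[symmetric] a_kernel_def')
  moreover have "a_kernel (P (Suc 0)) ?K (d 1) = a_kernel (P (Suc 0)) (P 0) (d 1)"
    by (simp add: a_kernel_def')
  moreover have "d (Suc i) \<in> module_hom R (P (Suc i)) (P (Suc (i - 1)))"
    and "a_kernel (P (Suc i)) (P (Suc (i - 1))) (d (Suc i)) =
      (if i = n then {\<zero>\<^bsub>P (Suc i)\<^esub>} else d (Suc (Suc i)) ` carrier (P (Suc (Suc i))))" if "i \<in> {1..n}" for i
    using d[of "Suc i"] ki[of "Suc i"] that by auto
  ultimately show ?thesis
    unfolding resolution_def Let_def
    using P k0 ki[of 1] by auto
qed

text \<open>The induction passes from \<open>M\<close> to the kernel of \<open>\<epsilon>\<close>,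
  which lies inside \<open>P 0\<close>. Its elements have the type of the resolution, hence the
  restriction on the type of \<open>M\<close>; in general only the first step leaves this
  type.\<close>

lemma resolution_mexact_same_type:
  fixes M :: "('r, 'p) module" and P :: "nat \<Rightarrow> ('r, 'p) module"
  assumes "resolution (FT_flat R) R M n P d \<epsilon>" "cring R" "fp_resolution R k e D" "n \<le> i"
  shows "mexact M k e D i"
  using assms
proof (induction n arbitrary: M P d \<epsilon> i)
  case 0
  then show ?case using resolution_0_mexact by blast
next
  case (Suc n)
  show ?case
    by (rule resolution_Suc_mexact[OF Suc.prems(1-3) Suc.IH[OF resolution_kernel[OF Suc.prems(1)] Suc.prems(2,3)] Suc.prems(4)])
qed

lemma resolution_mexact:
  assumes "resolution (FT_flat R) R M n P d \<epsilon>" "cring R" "fp_resolution R k e D" "n \<le> i"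
  shows "mexact M k e D i"
proof (cases n)
  case 0
  with assms show ?thesis using resolution_0_mexact by blast
next
  case (Suc m)
  note res = assms(1)[unfolded Suc]
  show ?thesis
    by (rule resolution_Suc_mexact[OF res assms(2,3) resolution_mexact_same_type[OF resolution_kernel[OF res] assms(2,3)]
          assms(4)[unfolded Suc]])
qed

text \<open>The resolution consists of copies of the canonical free modules, truncated at the \<open>m\<close>-th syzygy \<open>S m\<close>.\<close>

lemma FT_fd_leI:
  fixes R :: "('r, 'x) ring_scheme" and M :: "('r, 'm, 'y) module_scheme"
  assumes R: "cring R" and M: "Module.module R M"
    and exact: "\<And>k e D i. fp_resolution R k e D \<Longrightarrow> m \<le> i \<Longrightarrow> mexact M k e D i"
  shows "FT_fd_le R M m"
proof -
  interpret R: cring R by fact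
  obtain emb :: "(('r, 'm) formal \<Rightarrow> 'r) \<Rightarrow> ('r, 'm) formal" where
    emb: "inj_on emb {f. finite {x. f x \<noteq> \<zero>\<^bsub>R\<^esub>}}"
    using finite_support_embeds_in_formal[of "\<zero>\<^bsub>R\<^esub>"] by blast
  define F :: "('r, ('r, 'm) formal) module \<Rightarrow> ('r, ('r, 'm) formal) module"
    \<comment> \<open>The cover consists of finitely supported functions on \<open>formal\<close>,
      and \<open>emb\<close> brings these back into \<open>formal\<close>. So the construction of
      syzygies can be iterated within one type.\<close>
    where "F A = image_module (cover R A) emb" for A
  define pr where "pr A u = cover_map R A (inv_into (carrier (cover R A)) emb u)"
    for A :: "('r, ('r, 'm) formal) module" and u
  define S :: "nat \<Rightarrow> ('r, ('r, 'm) formal) module"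
    where "S = rec_nat (image_module M Gen) (\<lambda>_ A. (F A)\<lparr>carrier := a_kernel (F A) A (pr A)\<rparr>)"
  have S_simps: "S 0 = image_module M Gen" "S (Suc i) = (F (S i))\<lparr>carrier := a_kernel (F (S i)) (S i) (pr (S i))\<rparr>" for i
    by (simp_all add: S_def)
  have inj: "inj_on emb (carrier (cover R A))" for A :: "('r, ('r, 'm) formal) module"
    by (rule inj_on_subset[OF emb]) (auto simp: cover_def carrier_free_module)
  have F: "Module.module R (F A)" and toF: "emb \<in> module_hom R (cover R A) (F A)"
    and fromF: "inv_into (carrier (cover R A)) emb \<in> module_hom R (F A) (cover R A)"
    for A :: "('r, ('r, 'm) formal) module"
    using image_module_inj[OF R.module_free_module[of "carrier A", folded cover_def] inj[of A]]
    by (auto simp: F_def)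
  have pr: "pr A \<in> module_hom R (F A) A" "pr A ` carrier (F A) = carrier A"
    if A: "Module.module R A" for A
  proof -
    note cm = cover_map_surj_hom[OF A]
    show "pr A \<in> module_hom R (F A) A"
      using module_hom_comp[OF fromF cm(1)] by (simp add: pr_def[abs_def])
    have "pr A (emb f) = cover_map R A f" if "f \<in> carrier (cover R A)" for f
      using inj that by (simp add: pr_def)
    then show "pr A ` carrier (F A) = carrier A"
      using cm(2) by (force simp: F_def image_image)
  qed
  have inj_Gen: "inj_on (Gen :: 'm \<Rightarrow> ('r, 'm) formal) (carrier M)" by (simp add: inj_on_def)
  note S0 = image_module_inj[OF M inj_Gen, folded S_simps]
  let ?g = "inv_into (carrier M) (Gen :: 'm \<Rightarrow> ('r, 'm) formal)"
  have S: "Module.module R (S i)" for i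
  proof (induction i)
    case (Suc i)
    then show ?case
      unfolding S_simps by (intro module_hom_kernel_module[OF F _ pr(1)])
  qed (rule S0(1))
  note prS = pr[OF S]
  have exactF: "mexact (F A) k e D i" if fp: "fp_resolution R k e D" for A k e D i
  proof (rule mexact_retract[OF F _ fromF toF])
    show "Module.module R (cover R A)"
      unfolding cover_def by (rule R.module_free_module)
    show "fp_complex R k e D" using fp by (simp add: fp_resolution_def)
    show "mexact (cover R A) k e D i"
      unfolding cover_def by (rule R.mexact_free_module[OF fp])
  qed (auto simp: F_def f_inv_into_f)
  \<comment> \<open>Each syzygy trades one degree: \<open>mexact_kernel\<close> leads from
    \<open>S i\<close> in degree \<open>j + 2\<close> to \<open>S (Suc i)\<close> in degree
    \<open>j + 1\<close>, since the free module in between has no homology in positive degrees. For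
    \<open>i = m\<close> every positive degree is covered, which makes \<open>S m\<close>
    FT-flat.\<close>
  have exactS: "mexact (S i) k e D j" if fp: "fp_resolution R k e D" and "m \<le> i + j" for i j k e D
    using that(2)
  proof (induction i arbitrary: j)
    case 0
    show ?case
    proof (rule mexact_retract[OF S0(1) M S0(3) S0(2)])
      show "fp_complex R k e D" using fp by (simp add: fp_resolution_def)
      show "mexact M k e D j" using exact[OF fp] 0 by simp
    qed (auto simp: S_simps f_inv_into_f)
  next
    case (Suc i)
    have "fp_complex R k e D" using fp by (simp add: fp_resolution_def)
    then show ?case
      unfolding S_simps
      by (rule mexact_kernel[OF F S prS _ exactF[OF fp] Suc.IH]) (use Suc.prems in simp)
  qed
  \<comment> \<open>The map \<open>d i\<close> goes onto \<open>S i\<close>, and for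
    \<open>i > 0\<close> this is a submodule of \<open>P (i - 1) = F (S (i - 1))\<close>. At
    \<open>i = m\<close> the map is the inclusion of the last syzygy.\<close>
  define P where "P i = (if i < m then F (S i) else S m)" for i
  define d where "d i = (if i < m then pr (S i) else (\<lambda>x. x))" for i
  \<comment> \<open>For \<open>m = 0\<close> the module \<open>P 0\<close> is the copy
    \<open>S 0\<close> of \<open>M\<close> itself, and only the decoding \<open>?g\<close>
    remains.\<close>
  define \<epsilon> where "\<epsilon> u = ?g (if 0 < m then pr (S 0) u else u)" for u
  have P: "Module.module R (P i)" for i
    using F S by (simp add: P_def)
  have flat: "FT_flat R (P i)" if "i \<le> m" for i
    unfolding FT_flat_iff[OF R] P_def using F S exactF exactS[of _ _ _ m 0] by auto
  have dS: "d i \<in> module_hom R (P i) (S i)" "d i ` carrier (P i) = carrier (S i)" if "i \<le> m" for i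
    using that prS[of i] module_hom_id[of R "S i"] by (auto simp: d_def P_def)
  have S_sub: "(\<lambda>x. x) \<in> module_hom R (S (Suc i)) (F (S i))" for i
    unfolding S_simps by (rule module_hom_incl) (auto simp: a_kernel_def')
  have zeroS: "\<zero>\<^bsub>S (Suc i)\<^esub> = \<zero>\<^bsub>F (S i)\<^esub>" for i
    by (simp add: S_simps)
  have carrierS: "carrier (S (Suc i)) = a_kernel (F (S i)) (S i) (pr (S i))" for i
    by (simp add: S_simps)
  have g_zero: "?g x = \<zero>\<^bsub>M\<^esub> \<longleftrightarrow> x = \<zero>\<^bsub>S 0\<^esub>" if x: "x \<in> carrier (S 0)" for x
  proof -
    obtain a where a: "a \<in> carrier M" "x = Gen a" using x by (auto simp: S_simps)
    then have "?g x = a" using inj_Gen by simp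
    then show ?thesis
      using a(2) module_hom_zero[OF M S0(1,2)] by (metis formal.inject(1))
  qed
  have d0_hom: "(\<lambda>u. if 0 < m then pr (S 0) u else u) \<in> module_hom R (P 0) (S 0)"
    using dS(1)[of 0] by (cases "0 < m") (simp_all add: d_def)
  have d0_surj: "(\<lambda>u. if 0 < m then pr (S 0) u else u) ` carrier (P 0) = carrier (S 0)"
    using dS(2)[of 0] by (cases "0 < m") (simp_all add: d_def)
  have "resolution (FT_flat R) R M m P d \<epsilon>"
    unfolding resolution_def Let_def
  proof (intro conjI allI impI ballI M P)
    show "\<epsilon> \<in> module_hom R (P 0) M"
      using module_hom_comp[OF d0_hom S0(3)] by (simp add: \<epsilon>_def[abs_def])
    have "\<epsilon> ` carrier (P 0) = ?g ` carrier (S 0)"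
      unfolding d0_surj[symmetric] by (simp add: \<epsilon>_def image_image)
    also have "\<dots> = carrier M"
      by (simp only: S_simps carrier_image_module inv_into_image_cancel[OF inj_Gen order_refl])
    finally show "\<epsilon> ` carrier (P 0) = carrier M" .
    show "FT_flat R (P i)" if "i \<le> m" for i by (rule flat[OF that])
  next
    fix i assume i: "i \<in> {1..m}"
    then obtain j where j: "i = Suc j" "j < m" by (cases i) auto
    then have Pj: "P (i - 1) = F (S j)" by (simp add: P_def)
    show "d i \<in> module_hom R (P i) (P (i - 1))"
      using module_hom_comp[OF dS(1) S_sub] i j unfolding Pj by auto
    show "a_kernel (P i) (P (i - 1)) (d i) = (if i = m then {\<zero>\<^bsub>P i\<^esub>} else d (Suc i) ` carrier (P (Suc i)))"
    proof (cases "i = m")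
      case True
      interpret Si: Module.module R "S i" by (rule S)
      show ?thesis
        using True j Si.M.zero_closed unfolding Pj by (auto simp: a_kernel_def' d_def P_def zeroS)
    next
      case False
      then have "i < m" using i by auto
      then show ?thesis
        using dS(2)[of "Suc i"] j unfolding Pj
        by (simp add: carrierS) (simp add: P_def d_def a_kernel_def' zeroS)
    qed
  next
    show "a_kernel (P 0) M \<epsilon> = (if 0 = m then {\<zero>\<^bsub>P 0\<^esub>} else d (Suc 0) ` carrier (P (Suc 0)))"
    proof (cases "m = 0")
      case True
      interpret S0: Module.module R "S 0" by (rule S)
      show ?thesis
        using True g_zero by (auto simp: a_kernel_def' \<epsilon>_def P_def)
    next
      case False
      then show ?thesis
        using dS(2)[of "Suc 0"] g_zero module_hom_closed[OF prS(1)[of 0]]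
        by (simp add: carrierS) (auto simp: a_kernel_def' \<epsilon>_def P_def)
    qed
  qed
  then show ?thesis unfolding FT_fd_le_def by blast
qed

text \<open>The right-hand side mentions matrices over \<open>R\<close> and the scalar action on
  \<open>M\<close> only, which makes dimensions over different rings comparable.\<close>

theorem FT_fd_le_iff:
  assumes "cring R" "Module.module R M"
  shows "FT_fd_le R M m \<longleftrightarrow> (\<forall>k e D i. fp_resolution R k e D \<longrightarrow> m \<le> i \<longrightarrow> mexact M k e D i)"
  using FT_fd_leI[OF assms] resolution_mexact[OF _ assms(1)] unfolding FT_fd_le_def by metis

section \<open>Change of rings\<close>

lemma restrict_scalars_simps [simp]:
  "carrier (restrict_scalars \<phi> L) = carrier L" "\<zero>\<^bsub>restrict_scalars \<phi> L\<^esub> = \<zero>\<^bsub>L\<^esub>"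
  "x \<oplus>\<^bsub>restrict_scalars \<phi> L\<^esub> y = x \<oplus>\<^bsub>L\<^esub> y" "r \<odot>\<^bsub>restrict_scalars \<phi> L\<^esub> x = \<phi> r \<odot>\<^bsub>L\<^esub> x"
  by (simp_all add: restrict_scalars_def)

lemma module_restrict_scalars:
  assumes R: "cring R" and \<phi>: "\<phi> \<in> ring_hom R T" and L: "Module.module T L"
  shows "Module.module R (restrict_scalars \<phi> L)"
proof (rule moduleI[OF R])
  interpret L: Module.module T L by fact
  show "abelian_group (restrict_scalars \<phi> L)"
    by (rule abelian_groupI) (auto simp: L.M.a_ac intro: bexI[of _ "\<ominus>\<^bsub>L\<^esub> _"] L.M.l_neg)
qed (use assms ring_hom_closed[OF \<phi>] in \<open>auto simp: ring_hom_add[OF \<phi>] ring_hom_mult[OF \<phi>] ring_hom_one[OF \<phi>]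
    module.smult_l_distr module.smult_r_distr module.smult_assoc1 module.smult_closed module.smult_one\<close>)

lemma msum_restrict_scalars [simp]: "msum (restrict_scalars \<phi> L) f n = msum L f n"
  by (induction n) auto

text \<open>Both sides unfold to the same formula: carrier, zero and sums of \<open>L\<close> are
  unchanged, and \<open>r\<close> acts as \<open>\<phi> r\<close>. For matrices this takes the place
  of the associativity of tensor products under base change.\<close>

lemma mexact_restrict_scalars:
  "mexact (restrict_scalars \<phi> L) k e D i \<longleftrightarrow> mexact L k (\<lambda>i j l. \<phi> (e i j l)) (\<lambda>i j l. \<phi> (D i j l)) i"
  unfolding mexact_def tuples_def mv_def restrict_scalars_simps msum_restrict_scalars ..

text \<open>The identities between matrices survive a ring homomorphism applied to the entries.
  Exactness may be lost, so the claim is about \<open>fp_complex\<close>.\<close>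

lemma fp_complex_base_change:
  assumes R: "cring R" and T: "cring T" and \<phi>: "\<phi> \<in> ring_hom R T" and complex: "fp_complex R k e D"
  shows "fp_complex T k (\<lambda>i j l. \<phi> (e i j l)) (\<lambda>i j l. \<phi> (D i j l))"
proof -
  interpret R: cring R by fact
  interpret T: cring T by fact
  have zero: "\<phi> \<zero>\<^bsub>R\<^esub> = \<zero>\<^bsub>T\<^esub>"
    using ring_hom_zero[OF \<phi>] R.ring_axioms T.ring_axioms by blast
  have msum: "\<phi> (msum R f n) = msum T (\<lambda>p. \<phi> (f p)) n" if "\<And>p. p < n \<Longrightarrow> f p \<in> carrier R" for f n
    using that by (induction n) (auto simp: zero ring_hom_add[OF \<phi>] R.msum_closed)
  have mat: "mat_in T r c (\<lambda>j l. \<phi> (A j l))" if "mat_in R r c A" for r c A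
    using that ring_hom_closed[OF \<phi>] by (auto simp: mat_in_def)
  have prod: "mat_prod T r c d (\<lambda>j l. \<phi> (A j l)) (\<lambda>j l. \<phi> (B j l)) (\<lambda>j l. \<phi> (C j l))"
    if A: "mat_in R r c A" and B: "mat_in R c d B" and AB: "mat_prod R r c d A B C" for r c d A B C
    unfolding mat_prod_def
  proof (intro allI impI)
    fix j l assume j: "j < r" and l: "l < d"
    have c: "A j p \<in> carrier R" "B p l \<in> carrier R" if "p < c" for p
      using A B j l that by (auto simp: mat_in_def)
    have "msum T (\<lambda>p. \<phi> (A j p) \<otimes>\<^bsub>T\<^esub> \<phi> (B p l)) c = msum T (\<lambda>p. \<phi> (A j p \<otimes>\<^bsub>R\<^esub> B p l)) c"
      by (rule msum_cong) (simp add: ring_hom_mult[OF \<phi>] c)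
    also have "\<dots> = \<phi> (msum R (\<lambda>p. A j p \<otimes>\<^bsub>R\<^esub> B p l) c)"
      by (rule msum[symmetric]) (simp add: c)
    also have "\<dots> = \<phi> (C j l)"
      using AB j l by (simp add: mat_prod_def)
    finally show "msum T (\<lambda>p. \<phi> (A j p) \<otimes>\<^bsub>T\<^esub> \<phi> (B p l)) c = \<phi> (C j l)" .
  qed
  have c: "mat_in R (k i) (k i) (e i)" "mat_in R (k i) (k (Suc i)) (D i)"
      "mat_prod R (k i) (k i) (k i) (e i) (e i) (e i)"
      "mat_prod R (k i) (k i) (k (Suc i)) (e i) (D i) (D i)"
      "mat_prod R (k i) (k (Suc i)) (k (Suc i)) (D i) (e (Suc i)) (D i)"
      "mat_prod R (k i) (k (Suc i)) (k (Suc (Suc i))) (D i) (D (Suc i)) (\<lambda>_ _. \<zero>\<^bsub>R\<^esub>)" for i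
    using complex unfolding fp_complex_def by blast+
  have bound: "\<exists>n. \<forall>i>n. k i = 0"
    using complex by (simp add: fp_complex_def)
  show ?thesis
    unfolding fp_complex_def
    using mat[OF c(1)] mat[OF c(2)] prod[OF c(1,1,3)] prod[OF c(1,2,4)] prod[OF c(2,1,5)]
      prod[OF c(2,2,6), unfolded zero] bound
    by blast
qed

lemma FT_fd_le_base_change:
  assumes R: "cring R" and T: "cring T" and \<phi>: "\<phi> \<in> ring_hom R T" and L: "Module.module T L"
    and m: "FT_fd_le R (restrict_scalars \<phi> (ring_as_module T)) m" and n: "FT_fd_le T L n"
  shows "FT_fd_le R (restrict_scalars \<phi> L) (n + m)"
proof (rule FT_fd_leI[OF R module_restrict_scalars[OF R \<phi> L]])
  fix k e D i
  assume res: "fp_resolution R k e D" and i: "n + m \<le> i"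
  let ?k = "\<lambda>i. k (i + m)" and ?e = "\<lambda>i j l. \<phi> (e (i + m) j l)" and ?D = "\<lambda>i j l. \<phi> (D (i + m) j l)"
  note shift = mexact_shift[of _ k m "\<lambda>i j l. \<phi> (e i j l)" "\<lambda>i j l. \<phi> (D i j l)"]
  note TR = module_restrict_scalars[OF R \<phi> cring.module_ring_as_module[OF T]]
  have "fp_complex R ?k (\<lambda>i. e (i + m)) (\<lambda>i. D (i + m))"
    using fp_resolution_shift[OF res] by (simp add: fp_resolution_def)
  from fp_complex_base_change[OF R T \<phi> this] have "fp_complex T ?k ?e ?D" .
  \<comment> \<open>Read through \<open>mexact_restrict_scalars\<close>, the bound for
    \<open>T\<close> as an \<open>R\<close>-module concerns the image matrices with coefficients in
    \<open>T\<close> over itself. The shift by \<open>m\<close> brings every index into the range of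
    that bound.\<close>
  moreover have "mexact (ring_as_module T) ?k ?e ?D i" for i
    using m res unfolding FT_fd_le_iff[OF R TR] mexact_restrict_scalars shift by simp
  ultimately have "fp_resolution T ?k ?e ?D" by (simp add: fp_resolution_def)
  then have "mexact L ?k ?e ?D (i - m)"
    using n i unfolding FT_fd_le_iff[OF T L] by simp
  then show "mexact (restrict_scalars \<phi> L) k e D i"
    using i unfolding mexact_restrict_scalars shift by simp
qed

section \<open>Flat modules have FT-flat dimension zero\<close>

text \<open>\<open>flat_module\<close> tests injections between modules with elements in
  \<open>formal\<close>. The map \<open>g\<close> is moved there along \<open>eK\<close> and
  \<open>eF\<close>, and triviality is brought back along the isomorphism between \<open>K\<close>
  and its copy.\<close>

lemma flat_module_inj:
  fixes M :: "('r, 'm, 'y) module_scheme"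
  assumes flat: "flat_module R M" and K: "Module.module R K" and F: "Module.module R F"
    and eK: "inj_on (eK :: _ \<Rightarrow> ('r, 'm) formal) (carrier K)" and eF: "inj_on (eF :: _ \<Rightarrow> ('r, 'm) formal) (carrier F)"
    and g: "g \<in> module_hom R K F" "inj_on g (carrier K)"
    and X: "X \<in> carrier (tensor R K M)" "tensor_map R F M g X = \<one>\<^bsub>tensor R F M\<^esub>"
  shows "X = \<one>\<^bsub>tensor R K M\<^esub>"
proof -
  let ?A = "image_module K eK" and ?B = "image_module F eF"
  let ?f = "\<lambda>u. eF (g (inv_into (carrier K) eK u))"
  note A = image_module_inj[OF K eK] and B = image_module_inj[OF F eF]
  have M: "Module.module R M" using flat by (simp add: flat_module_def)
  interpret TA: comm_group "tensor R ?A M" by (rule comm_group_tensor[OF A(1) M])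
  note f = module_hom_comp[OF module_hom_comp[OF A(3) g(1)] B(2)]
  have "inj_on ?f (carrier ?A)"
  proof (rule inj_onI)
    fix u v assume "u \<in> carrier ?A" "v \<in> carrier ?A" and eq: "?f u = ?f v"
    then obtain x y where xy: "x \<in> carrier K" "y \<in> carrier K" "u = eK x" "v = eK y" by auto
    then have "eF (g x) = eF (g y)" using eq eK by simp
    then have "x = y"
      using inj_onD[OF eF _ module_hom_closed[OF g(1) xy(1)] module_hom_closed[OF g(1) xy(2)]]
        inj_onD[OF g(2) _ xy(1,2)] by blast
    then show "u = v" using xy by simp
  qed
  then have inj: "inj_on (tensor_map R ?B M ?f) (carrier (tensor R ?A M))"
    using flat A(1) B(1) f unfolding flat_module_def by blast
  let ?Y = "tensor_map R ?A M eK X"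
  have Y: "?Y \<in> carrier (tensor R ?A M)"
    by (rule tensor_map_closed[OF K A(1) M A(2) X(1)])
  have "tensor_map R ?B M ?f ?Y = tensor_map R ?B M (\<lambda>x. ?f (eK x)) X"
    by (rule tensor_map_comp[OF K A(1) B(1) M A(2) f X(1)])
  also have "\<dots> = tensor_map R ?B M (\<lambda>x. eF (g x)) X"
    by (rule tensor_map_cong[OF K B(1) M module_hom_comp[OF A(2) f] module_hom_comp[OF g(1) B(2)] _ X(1)])
      (use eK in simp)
  also have "\<dots> = tensor_map R ?B M eF (tensor_map R F M g X)"
    by (rule tensor_map_comp[OF K F B(1) M g(1) B(2) X(1), symmetric])
  also have "\<dots> = tensor_map R ?B M ?f \<one>\<^bsub>tensor R ?A M\<^esub>"
    by (simp add: X(2) tensor_map_one[OF F B(1) M B(2)] tensor_map_one[OF A(1) B(1) M f])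
  finally have "?Y = \<one>\<^bsub>tensor R ?A M\<^esub>"
    using inj Y by (auto simp: inj_on_def)
  then have "tensor_map R K M (inv_into (carrier K) eK) ?Y = \<one>\<^bsub>tensor R K M\<^esub>"
    by (simp add: tensor_map_one[OF A(1) K M A(3)])
  moreover have "tensor_map R K M (inv_into (carrier K) eK) ?Y = tensor_map R K M (\<lambda>x. x) X"
    unfolding tensor_map_comp[OF K A(1) K M A(2,3) X(1)]
    by (rule tensor_map_cong[OF K K M module_hom_comp[OF A(2,3)] module_hom_id _ X(1)]) (use eK in simp)
  ultimately show ?thesis
    by (simp add: tensor_map_id[OF K M X(1)])
qed

text \<open>The tensor product of the image of \<open>D\<^sub>0\<close> with \<open>M\<close> maps onto the cokernel of \<open>D\<^sub>1\<close> with
  coefficients in \<open>M\<close>; this is the right exactness needed to use injectivity of the inclusion of that image.\<close>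

lemma flat_mexact:
  fixes R :: "('r, 'x) ring_scheme" and M :: "('r, 'm, 'y) module_scheme"
  assumes R: "cring R" and flat: "flat_module R M" and res: "fp_resolution R k e D"
  shows "mexact M k e D 0"
  unfolding mexact_def
proof (intro ballI impI)
  interpret R: cring R by fact
  have M: "Module.module R M" using flat by (simp add: flat_module_def)
  interpret M: Module.module R M by fact
  let ?Rm = "ring_as_module R"
  have complex: "fp_complex R k e D" and exact: "mexact ?Rm k e D 0"
    using res by (auto simp: fp_resolution_def)
  note mat = fp_complex_mat[OF complex]
  let ?k0 = "k 0" and ?k1 = "k (Suc 0)" and ?k2 = "k (Suc (Suc 0))"
  let ?e = "e (Suc 0)" and ?D1 = "D (Suc 0)"
  let ?F0 = "free_module R {..<?k0}" and ?F1 = "free_module R {..<?k1}"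
  \<comment> \<open>The differential is taken on the whole free module, not on the image of
    \<open>?e\<close>. Its kernel therefore consists of the tuples that \<open>?e\<close> sends into
    the range of \<open>?D1\<close>.\<close>
  define d where "d = mv ?Rm ?k0 ?k1 (D 0)"
  have F: "Module.module R ?F0" "Module.module R ?F1" by (rule R.module_free_module)+
  interpret F1: Module.module R ?F1 by (rule F)
  have d: "d \<in> module_hom R ?F1 ?F0"
    unfolding d_def by (rule R.mv_module_hom_free[OF mat(2)])
  let ?K = "?F0\<lparr>carrier := d ` carrier ?F1\<rparr>"
  have Ksub: "d ` carrier ?F1 \<subseteq> carrier ?F0"
    using module_hom_closed[OF d] by auto
  have K: "Module.module R ?K" by (rule image_submodule[OF F(2,1) d])
  have dK: "d \<in> module_hom R ?F1 ?K" by (rule module_hom_restrict[OF d Ksub]) simp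
  have incl: "(\<lambda>u. u) \<in> module_hom R ?K ?F0" by (rule module_hom_incl[OF Ksub])
  have free: "retract_free R ?F1 {..<?k1} (\<lambda>u. u) (\<lambda>u. u)" "retract_free R ?F0 {..<?k0} (\<lambda>u. u) (\<lambda>u. u)"
    by (rule R.retract_free_free_module)+
  let ?G = "tuple_group M ?k1"
  interpret G: comm_group ?G by (rule M.comm_group_tuple_group)
  \<comment> \<open>The goal is that the given cycle \<open>x\<close> lies in \<open>H\<close>. The
    quotient by \<open>H\<close> is the cokernel of the differential \<open>?D1\<close> with
    coefficients in \<open>M\<close>; membership is tested after \<open>?e\<close>, in accordance
    with the kernel of \<open>d\<close>.\<close>
  define H where "H = {z \<in> tuples M ?k1. \<exists>y\<in>tuples M ?k2. mv M ?k1 ?k1 ?e z = mv M ?k1 ?k2 ?D1 y}"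
  have inv_G: "inv\<^bsub>?G\<^esub> z = (\<lambda>i. \<ominus>\<^bsub>M\<^esub> z i)" if "z \<in> tuples M ?k1" for z
    by (rule G.inv_equality) (use that in \<open>auto simp: M.tuples_minus M.tuples_closed M.M.l_neg\<close>)
  have H: "subgroup H ?G"
  proof (rule G.subgroupI)
    show "H \<subseteq> carrier ?G" by (auto simp: H_def)
    have "(\<lambda>_. \<zero>\<^bsub>M\<^esub>) \<in> H"
      using M.mv_zero_tuple[OF mat(1)] M.mv_zero_tuple[OF mat(2)] M.tuples_zero
      unfolding H_def by (intro CollectI conjI bexI[of _ "\<lambda>_. \<zero>\<^bsub>M\<^esub>"]) simp_all
    then show "H \<noteq> {}" by blast
    fix a assume "a \<in> H"
    then obtain y where a: "a \<in> tuples M ?k1" and y: "y \<in> tuples M ?k2" "mv M ?k1 ?k1 ?e a = mv M ?k1 ?k2 ?D1 y"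
      by (auto simp: H_def)
    show "inv\<^bsub>?G\<^esub> a \<in> H"
      unfolding inv_G[OF a] H_def
      using M.tuples_minus[OF a] M.tuples_minus[OF y(1)] M.mv_minus[OF mat(1) a] M.mv_minus[OF mat(2) y(1)] y(2)
      by (intro CollectI conjI bexI[of _ "\<lambda>i. \<ominus>\<^bsub>M\<^esub> y i"]) simp_all
    fix b assume "b \<in> H"
    then obtain z where b: "b \<in> tuples M ?k1" and z: "z \<in> tuples M ?k2" "mv M ?k1 ?k1 ?e b = mv M ?k1 ?k2 ?D1 z"
      by (auto simp: H_def)
    show "a \<otimes>\<^bsub>?G\<^esub> b \<in> H"
      using M.tuples_add[OF a b] M.tuples_add[OF y(1) z(1)] M.mv_add[OF mat(1) a b] M.mv_add[OF mat(2) y(1) z(1)] y(2) z(2)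
      unfolding H_def by (intro CollectI conjI bexI[of _ "\<lambda>i. y i \<oplus>\<^bsub>M\<^esub> z i"]) simp_all
  qed
  let ?Q = "?G Mod H"
  interpret Q: comm_group ?Q by (rule G.abelian_FactGroup[OF H])
  have normal: "H \<lhd> ?G" by (rule G.subgroup_imp_normal[OF H])
  have sum: "(H #>\<^bsub>?G\<^esub> x) \<otimes>\<^bsub>?Q\<^esub> (H #>\<^bsub>?G\<^esub> y) = H #>\<^bsub>?G\<^esub> (\<lambda>i. x i \<oplus>\<^bsub>M\<^esub> y i)"
    if "x \<in> tuples M ?k1" "y \<in> tuples M ?k1" for x y
    using normal.rcos_sum[OF normal, of x y] that by simp
  have scale: "(\<lambda>s. s \<odot>\<^bsub>M\<^esub> m) \<in> module_hom R ?Rm M" if "m \<in> carrier M" for m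
    using that by (auto intro!: module_homI simp: M.smult_l_distr M.smult_assoc1)
  \<comment> \<open>The class of the tensor of \<open>a\<close> and \<open>m\<close> in that
    cokernel. By exactness over \<open>R\<close> it depends on \<open>a\<close> only through
    \<open>d a\<close>, so it is defined on the image of \<open>d\<close>.\<close>
  define c where "c a m = H #>\<^bsub>?G\<^esub> (\<lambda>j. a j \<odot>\<^bsub>M\<^esub> m)" for a m
  note Rm = R.module_ring_as_module
  have scale_tuple: "(\<lambda>j. a j \<odot>\<^bsub>M\<^esub> m) \<in> tuples M ?k1" if "a \<in> carrier ?F1" "m \<in> carrier M" for a m
    using tuples_module_hom[OF Rm M scale[OF that(2)]] that(1) by (simp add: carrier_free_module_tuples)
  have kernel_H: "(\<lambda>j. a j \<odot>\<^bsub>M\<^esub> m) \<in> H"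
    if a: "a \<in> carrier ?F1" "d a = (\<lambda>_. \<zero>\<^bsub>R\<^esub>)" and m: "m \<in> carrier M" for a m
  proof -
    have aT: "a \<in> tuples ?Rm ?k1" using a(1) by (simp add: carrier_free_module_tuples)
    then obtain b where b: "b \<in> tuples ?Rm ?k2" "mv ?Rm ?k1 ?k1 ?e a = mv ?Rm ?k1 ?k2 ?D1 b"
      using exact a(2) unfolding mexact_def d_def by auto
    have "mv M ?k1 ?k1 ?e (\<lambda>j. a j \<odot>\<^bsub>M\<^esub> m) = mv M ?k1 ?k2 ?D1 (\<lambda>j. b j \<odot>\<^bsub>M\<^esub> m)"
      using mv_module_hom[OF Rm M scale[OF m] mat(1) aT] mv_module_hom[OF Rm M scale[OF m] mat(2) b(1)] b(2) by simp
    then show ?thesis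
      using scale_tuple[OF a(1) m] tuples_module_hom[OF Rm M scale[OF m] b(1)] unfolding H_def by blast
  qed
  have c_eq: "c a m = c a' m"
    if a: "a \<in> carrier ?F1" and a': "a' \<in> carrier ?F1" and eq: "d a = d a'" and m: "m \<in> carrier M" for a a' m
  proof -
    let ?b = "a' \<ominus>\<^bsub>?F1\<^esub> a"
    interpret F0: Module.module R ?F0 by (rule F)
    have b: "?b \<in> carrier ?F1" using a a' by simp
    have "d ?b = \<zero>\<^bsub>?F0\<^esub>"
      using module_hom_closed[OF d a'] eq by (simp only: module_hom_diff[OF F(2,1) d a' a] F0.diff_eq_zero_iff)
    then have bH: "(\<lambda>j. ?b j \<odot>\<^bsub>M\<^esub> m) \<in> H" using kernel_H[OF b _ m] by simp
    have "?b \<oplus>\<^bsub>?F1\<^esub> a = a'"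
      using a a' by (simp only: a_minus_def F1.M.a_assoc F1.M.l_neg F1.M.a_inv_closed F1.M.r_zero)
    then have "?b j \<oplus>\<^bsub>R\<^esub> a j = a' j" for j by (simp add: fun_eq_iff)
    then have "(\<lambda>j. ?b j \<odot>\<^bsub>M\<^esub> m) \<otimes>\<^bsub>?G\<^esub> (\<lambda>j. a j \<odot>\<^bsub>M\<^esub> m) = (\<lambda>j. a' j \<odot>\<^bsub>M\<^esub> m)"
      using m R.free_module_closed[OF a] R.free_module_closed[OF b] by (simp add: M.smult_l_distr[symmetric])
    then have "(\<lambda>j. a' j \<odot>\<^bsub>M\<^esub> m) \<in> H #>\<^bsub>?G\<^esub> (\<lambda>j. a j \<odot>\<^bsub>M\<^esub> m)"
      unfolding r_coset_def using bH by (metis (no_types, lifting) UN_iff singletonI)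
    then show ?thesis
      unfolding c_def using scale_tuple[OF a m] by (intro G.repr_independence[OF _ _ H]) simp_all
  qed
  have c_closed: "c a m \<in> carrier ?Q" if "a \<in> carrier ?F1" "m \<in> carrier M" for a m
    unfolding c_def carrier_FactGroup using scale_tuple[OF that] by simp
  have c_add: "c (a \<oplus>\<^bsub>?F1\<^esub> a') m = c a m \<otimes>\<^bsub>?Q\<^esub> c a' m"
    if "a \<in> carrier ?F1" "a' \<in> carrier ?F1" "m \<in> carrier M" for a a' m
    unfolding c_def sum[OF scale_tuple[OF that(1,3)] scale_tuple[OF that(2,3)]]
    using R.free_module_closed[OF that(1)] R.free_module_closed[OF that(2)] that(3) by (simp add: M.smult_l_distr)
  have c_add_right: "c a (m \<oplus>\<^bsub>M\<^esub> m') = c a m \<otimes>\<^bsub>?Q\<^esub> c a m'"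
    if "a \<in> carrier ?F1" "m \<in> carrier M" "m' \<in> carrier M" for a m m'
    unfolding c_def sum[OF scale_tuple[OF that(1,2)] scale_tuple[OF that(1,3)]]
    using R.free_module_closed[OF that(1)] that(2,3) by (simp add: M.smult_r_distr)
  have c_smult: "c (s \<odot>\<^bsub>?F1\<^esub> a) m = c a (s \<odot>\<^bsub>M\<^esub> m)"
    if "s \<in> carrier R" "a \<in> carrier ?F1" "m \<in> carrier M" for s a m
    unfolding c_def using R.free_module_closed[OF that(2)] that(1,3)
    by (simp add: M.smult_assoc1[symmetric] R.m_comm)
  define \<sigma> where "\<sigma> = inv_into (carrier ?F1) d"
  have \<sigma>: "\<sigma> u \<in> carrier ?F1" "d (\<sigma> u) = u" if "u \<in> carrier ?K" for u
    using that by (auto simp: \<sigma>_def inv_into_into f_inv_into_f)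
  have \<sigma>d: "c (\<sigma> (d a)) m = c a m" if "a \<in> carrier ?F1" "m \<in> carrier M" for a m
    using \<sigma>[of "d a"] that by (intro c_eq) auto
  \<comment> \<open>The homomorphism through which the quotient map to the cokernel factors:
    composed with \<open>d \<otimes> id\<close> it is this quotient map, in coordinates.
    Independence of the section \<open>\<sigma>\<close>, stated as \<open>\<sigma>d\<close>, gives
    bilinearity.\<close>
  obtain h where h: "h \<in> hom (tensor R ?K M) ?Q"
    "\<And>u m. u \<in> carrier ?K \<Longrightarrow> m \<in> carrier M \<Longrightarrow> h (tens R ?K M u m) = c (\<sigma> u) m"
  proof (rule tensor_universal[OF K M Q.comm_group_axioms, of "\<lambda>u m. c (\<sigma> u) m"])
    fix u m assume u: "u \<in> carrier ?K" and m: "m \<in> carrier M"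
    show "c (\<sigma> u) m \<in> carrier ?Q" by (rule c_closed[OF \<sigma>(1)[OF u] m])
    show "c (\<sigma> u) (m \<oplus>\<^bsub>M\<^esub> m') = c (\<sigma> u) m \<otimes>\<^bsub>?Q\<^esub> c (\<sigma> u) m'" if "m' \<in> carrier M" for m'
      by (rule c_add_right[OF \<sigma>(1)[OF u] m that])
    show "c (\<sigma> (u \<oplus>\<^bsub>?K\<^esub> v)) m = c (\<sigma> u) m \<otimes>\<^bsub>?Q\<^esub> c (\<sigma> v) m" if v: "v \<in> carrier ?K" for v
    proof -
      have "u \<oplus>\<^bsub>?K\<^esub> v = d (\<sigma> u \<oplus>\<^bsub>?F1\<^esub> \<sigma> v)"
        unfolding module_hom_add[OF dK \<sigma>(1)[OF u] \<sigma>(1)[OF v]] \<sigma>(2)[OF u] \<sigma>(2)[OF v] ..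
      then show ?thesis
        using \<sigma>d[OF F1.M.a_closed[OF \<sigma>(1)[OF u] \<sigma>(1)[OF v]] m] c_add[OF \<sigma>(1)[OF u] \<sigma>(1)[OF v] m]
        by (simp only:)
    qed
    show "c (\<sigma> (s \<odot>\<^bsub>?K\<^esub> u)) m = c (\<sigma> u) (s \<odot>\<^bsub>M\<^esub> m)" if s: "s \<in> carrier R" for s
    proof -
      have "s \<odot>\<^bsub>?K\<^esub> u = d (s \<odot>\<^bsub>?F1\<^esub> \<sigma> u)"
        unfolding module_hom_smult[OF dK s \<sigma>(1)[OF u]] \<sigma>(2)[OF u] ..
      then show ?thesis
        using \<sigma>d[OF F1.smult_closed[OF s \<sigma>(1)[OF u]] m] c_smult[OF s \<sigma>(1)[OF u] m]
        by (simp only:)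
    qed
  qed (rule that)
  obtain \<Psi>1 where \<Psi>1: "\<Psi>1 \<in> hom (tensor R ?F1 M) ?G"
    "\<And>a m. a \<in> carrier ?F1 \<Longrightarrow> m \<in> carrier M \<Longrightarrow> \<Psi>1 (tens R ?F1 M a m) = (\<lambda>j. a j \<odot>\<^bsub>M\<^esub> m)"
    by (rule tuple_of_tensor[OF free(1) M]) metis
  obtain \<Psi>0 where \<Psi>0: "\<Psi>0 \<in> hom (tensor R ?F0 M) (tuple_group M ?k0)"
    "\<And>a m. a \<in> carrier ?F0 \<Longrightarrow> m \<in> carrier M \<Longrightarrow> \<Psi>0 (tens R ?F0 M a m) = (\<lambda>j. a j \<odot>\<^bsub>M\<^esub> m)"
    "\<And>X. X \<in> carrier (tensor R ?F0 M) \<Longrightarrow> tens_of_tuple R ?F0 M ?k0 (\<lambda>u. u) (\<Psi>0 X) = X"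
    by (rule tuple_of_tensor[OF free(2) M]) metis
  have hd: "h (tensor_map R ?K M d X) = H #>\<^bsub>?G\<^esub> \<Psi>1 X" if X: "X \<in> carrier (tensor R ?F1 M)" for X
  proof (rule tensor_hom_eqI[OF F(2) M Q.is_group _ _ _ X])
    show "(\<lambda>X. h (tensor_map R ?K M d X)) \<in> hom (tensor R ?F1 M) ?Q"
      using hom_compose[OF tensor_map_hom[OF F(2) K M dK] h(1)] by (simp add: o_def)
    show "(\<lambda>X. H #>\<^bsub>?G\<^esub> \<Psi>1 X) \<in> hom (tensor R ?F1 M) ?Q"
      using hom_compose[OF \<Psi>1(1) normal.r_coset_hom_Mod[OF normal]] by (simp add: o_def)
    fix a m assume a: "a \<in> carrier ?F1" and m: "m \<in> carrier M"
    show "h (tensor_map R ?K M d (tens R ?F1 M a m)) = H #>\<^bsub>?G\<^esub> \<Psi>1 (tens R ?F1 M a m)"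
      using a m by (simp add: tensor_map_tens[OF F(2) K M dK] h(2) \<sigma>d \<Psi>1(2) c_def[symmetric])
  qed
  fix x assume x: "x \<in> tuples M ?k1" and zero: "mv M ?k0 ?k1 (D 0) x = (\<lambda>_. \<zero>\<^bsub>M\<^esub>)"
  let ?X = "tens_of_tuple R ?F1 M ?k1 (\<lambda>u. u) x"
  have X: "?X \<in> carrier (tensor R ?F1 M)"
    by (rule tens_of_tuple_closed[OF free(1) M x])
  have "\<Psi>0 (tensor_map R ?F0 M d ?X) = mv M ?k0 ?k1 (D 0) x"
    by (rule tuple_of_tensor_map[OF free M d \<Psi>0(1,2) _ x]) (simp_all add: d_def R.mv_delta[OF mat(2)])
  then have "tensor_map R ?F0 M d ?X = \<one>\<^bsub>tensor R ?F0 M\<^esub>"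
    using \<Psi>0(3)[OF tensor_map_closed[OF F(2,1) M d X]] tens_of_tuple_zero[OF free(2) M] zero by metis
  \<comment> \<open>The tensor of the cycle dies in \<open>?F0 \<otimes> M\<close>. By flatness the
    inclusion of the image \<open>?K\<close> stays injective after tensoring, so it dies in
    \<open>?K \<otimes> M\<close> already, and \<open>h\<close> then kills the class of
    \<open>x\<close>.\<close>
  then have "tensor_map R ?F0 M (\<lambda>u. u) (tensor_map R ?K M d ?X) = \<one>\<^bsub>tensor R ?F0 M\<^esub>"
    by (simp add: tensor_map_comp[OF F(2) K F(1) M dK incl X])
  moreover have "inj_on (formal_tuple ?k0 :: _ \<Rightarrow> ('r, 'm) formal) (carrier ?K)"
    using inj_on_subset[OF inj_on_formal_tuple Ksub] by simp
  ultimately have "tensor_map R ?K M d ?X = \<one>\<^bsub>tensor R ?K M\<^esub>"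
    by (intro flat_module_inj[OF flat K F(1) _ inj_on_formal_tuple incl _ tensor_map_closed[OF F(2) K M dK X]]) auto
  then have "H #>\<^bsub>?G\<^esub> \<Psi>1 ?X = H"
    using hd[OF X] hom_one[OF h(1) group_tensor[OF K M] Q.is_group] by simp
  moreover have "\<Psi>1 ?X = x"
  proof -
    \<comment> \<open>For the free module with its trivial splitting the idempotent is the identity
      matrix, so the coordinates of the tensor of \<open>x\<close> are \<open>x\<close>
      again.\<close>
    have "\<Psi>1 (tensor_map R ?F1 M (\<lambda>u. u) ?X) = mv M ?k1 ?k1 (\<lambda>j l. delta R l j) x"
      by (rule tuple_of_tensor_map[OF free(1,1) M module_hom_id \<Psi>1 _ x]) simp_all
    also have "\<dots> = x"
    proof
      fix j
      have "msum M (\<lambda>l. delta R l j \<odot>\<^bsub>M\<^esub> x l) ?k1 = msum M (\<lambda>l. if l = j then x j else \<zero>\<^bsub>M\<^esub>) ?k1"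
        using M.tuples_closed[OF x] by (intro msum_cong) (auto simp: delta_def)
      then show "mv M ?k1 ?k1 (\<lambda>j l. delta R l j) x j = x j"
        using x by (auto simp: mv_def M.M.msum_single tuples_def)
    qed
    finally show ?thesis by (simp add: tensor_map_id[OF F(2) M X])
  qed
  ultimately have "x \<in> H"
    using G.coset_join1[OF _ _ H, of x] x subgroup.subset[OF H] by simp
  then show "\<exists>y\<in>tuples M ?k2. mv M ?k1 ?k1 ?e x = mv M ?k1 ?k2 ?D1 y"
    by (simp add: H_def)
qed

text \<open>Vanishing in degree one for the shifted data gives vanishing in all positive
  degrees.\<close>

lemma flat_FT_fd_le_0:
  assumes "cring R" "flat_module R M"
  shows "FT_fd_le R M 0"
proof (rule FT_fd_leI[OF assms(1)])
  show "Module.module R M" using assms(2) by (simp add: flat_module_def)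
  fix k e D i assume "fp_resolution R k e D"
  from flat_mexact[OF assms fp_resolution_shift[OF this, of i]] show "mexact M k e D i"
    using mexact_shift[of M k i e D 0] by simp
qed

section \<open>From bounds to the dimension as an extended natural number\<close>

text \<open>An infimum of a nonempty set in \<open>enat\<close> is attained, by well-ordering; the
  empty set gives \<open>\<infinity>\<close>. In the latter case the base change inequality is
  trivial.\<close>

lemma FT_fd_cases:
  obtains "FT_fd R M = \<infinity>" | n where "FT_fd R M = enat n" "FT_fd_le R M n"
proof (cases "{n. FT_fd_le R M n} = {}")
  case True
  then show thesis by (intro that(1)) (simp add: FT_fd_def Inf_enat_def)
next
  case False
  then have "FT_fd R M \<in> enat ` {n. FT_fd_le R M n}"
    unfolding FT_fd_def by (intro wellorder_InfI[of "enat (SOME n. FT_fd_le R M n)"]) (auto intro: someI)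
  then show thesis using that(2) by auto
qed

lemma FT_fd_le: "FT_fd_le R M n \<Longrightarrow> FT_fd R M \<le> enat n"
  unfolding FT_fd_def by (rule Inf_lower) simp

lemma FT_fd_base_change:
  assumes "cring R" "cring T" "\<phi> \<in> ring_hom R T" "Module.module T L"
  shows "FT_fd R (restrict_scalars \<phi> L) \<le> FT_fd T L + FT_fd R (restrict_scalars \<phi> (ring_as_module T))"
proof (rule FT_fd_cases[of T L])
  fix n assume n: "FT_fd T L = enat n" "FT_fd_le T L n"
  show ?thesis
  proof (rule FT_fd_cases[of R "restrict_scalars \<phi> (ring_as_module T)"])
    fix m assume m: "FT_fd R (restrict_scalars \<phi> (ring_as_module T)) = enat m"
      "FT_fd_le R (restrict_scalars \<phi> (ring_as_module T)) m"
    from FT_fd_le[OF FT_fd_le_base_change[OF assms m(2) n(2)]] show ?thesis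
      by (simp add: n m)
  qed simp
qed simp

theorem theorem2p6:
  fixes R :: "('r, 'a) ring_scheme" and T :: "('t, 'b) ring_scheme" and \<phi> :: "'r \<Rightarrow> 't"
  assumes "cring R" and "cring T" and "\<phi> \<in> ring_hom R T"
  shows "(flat_module R (restrict_scalars \<phi> (ring_as_module T)) \<longrightarrow>
           (\<forall>L :: ('t, 'l) module. Module.module T L \<longrightarrow>
              FT_fd R (restrict_scalars \<phi> L) \<le> FT_fd T L)) \<and>
         (\<forall>L :: ('t, 'l) module. Module.module T L \<longrightarrow>
              FT_fd R (restrict_scalars \<phi> L)
                \<le> FT_fd T L + FT_fd R (restrict_scalars \<phi> (ring_as_module T)))"
proof (intro conjI impI allI)
  fix L :: "('t, 'l) module" assume L: "Module.module T L"
  note base_change = FT_fd_base_change[OF assms L]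
  show "FT_fd R (restrict_scalars \<phi> L) \<le> FT_fd T L + FT_fd R (restrict_scalars \<phi> (ring_as_module T))"
    by (rule base_change)
  assume "flat_module R (restrict_scalars \<phi> (ring_as_module T))"
  \<comment> \<open>Flatness makes the second summand of the base change inequality zero.\<close>
  from FT_fd_le[OF flat_FT_fd_le_0[OF assms(1) this]] base_change
  show "FT_fd R (restrict_scalars \<phi> L) \<le> FT_fd T L"
    by (simp add: zero_enat_def[symmetric])
qed

end
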